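(* Let $k$ be an algebraically closed field of characteristic $2$. Let $\mathfrak{M}$ be a finite group of order $3\cdot 2^n$ for an integer $n\ge 3$. Assume that $\mathfrak{M}$ is of $2$-length $2$ and $O_{2'}(\mathfrak{M})=1$. Let $P$ be a Sylow $2$-subgroup of $\mathfrak{M}$ and $\mathcal{F}=\mathcal{F}_P(\mathfrak{M})$. Let $G=\mathrm{Park}(\mathcal{F},\mathfrak{M})$ be Park's group and let $\iota:P\hookrightarrow G$ be Park's embedding. Then the Scott $kG$-module $\mathrm{Sc}(G,\iota P)$ with vertex $\iota P$ is Brauer indecomposable.
   Context: Modules are finitely generated left modules. Here $p=2$. $O_{2'}(X)$ is the largest normal subgroup of odd order of a finite group $X$, and $O_2(X)$ the largest normal $2$-subgroup. The $2$-length of a ($2$-)solvable finite group $X$ is the number of nontrivial $2$-factors in its upper $2$-series $1\le O_{2'}(X)\le O_{2',2}(X)\le O_{2',2,2'}(X)\le\cdots$. Fusion system: for a finite group $X$ and a $p$-subgroup $P\le X$, $\mathcal{F}_P(X)$ is the category whose objects are the subgroups of $P$ and whose morphisms $Q\to R$ are the group homomorphisms induced by conjugation by elements of $X$. Park's group: regard $\mathfrak{M}$ as a $P$-$P$-biset via left and right multiplication. $\mathrm{Park}(\mathcal{F},\mathfrak{M})$ is the group (under composition) of all bijections $f:\mathfrak{M}\to\mathfrak{M}$ preserving the right $P$-action, i.e. $f(mu)=f(m)u$ for all $m\in\mathfrak{M}$, $u\in P$. Park's embedding $\iota:P\to G$ is $\iota(u)=(m\mapsto um)$, and $\iota P$ denotes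 its image. Scott module: for a finite group $G$ and a subgroup $H\le G$, $\mathrm{Sc}(G,H)$ is the (unique up to isomorphism) indecomposable direct summand of $\mathrm{Ind}_H^G(k_H)$ having the trivial module $k_G$ in its socle, where $k_H$ is the trivial $kH$-module. Brauer quotient: for a $kG$-module $M$ and a $p$-subgroup $Q\le G$, $M(Q)=M^Q/\sum_{R<Q}\mathrm{Tr}_R^Q(M^R)$, where $M^Q$ is the set of $Q$-fixed points, $R$ runs over proper subgroups of $Q$, and $\mathrm{Tr}_R^Q:M^R\to M^Q$ is the trace map; it is naturally a $kN_G(Q)$-module. Brauer indecomposability: $M$ is Brauer indecomposable if for every $p$-subgroup $Q$ of $G$, $M(Q)$ is indecomposable or zero as a $k(Q\,C_G(Q))$-module. *)

theory Defs
  imports "HOL-Algebra.Algebra"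
begin

text \<open>The additive order of 1; \<open>group.ord\<close> is 0 for elements of infinite order.\<close>

definition ring_char :: "('a, 'm) ring_scheme \<Rightarrow> nat" where
  "ring_char R = group.ord (add_monoid R) \<one>\<^bsub>R\<^esub>"

section \<open>Finite groups\<close>

definition p_subgroup :: "nat \<Rightarrow> ('a, 'm) monoid_scheme \<Rightarrow> 'a set \<Rightarrow> bool" where
  "p_subgroup p G Q \<longleftrightarrow> subgroup Q G \<and> (\<exists>n. card Q = p ^ n)"

definition sylow_subgroup :: "nat \<Rightarrow> ('a, 'm) monoid_scheme \<Rightarrow> 'a set \<Rightarrow> bool" where
  "sylow_subgroup p G P \<longleftrightarrow> subgroup P G \<and> card P = p ^ multiplicity p (order G)"

definition centralizer :: "('a, 'm) monoid_scheme \<Rightarrow> 'a set \<Rightarrow> 'a set" where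
  "centralizer G Q = {g \<in> carrier G. \<forall>x\<in>Q. g \<otimes>\<^bsub>G\<^esub> x = x \<otimes>\<^bsub>G\<^esub> g}"

text \<open>\<open>O\<^sub>p(G)\<close> and \<open>O\<^sub>p\<^sub>'(G)\<close> for a finite group \<open>G\<close>; the order is inclusion of subsets.\<close>

definition p_core :: "nat \<Rightarrow> ('a, 'm) monoid_scheme \<Rightarrow> 'a set" where
  "p_core p G = (GREATEST N. N \<lhd> G \<and> (\<exists>n. card N = p ^ n))"

definition p'_core :: "nat \<Rightarrow> ('a, 'm) monoid_scheme \<Rightarrow> 'a set" where
  "p'_core p G = (GREATEST N. N \<lhd> G \<and> coprime p (card N))"

text \<open>The terms of the upper \<open>p\<close>-series \<open>1 \<le> O\<^sub>p\<^sub>'(G) \<le> O\<^sub>p\<^sub>'\<^sub>,\<^sub>p(G) \<le> \<dots>\<close>.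
  An element of \<open>G Mod N\<close> is a coset, so the union of a subgroup of \<open>G Mod N\<close> is its
  preimage in \<open>G\<close>.\<close>

primrec upper_p_series :: "nat \<Rightarrow> ('a, 'm) monoid_scheme \<Rightarrow> nat \<Rightarrow> 'a set" where
  "upper_p_series p G 0 = {\<one>\<^bsub>G\<^esub>}"
| "upper_p_series p G (Suc i) =
     \<Union> ((if even i then p'_core p else p_core p) (G Mod upper_p_series p G i))"

text \<open>The \<open>p\<close>-factors of the series are those from an odd index to the next one.
  The notion is meant for finite \<open>p\<close>-solvable \<open>G\<close>.\<close>

definition p_length :: "nat \<Rightarrow> ('a, 'm) monoid_scheme \<Rightarrow> nat" where
  "p_length p G = card {i. odd i \<and> upper_p_series p G i \<noteq> upper_p_series p G (Suc i)}"

section \<open>Fusion systems and Park's group\<close>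

text \<open>A category of subgroups of a group \<open>fs_group\<close>; the objects are all these subgroups and
  \<open>fs_hom Q R\<close> is the set of morphisms from \<open>Q\<close> to \<open>R\<close>, as extensional functions on \<open>Q\<close>.\<close>

record 'a fusion_system =
  fs_group :: "'a set"
  fs_hom :: "'a set \<Rightarrow> 'a set \<Rightarrow> ('a \<Rightarrow> 'a) set"

definition group_fusion_system :: "('a, 'm) monoid_scheme \<Rightarrow> 'a set \<Rightarrow> 'a fusion_system" where
  "group_fusion_system G P =
    \<lparr>fs_group = P,
     fs_hom = (\<lambda>Q R. {\<phi>. subgroup Q G \<and> subgroup R G \<and> Q \<subseteq> P \<and> R \<subseteq> P \<and>
       (\<exists>x\<in>carrier G. \<phi> = (\<lambda>u\<in>Q. x \<otimes>\<^bsub>G\<^esub> u \<otimes>\<^bsub>G\<^esub> inv\<^bsub>G\<^esub> x) \<and> \<phi> ` Q \<subseteq> R)})\<rparr>"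

text \<open>\<open>Park(F, M)\<close>, for a fusion system \<open>F\<close> on a subgroup of \<open>M\<close>. Only the underlying group
  of \<open>F\<close> matters.\<close>

definition park_group :: "'a fusion_system \<Rightarrow> ('a, 'm) monoid_scheme \<Rightarrow> ('a \<Rightarrow> 'a) monoid" where
  "park_group F M = (BijGroup (carrier M))
    \<lparr>carrier := {f \<in> Bij (carrier M).
       \<forall>m\<in>carrier M. \<forall>u\<in>fs_group F. f (m \<otimes>\<^bsub>M\<^esub> u) = f m \<otimes>\<^bsub>M\<^esub> u}\<rparr>"

definition park_embedding :: "('a, 'm) monoid_scheme \<Rightarrow> 'a \<Rightarrow> ('a \<Rightarrow> 'a)" where
  "park_embedding M u = (\<lambda>m\<in>carrier M. u \<otimes>\<^bsub>M\<^esub> m)"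

section \<open>Modules over group algebras\<close>

text \<open>A \<open>kG\<close>-module is a \<open>k\<close>-module together with a \<open>k\<close>-linear action of \<open>G\<close>. The fields
  \<open>mult\<close> and \<open>one\<close>, inherited from the record \<open>module\<close>, carry no information.\<close>

record ('k, 'v, 'g) gmodule = "('k, 'v) module" +
  act :: "'g \<Rightarrow> 'v \<Rightarrow> 'v"

definition kG_submodule ::
  "('k, 'n) ring_scheme \<Rightarrow> ('g, 'm) monoid_scheme \<Rightarrow> ('k, 'v, 'g) gmodule \<Rightarrow> 'v set \<Rightarrow> bool" where
  "kG_submodule K G V W \<longleftrightarrow>
     submodule W K V \<and> (\<forall>g\<in>carrier G. \<forall>w\<in>W. act V g w \<in> W)"

definition kG_module ::
  "('k, 'n) ring_scheme \<Rightarrow> ('g, 'm) monoid_scheme \<Rightarrow> ('k, 'v, 'g) gmodule \<Rightarrow> bool" where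
  "kG_module K G V \<longleftrightarrow>
     module K V \<and> group G \<and>
     (\<forall>g\<in>carrier G. \<forall>v\<in>carrier V. act V g v \<in> carrier V) \<and>
     (\<forall>g\<in>carrier G. \<forall>v\<in>carrier V. \<forall>w\<in>carrier V.
        act V g (v \<oplus>\<^bsub>V\<^esub> w) = act V g v \<oplus>\<^bsub>V\<^esub> act V g w) \<and>
     (\<forall>g\<in>carrier G. \<forall>a\<in>carrier K. \<forall>v\<in>carrier V.
        act V g (a \<odot>\<^bsub>V\<^esub> v) = a \<odot>\<^bsub>V\<^esub> act V g v) \<and>
     (\<forall>v\<in>carrier V. act V \<one>\<^bsub>G\<^esub> v = v) \<and>
     (\<forall>g\<in>carrier G. \<forall>h\<in>carrier G. \<forall>v\<in>carrier V.
        act V (g \<otimes>\<^bsub>G\<^esub> h) v = act V g (act V h v)) \<and>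
     (\<exists>S. finite S \<and> S \<subseteq> carrier V \<and>
        (\<forall>W. kG_submodule K G V W \<and> S \<subseteq> W \<longrightarrow> W = carrier V))"

definition kG_iso ::
  "('k, 'n) ring_scheme \<Rightarrow> ('g, 'm) monoid_scheme \<Rightarrow> ('k, 'v, 'g) gmodule \<Rightarrow>
    ('k, 'w, 'g) gmodule \<Rightarrow> ('v \<Rightarrow> 'w) \<Rightarrow> bool" where
  "kG_iso K G V W \<phi> \<longleftrightarrow>
     bij_betw \<phi> (carrier V) (carrier W) \<and>
     (\<forall>v\<in>carrier V. \<forall>w\<in>carrier V. \<phi> (v \<oplus>\<^bsub>V\<^esub> w) = \<phi> v \<oplus>\<^bsub>W\<^esub> \<phi> w) \<and>
     (\<forall>a\<in>carrier K. \<forall>v\<in>carrier V. \<phi> (a \<odot>\<^bsub>V\<^esub> v) = a \<odot>\<^bsub>W\<^esub> \<phi> v) \<and>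
     (\<forall>g\<in>carrier G. \<forall>v\<in>carrier V. \<phi> (act V g v) = act W g (\<phi> v))"

definition kG_isomorphic ::
  "('k, 'n) ring_scheme \<Rightarrow> ('g, 'm) monoid_scheme \<Rightarrow> ('k, 'v, 'g) gmodule \<Rightarrow>
    ('k, 'w, 'g) gmodule \<Rightarrow> bool" where
  "kG_isomorphic K G V W \<longleftrightarrow> (\<exists>\<phi>. kG_iso K G V W \<phi>)"

definition kG_direct_sum ::
  "('k, 'n) ring_scheme \<Rightarrow> ('g, 'm) monoid_scheme \<Rightarrow> ('k, 'v, 'g) gmodule \<Rightarrow>
    'v set \<Rightarrow> 'v set \<Rightarrow> bool" where
  "kG_direct_sum K G V A B \<longleftrightarrow>
     kG_submodule K G V A \<and> kG_submodule K G V B \<and>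
     A <+>\<^bsub>V\<^esub> B = carrier V \<and> A \<inter> B = {\<zero>\<^bsub>V\<^esub>}"

definition kG_direct_summand ::
  "('k, 'n) ring_scheme \<Rightarrow> ('g, 'm) monoid_scheme \<Rightarrow> ('k, 'v, 'g) gmodule \<Rightarrow> 'v set \<Rightarrow> bool" where
  "kG_direct_summand K G V A \<longleftrightarrow> (\<exists>B. kG_direct_sum K G V A B)"

definition kG_zero :: "('k, 'v, 'g) gmodule \<Rightarrow> bool" where
  "kG_zero V \<longleftrightarrow> carrier V = {\<zero>\<^bsub>V\<^esub>}"

definition kG_indecomposable ::
  "('k, 'n) ring_scheme \<Rightarrow> ('g, 'm) monoid_scheme \<Rightarrow> ('k, 'v, 'g) gmodule \<Rightarrow> bool" where
  "kG_indecomposable K G V \<longleftrightarrow>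
     \<not> kG_zero V \<and>
     (\<forall>A B. kG_direct_sum K G V A B \<longrightarrow> A = {\<zero>\<^bsub>V\<^esub>} \<or> B = {\<zero>\<^bsub>V\<^esub>})"

definition kG_simple ::
  "('k, 'n) ring_scheme \<Rightarrow> ('g, 'm) monoid_scheme \<Rightarrow> ('k, 'v, 'g) gmodule \<Rightarrow> bool" where
  "kG_simple K G V \<longleftrightarrow>
     \<not> kG_zero V \<and>
     (\<forall>A. kG_submodule K G V A \<longrightarrow> A = {\<zero>\<^bsub>V\<^esub>} \<or> A = carrier V)"

definition kG_socle ::
  "('k, 'n) ring_scheme \<Rightarrow> ('g, 'm) monoid_scheme \<Rightarrow> ('k, 'v, 'g) gmodule \<Rightarrow> 'v set" where
  "kG_socle K G V = generate (add_monoid V)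
     (\<Union> {S. kG_submodule K G V S \<and> kG_simple K G (V\<lparr>carrier := S\<rparr>)})"

definition trivial_kG_module :: "('k, 'n) ring_scheme \<Rightarrow> ('k, 'k, 'g) gmodule" where
  "trivial_kG_module K =
    \<lparr>carrier = carrier K, monoid.mult = monoid.mult K, one = \<one>\<^bsub>K\<^esub>, ring.zero = \<zero>\<^bsub>K\<^esub>, add = add K,
     smult = monoid.mult K, act = (\<lambda>g a. a)\<rparr>"

text \<open>\<open>Ind\<^sub>H\<^sup>G(V)\<close> for a subgroup \<open>H\<close> of a finite group \<open>G\<close> and a \<open>kH\<close>-module \<open>V\<close>, in its
  function model: \<open>f\<close> corresponds to the element \<open>\<Sum>x\<in>G/H. x \<otimes> f x\<close> of \<open>kG \<otimes>\<^sub>k\<^sub>H V\<close>,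
  where \<open>x\<close> runs over representatives of the left cosets.\<close>

definition induced_module ::
  "('g, 'm) monoid_scheme \<Rightarrow> 'g set \<Rightarrow> ('k, 'v, 'g) gmodule \<Rightarrow> ('k, 'g \<Rightarrow> 'v, 'g) gmodule" where
  "induced_module G H V =
    \<lparr>carrier = {f \<in> carrier G \<rightarrow>\<^sub>E carrier V.
       \<forall>x\<in>carrier G. \<forall>h\<in>H. f (x \<otimes>\<^bsub>G\<^esub> h) = act V (inv\<^bsub>G\<^esub> h) (f x)},
     monoid.mult = undefined, one = undefined,
     ring.zero = (\<lambda>x\<in>carrier G. \<zero>\<^bsub>V\<^esub>),
     add = (\<lambda>f f'. \<lambda>x\<in>carrier G. f x \<oplus>\<^bsub>V\<^esub> f' x),
     smult = (\<lambda>a f. \<lambda>x\<in>carrier G. a \<odot>\<^bsub>V\<^esub> f x),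
     act = (\<lambda>g f. \<lambda>x\<in>carrier G. f (inv\<^bsub>G\<^esub> g \<otimes>\<^bsub>G\<^esub> x))\<rparr>"

text \<open>\<open>V\<close> is (isomorphic to) the Scott module \<open>Sc(G, H)\<close>; it is determined only up to isomorphism.\<close>

definition is_scott_module ::
  "('k, 'n) ring_scheme \<Rightarrow> ('g, 'm) monoid_scheme \<Rightarrow> 'g set \<Rightarrow> ('k, 'v, 'g) gmodule \<Rightarrow> bool" where
  "is_scott_module K G H V \<longleftrightarrow>
     kG_module K G V \<and>
     kG_indecomposable K G V \<and>
     (let I = induced_module G H (trivial_kG_module K)
      in \<exists>W. kG_direct_summand K G I W \<and> kG_isomorphic K G V (I\<lparr>carrier := W\<rparr>)) \<and>
     (\<exists>S. kG_submodule K G V S \<and> S \<subseteq> kG_socle K G V \<and>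
        kG_isomorphic K G (V\<lparr>carrier := S\<rparr>) (trivial_kG_module K))"

section \<open>Brauer quotients\<close>

text \<open>The quotient of \<open>V\<close> by a submodule \<open>W\<close>; the unions give \<open>a(v + W) = av + W\<close> and
  \<open>g(v + W) = gv + W\<close>.\<close>

definition quotient_gmodule ::
  "('k, 'v, 'g) gmodule \<Rightarrow> 'v set \<Rightarrow> ('k, 'v set, 'g) gmodule" where
  "quotient_gmodule V W =
    \<lparr>carrier = a_rcosets\<^bsub>V\<^esub> W,
     monoid.mult = undefined, one = undefined,
     ring.zero = W,
     add = (\<lambda>C D. C <+>\<^bsub>V\<^esub> D),
     smult = (\<lambda>a C. \<Union>v\<in>C. W +>\<^bsub>V\<^esub> (a \<odot>\<^bsub>V\<^esub> v)),
     act = (\<lambda>g C. \<Union>v\<in>C. W +>\<^bsub>V\<^esub> act V g v)\<rparr>"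

definition fixed_points :: "('k, 'v, 'g) gmodule \<Rightarrow> 'g set \<Rightarrow> 'v set" where
  "fixed_points V Q = {v \<in> carrier V. \<forall>g\<in>Q. act V g v = v}"

text \<open>\<open>Tr\<^sub>R\<^sup>Q(v) = \<Sum>x\<in>Q/R. x v\<close>; for \<open>v\<close> fixed by \<open>R\<close> the choice of representatives of the left
  cosets does not matter.\<close>

definition relative_trace ::
  "('g, 'm) monoid_scheme \<Rightarrow> ('k, 'v, 'g) gmodule \<Rightarrow> 'g set \<Rightarrow> 'g set \<Rightarrow> 'v \<Rightarrow> 'v" where
  "relative_trace G V R Q v =
     (\<Oplus>\<^bsub>V\<^esub>C\<in>(\<lambda>x. x <#\<^bsub>G\<^esub> R) ` Q. act V (SOME x. x \<in> C) v)"

text \<open>A sum of subgroups of \<open>V\<close> is the additive subgroup generated by their union.\<close>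

definition trace_sum ::
  "('g, 'm) monoid_scheme \<Rightarrow> ('k, 'v, 'g) gmodule \<Rightarrow> 'g set \<Rightarrow> 'v set" where
  "trace_sum G V Q = generate (add_monoid V)
     (\<Union>R\<in>{R. subgroup R G \<and> R \<subset> Q}. relative_trace G V R Q ` fixed_points V R)"

text \<open>The action of \<open>g\<close> on \<open>V(Q)\<close> is meaningful for \<open>g\<close> in the normalizer of \<open>Q\<close>.\<close>

definition brauer_quotient ::
  "('g, 'm) monoid_scheme \<Rightarrow> ('k, 'v, 'g) gmodule \<Rightarrow> 'g set \<Rightarrow> ('k, 'v set, 'g) gmodule" where
  "brauer_quotient G V Q =
     quotient_gmodule (V\<lparr>carrier := fixed_points V Q\<rparr>) (trace_sum G V Q)"

definition brauer_indecomposable ::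
  "nat \<Rightarrow> ('k, 'n) ring_scheme \<Rightarrow> ('g, 'm) monoid_scheme \<Rightarrow> ('k, 'v, 'g) gmodule \<Rightarrow> bool" where
  "brauer_indecomposable p K G V \<longleftrightarrow>
     (\<forall>Q. p_subgroup p G Q \<longrightarrow>
        kG_indecomposable K (G\<lparr>carrier := Q <#>\<^bsub>G\<^esub> centralizer G Q\<rparr>) (brauer_quotient G V Q) \<or>
        kG_zero (brauer_quotient G V Q))"

end

theory Submission
  imports Defs "HOL-Algebra.Left_Coset"
begin

text \<open>Write \<open>\<iota>\<close> for Park's embedding. Left multiplication by any element of \<open>M\<close>, not only of \<open>P\<close>,
commutes with right multiplication by \<open>P\<close>. So \<open>\<iota>\<close> extends to an embedding of \<open>M\<close> into
\<open>G = Park(\<F>, M)\<close>; let \<open>L\<close> be its image and \<open>H = \<iota>P\<close>, a subgroup of index 3 in \<open>L\<close>. The proof shows that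
\<open>Sc(G, H)\<close> is the permutation module \<open>k[G/L]\<close>, and that every nonzero Brauer quotient of \<open>k[G/L]\<close>
is indecomposable even over some 2-subgroup \<open>S\<close> of \<open>C\<^sub>G(Q)\<close>.

Indecomposability always has the same source. A 2-group \<open>S\<close> acting on a nonzero module in
characteristic 2 fixes a nonzero vector, and in a permutation module on which \<open>S\<close> permutes the basis
transitively the fixed vectors are the constants. So any two nonzero \<open>S\<close>-submodules of such a module
both contain the constants (\<open>two_group_invariant_function\<close>), and it cannot be a
direct sum of two of them.

For the Scott module: the index 3 is odd, so \<open>k[G/L]\<close> splits off \<open>k[G/H] = Ind\<^sub>H\<^sup>G(k)\<close> by summing over
\<open>L/H\<close>. The Scott module is a summand \<open>W\<close> of \<open>k[G/H]\<close> that contains the constants. The composition of the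
two projections \<open>k[G/L] \<rightarrow> W \<rightarrow> k[G/L]\<close> fixes the constants, hence is injective, hence bijective;
so \<open>W\<close> has a summand isomorphic to \<open>k[G/L]\<close> and, being indecomposable, equals it
(\<open>scott_module_iso_perm_module\<close>).

For the Brauer quotients: \<open>k[G/L](Q)\<close> is the permutation module on the fixed points of \<open>Q\<close> in \<open>G/L\<close>,
so it suffices that some 2-subgroup of \<open>C\<^sub>G(Q)\<close> is transitive on these fixed points
(\<open>brauer_quotient_indecomposable_or_zero\<close>). This is where Park's group enters. A 2-subgroup \<open>Q\<close> of
\<open>G\<close> permutes the three left cosets of \<open>P\<close> in \<open>M\<close>, hence fixes one of them, say \<open>mP\<close>; evaluation
at \<open>m\<close> then translates conjugation in \<open>G\<close> into conjugation in \<open>M\<close>. This shows that an element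
of \<open>G\<close> conjugating \<open>Q \<le> L\<close> into \<open>L\<close> lies in \<open>C\<^sub>G(Q)L\<close>
(\<open>conjugating_element_factorization\<close>; in essence Park's theorem that \<open>\<F>\<close> is realized by \<open>G\<close>), and
that \<open>C\<^sub>G(Q)\<close> is the product of the stabilizer of \<open>m\<close> in it and \<open>C\<^sub>L(Q)\<close>
(\<open>centralizer_factorization\<close>). The stabilizer of a point \<open>m\<close> in \<open>G\<close> is a 2-group
(\<open>point_stabilizer_card\<close>): its elements of odd order fix \<open>mP\<close>, hence all three cosets, and then,
\<open>P\<close> being a 2-group, all points. So for \<open>Q \<le> L\<close> the stabilizer of \<open>m\<close> in \<open>C\<^sub>G(Q)\<close> is the 2-subgroup
that is needed, and any \<open>Q\<close> with a fixed point in \<open>G/L\<close> is conjugate to a subgroup of \<open>L\<close>.\<close>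

section \<open>Groups of prime power order acting on finite sets\<close>

text \<open>The moved points form the orbits of length greater than 1, and the length of an orbit divides a
power of \<open>p\<close>.\<close>

lemma p_group_moved_points:
  fixes G (structure)
  assumes "group G" "subgroup S G" "Factorial_Ring.prime p" "card S = p ^ a" "finite E"
    and closed: "\<And>g x. g \<in> S \<Longrightarrow> x \<in> E \<Longrightarrow> \<alpha> g x \<in> E"
    and one: "\<And>x. x \<in> E \<Longrightarrow> \<alpha> \<one> x = x"
    and mult: "\<And>g h x. g \<in> S \<Longrightarrow> h \<in> S \<Longrightarrow> x \<in> E \<Longrightarrow> \<alpha> (g \<otimes> h) x = \<alpha> g (\<alpha> h x)"
  shows "p dvd card {x \<in> E. \<exists>g\<in>S. \<alpha> g x \<noteq> x}"
proof -
  interpret group G by fact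
  interpret S: subgroup S G by fact
  define A where "A = G\<lparr>carrier := S\<rparr>"
  define \<phi> where "\<phi> = (\<lambda>g. \<lambda>x\<in>E. \<alpha> g x)"
  have grpA: "group A" unfolding A_def by (rule S.subgroup_is_group) fact
  have carA: "carrier A = S" and multA: "\<And>x y. x \<otimes>\<^bsub>A\<^esub> y = x \<otimes> y"
    by (simp_all add: A_def)
  have inv: "\<alpha> (inv g) (\<alpha> g x) = x" "\<alpha> g (\<alpha> (inv g) x) = x" if "g \<in> S" "x \<in> E" for g x
    using that mult[of "inv g" g x] mult[of g "inv g" x] one by simp_all
  have bij: "\<phi> g \<in> Bij E" if "g \<in> S" for g
  proof -
    have "bij_betw (\<alpha> g) E E"
      by (rule bij_betwI[where g = "\<alpha> (inv g)"]) (use that in \<open>auto intro: closed simp: inv\<close>)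
    then have "bij_betw (\<phi> g) E E"
      by (rule bij_betw_cong[THEN iffD1, rotated]) (simp add: \<phi>_def)
    then show ?thesis by (simp add: Bij_def \<phi>_def)
  qed
  have "\<phi> (g \<otimes> h) = compose E (\<phi> g) (\<phi> h)" if "g \<in> S" "h \<in> S" for g h
    using that by (auto simp: \<phi>_def compose_def mult closed restrict_def)
  then have "group_hom A (BijGroup E) \<phi>"
    by (intro group_hom.intro group_hom_axioms.intro grpA group_BijGroup homI)
       (auto simp: carA multA BijGroup_def bij)
  then interpret ga: group_action A E \<phi> by (rule group_action.intro)
  let ?moved = "{x \<in> E. \<exists>g\<in>S. \<alpha> g x \<noteq> x}"
  let ?C = "{B. B \<in> orbits A E \<phi> \<and> card B \<noteq> 1}"
  have orb: "orbit A \<phi> x = (\<lambda>g. \<alpha> g x) ` S" if "x \<in> E" for x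
    using that by (auto simp: orbit_def carA \<phi>_def)
  have orb_self: "x \<in> orbit A \<phi> x" if "x \<in> E" for x
    using ga.orbit_refl that by blast
  have fin: "finite B" if "B \<in> orbits A E \<phi>" for B
    using ga.orbits_coverture that \<open>finite E\<close> by (metis Sup_upper finite_subset)
  have orb1: "card (orbit A \<phi> x) = 1 \<longleftrightarrow> (\<forall>g\<in>S. \<alpha> g x = x)" if "x \<in> E" for x
  proof
    assume "card (orbit A \<phi> x) = 1"
    then obtain y where "orbit A \<phi> x = {y}" by (auto simp: card_1_singleton_iff)
    then have "(\<lambda>g. \<alpha> g x) ` S \<subseteq> {y}" "x \<in> {y}"
      using orb[OF that] orb_self[OF that] by simp_all
    then show "\<forall>g\<in>S. \<alpha> g x = x" by auto
  next
    assume "\<forall>g\<in>S. \<alpha> g x = x"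
    then have "orbit A \<phi> x \<subseteq> {x}" using orb[OF that] by auto
    then have "orbit A \<phi> x = {x}" using orb_self[OF that] by blast
    then show "card (orbit A \<phi> x) = 1" by simp
  qed
  have moved: "?moved = \<Union>?C"
  proof
    show "?moved \<subseteq> \<Union>?C"
    proof
      fix x assume x: "x \<in> ?moved"
      then have "orbit A \<phi> x \<in> ?C" using orb1[of x] by (auto simp: orbits_def)
      then show "x \<in> \<Union>?C" using orb_self[of x] x by blast
    qed
    show "\<Union>?C \<subseteq> ?moved"
    proof
      fix y assume "y \<in> \<Union>?C"
      then obtain B where B: "B \<in> orbits A E \<phi>" "card B \<noteq> 1" "y \<in> B" by blast
      then have "y \<in> E" using ga.orbits_coverture by blast
      then have "orbit A \<phi> y \<in> orbits A E \<phi>" by (auto simp: orbits_def)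
      then have "orbit A \<phi> y = B" using ga.disjoint_union B orb_self[OF \<open>y \<in> E\<close>] by blast
      then show "y \<in> ?moved" using orb1[OF \<open>y \<in> E\<close>] B \<open>y \<in> E\<close> by auto
    qed
  qed
  have "p dvd card (\<Union>?C)"
  proof (rule dvd_partition)
    show "finite (\<Union>?C)" unfolding moved[symmetric] using \<open>finite E\<close> by simp
    show "\<forall>c\<in>?C. p dvd card c"
    proof
      fix c assume c: "c \<in> ?C"
      then obtain x where "x \<in> E" "c = orbit A \<phi> x" by (auto simp: orbits_def)
      then have "card c dvd p ^ a"
        using ga.orbit_stabilizer_theorem[of x] \<open>card S = p ^ a\<close> carA
        by (metis dvd_triv_left order_def)
      then obtain i where "card c = p ^ i" using divides_primepow_nat \<open>Factorial_Ring.prime p\<close> by blast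
      moreover have "i \<noteq> 0" using c calculation by (cases i) auto
      ultimately show "p dvd card c" by simp
    qed
    show "\<forall>c1\<in>?C. \<forall>c2\<in>?C. c1 \<noteq> c2 \<longrightarrow> c1 \<inter> c2 = {}" using ga.disjoint_union by blast
  qed
  then show ?thesis unfolding moved .
qed

text \<open>The sets \<open>{x, f x}\<close> partition \<open>E\<close> into pairs.\<close>

lemma even_card_fixed_point_free_involution:
  assumes "finite E" "\<And>x. x \<in> E \<Longrightarrow> f x \<in> E" "\<And>x. x \<in> E \<Longrightarrow> f (f x) = x"
    "\<And>x. x \<in> E \<Longrightarrow> f x \<noteq> x"
  shows "even (card E)"
proof -
  have "E = \<Union>((\<lambda>x. {x, f x}) ` E)" using assms(2) by blast
  moreover have "2 dvd card (\<Union>((\<lambda>x. {x, f x}) ` E))"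
  proof (rule dvd_partition)
    show "\<forall>c\<in>(\<lambda>x. {x, f x}) ` E. 2 dvd card c"
    proof
      fix c assume "c \<in> (\<lambda>x. {x, f x}) ` E"
      then obtain x where "x \<in> E" "c = {x, f x}" by blast
      then have "card c = 2" using assms(4)[of x] by (simp add: eq_commute)
      then show "2 dvd card c" by simp
    qed
    show "\<forall>c1\<in>(\<lambda>x. {x, f x}) ` E. \<forall>c2\<in>(\<lambda>x. {x, f x}) ` E. c1 \<noteq> c2 \<longrightarrow> c1 \<inter> c2 = {}"
    proof (intro ballI impI)
      fix c d assume "c \<in> (\<lambda>x. {x, f x}) ` E" "d \<in> (\<lambda>x. {x, f x}) ` E" "c \<noteq> d"
      then obtain x y where xy: "x \<in> E" "c = {x, f x}" "y \<in> E" "d = {y, f y}" by blast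
      have "x \<noteq> y" "f x \<noteq> y" "x \<noteq> f y" "f x \<noteq> f y"
        using \<open>c \<noteq> d\<close> xy assms(3) by (metis insert_commute)+
      then show "c \<inter> d = {}" using xy by auto
    qed
    show "finite (\<Union>((\<lambda>x. {x, f x}) ` E))" using assms(1) by simp
  qed
  ultimately show ?thesis by metis
qed

section \<open>Conjugates, centralizers and scalars\<close>

lemma (in group) cancel_inv:
  "x \<in> carrier G \<Longrightarrow> y \<in> carrier G \<Longrightarrow> inv x \<otimes> (x \<otimes> y) = y"
  "x \<in> carrier G \<Longrightarrow> y \<in> carrier G \<Longrightarrow> x \<otimes> (inv x \<otimes> y) = y"
  by (simp_all flip: m_assoc)

lemma (in group) conjugate_subgroup:
  assumes S: "subgroup S G" and x: "x \<in> carrier G"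
  shows "subgroup ((\<lambda>g. x \<otimes> g \<otimes> inv x) ` S) G" "card ((\<lambda>g. x \<otimes> g \<otimes> inv x) ` S) = card S"
proof -
  have SG: "S \<subseteq> carrier G" using S by (rule subgroup.subset)
  have "x \<otimes> (g \<otimes> h) \<otimes> inv x = (x \<otimes> g \<otimes> inv x) \<otimes> (x \<otimes> h \<otimes> inv x)"
    if "g \<in> carrier G" "h \<in> carrier G" for g h
    using that x by (simp add: m_assoc cancel_inv)
  then have "group_hom G G (\<lambda>g. x \<otimes> g \<otimes> inv x)"
    by (intro group_hom.intro group_hom_axioms.intro group_axioms homI) (use x in simp_all)
  then show "subgroup ((\<lambda>g. x \<otimes> g \<otimes> inv x) ` S) G"
    using S by (rule group_hom.subgroup_img_is_subgroup)
  have "inj_on (\<lambda>g. x \<otimes> g \<otimes> inv x) S"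
    using SG x by (intro inj_onI) (simp add: subset_iff)
  then show "card ((\<lambda>g. x \<otimes> g \<otimes> inv x) ` S) = card S" by (rule card_image)
qed

lemma (in group) centralizer_subgroup:
  assumes "Q \<subseteq> carrier G"
  shows "subgroup (centralizer G Q) G"
proof
  have QG: "q \<in> carrier G" if "q \<in> Q" for q using that assms by blast
  show "centralizer G Q \<subseteq> carrier G" "\<one> \<in> centralizer G Q"
    using QG by (auto simp: centralizer_def)
  fix x assume x: "x \<in> centralizer G Q"
  then have xG: "x \<in> carrier G" by (simp add: centralizer_def)
  show "inv x \<in> centralizer G Q"
    unfolding centralizer_def
  proof (intro CollectI conjI ballI)
    fix q assume q: "q \<in> Q"
    then have "x \<otimes> q = q \<otimes> x" using x by (simp add: centralizer_def)
    then have "inv x \<otimes> (x \<otimes> q) \<otimes> inv x = inv x \<otimes> (q \<otimes> x) \<otimes> inv x" by simp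
    then show "inv x \<otimes> q = q \<otimes> inv x" using xG QG[OF q] by (simp add: m_assoc cancel_inv)
  qed (use xG in simp)
  fix y assume y: "y \<in> centralizer G Q"
  then have yG: "y \<in> carrier G" by (simp add: centralizer_def)
  show "x \<otimes> y \<in> centralizer G Q"
    unfolding centralizer_def
  proof (intro CollectI conjI ballI)
    fix q assume q: "q \<in> Q"
    have "x \<otimes> y \<otimes> q = x \<otimes> (q \<otimes> y)" using y q xG yG QG[OF q] by (simp add: centralizer_def m_assoc)
    also have "\<dots> = q \<otimes> (x \<otimes> y)"
      using x q xG yG QG[OF q] by (simp add: centralizer_def m_assoc[symmetric])
    finally show "x \<otimes> y \<otimes> q = q \<otimes> (x \<otimes> y)" .
  qed (use xG yG in simp)
qed

lemma (in module) uminus_smult: "x \<in> carrier M \<Longrightarrow> \<ominus>\<^bsub>M\<^esub> x = (\<ominus> \<one>) \<odot>\<^bsub>M\<^esub> x"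
  using smult_l_minus[of \<one> x] by simp

lemma (in ring) ring_char_2: "ring_char R = 2 \<Longrightarrow> \<one> \<oplus> \<one> = \<zero>"
proof -
  assume "ring_char R = 2"
  then have "add_pow R (2 :: nat) \<one> = \<zero>"
    using add.pow_ord_eq_1[of \<one>] by (simp add: ring_char_def)
  then show ?thesis by (simp add: numeral_2_eq_2)
qed

section \<open>Scalar functions on a finite group in characteristic 2\<close>

text \<open>Permutation modules over \<open>K\<close> are treated as spaces of functions on \<open>G\<close>, in the model of
\<open>induced_module\<close>. The operations are named here independently of the subgroup from which one
induces: \<open>Ind\<close> from \<open>H\<close> and from \<open>L\<close> differ in the carrier only, so that both live in one space.\<close>

locale finite_group_char_2 = group G + K: field K for G (structure) and K :: "('k, 'n) ring_scheme" +
  assumes finite_carrier: "finite (carrier G)"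
    and char_2: "\<one>\<^bsub>K\<^esub> \<oplus>\<^bsub>K\<^esub> \<one>\<^bsub>K\<^esub> = \<zero>\<^bsub>K\<^esub>"
begin

definition fzero :: "'a \<Rightarrow> 'k" where
  "fzero = (\<lambda>x\<in>carrier G. \<zero>\<^bsub>K\<^esub>)"
definition fadd :: "('a \<Rightarrow> 'k) \<Rightarrow> ('a \<Rightarrow> 'k) \<Rightarrow> 'a \<Rightarrow> 'k" where
  "fadd f g = (\<lambda>x\<in>carrier G. f x \<oplus>\<^bsub>K\<^esub> g x)"
definition fsmult :: "'k \<Rightarrow> ('a \<Rightarrow> 'k) \<Rightarrow> 'a \<Rightarrow> 'k" where
  "fsmult a f = (\<lambda>x\<in>carrier G. a \<otimes>\<^bsub>K\<^esub> f x)"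
definition ftrans :: "'a \<Rightarrow> ('a \<Rightarrow> 'k) \<Rightarrow> 'a \<Rightarrow> 'k" where
  "ftrans g f = (\<lambda>x\<in>carrier G. f (inv g \<otimes> x))"

abbreviation fns :: "('a \<Rightarrow> 'k) set" where
  "fns \<equiv> carrier G \<rightarrow>\<^sub>E carrier K"

definition subspace :: "('a \<Rightarrow> 'k) set \<Rightarrow> bool" where
  "subspace A \<longleftrightarrow> A \<subseteq> fns \<and> fzero \<in> A \<and> (\<forall>f\<in>A. \<forall>g\<in>A. fadd f g \<in> A) \<and>
     (\<forall>a\<in>carrier K. \<forall>f\<in>A. fsmult a f \<in> A)"

lemma fun_apply [simp]:
  "x \<in> carrier G \<Longrightarrow> fzero x = \<zero>\<^bsub>K\<^esub>"
  "x \<in> carrier G \<Longrightarrow> fadd f g x = f x \<oplus>\<^bsub>K\<^esub> g x"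
  "x \<in> carrier G \<Longrightarrow> fsmult a f x = a \<otimes>\<^bsub>K\<^esub> f x"
  "x \<in> carrier G \<Longrightarrow> ftrans h f x = f (inv h \<otimes> x)"
  by (simp_all add: fzero_def fadd_def fsmult_def ftrans_def)

lemma fns_mem [simp]: "f \<in> fns \<Longrightarrow> x \<in> carrier G \<Longrightarrow> f x \<in> carrier K"
  by (auto simp: PiE_iff)

lemma fns_closed [simp]:
  "fzero \<in> fns"
  "f \<in> fns \<Longrightarrow> g \<in> fns \<Longrightarrow> fadd f g \<in> fns"
  "a \<in> carrier K \<Longrightarrow> f \<in> fns \<Longrightarrow> fsmult a f \<in> fns"
  "h \<in> carrier G \<Longrightarrow> f \<in> fns \<Longrightarrow> ftrans h f \<in> fns"
  by (auto simp: fzero_def fadd_def fsmult_def ftrans_def PiE_iff)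

lemma fns_eqI: "f \<in> fns \<Longrightarrow> g \<in> fns \<Longrightarrow> (\<And>x. x \<in> carrier G \<Longrightarrow> f x = g x) \<Longrightarrow> f = g"
  by (rule PiE_ext)

lemma add_self [simp]: "a \<in> carrier K \<Longrightarrow> a \<oplus>\<^bsub>K\<^esub> a = \<zero>\<^bsub>K\<^esub>"
  using char_2 K.l_distr[of "\<one>\<^bsub>K\<^esub>" "\<one>\<^bsub>K\<^esub>" a] by simp

lemma add_eq_zero_iff:
  "a \<in> carrier K \<Longrightarrow> b \<in> carrier K \<Longrightarrow> a \<oplus>\<^bsub>K\<^esub> b = \<zero>\<^bsub>K\<^esub> \<longleftrightarrow> a = b"
  using K.minus_equality K.minus_minus add_self by metis

lemma fadd_eq_fzeroD:
  assumes "f \<in> fns" "g \<in> fns" "fadd f g = fzero"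
  shows "f = g"
proof (rule fns_eqI[OF assms(1,2)])
  fix x assume "x \<in> carrier G"
  moreover have "fadd f g x = fzero x" using assms(3) by simp
  ultimately show "f x = g x" using assms(1,2) add_eq_zero_iff[of "f x" "g x"] by simp
qed

lemma subspaceD:
  assumes "subspace A"
  shows "A \<subseteq> fns" "f \<in> A \<Longrightarrow> f \<in> fns" "fzero \<in> A" "f \<in> A \<Longrightarrow> g \<in> A \<Longrightarrow> fadd f g \<in> A"
    "a \<in> carrier K \<Longrightarrow> f \<in> A \<Longrightarrow> fsmult a f \<in> A"
  using assms by (auto simp: subspace_def)

lemma add_swap:
  assumes "a \<in> carrier K" "b \<in> carrier K" "c \<in> carrier K" "d \<in> carrier K"
    "a \<oplus>\<^bsub>K\<^esub> b = c \<oplus>\<^bsub>K\<^esub> d"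
  shows "a \<oplus>\<^bsub>K\<^esub> c = b \<oplus>\<^bsub>K\<^esub> d"
proof -
  have "(a \<oplus>\<^bsub>K\<^esub> c) \<oplus>\<^bsub>K\<^esub> (b \<oplus>\<^bsub>K\<^esub> d) = (a \<oplus>\<^bsub>K\<^esub> b) \<oplus>\<^bsub>K\<^esub> (c \<oplus>\<^bsub>K\<^esub> d)"
    using assms(1-4) by (simp add: K.a_ac)
  also have "\<dots> = \<zero>\<^bsub>K\<^esub>" using assms by simp
  finally show ?thesis using assms(1-4) add_eq_zero_iff by simp
qed

lemma finsum_const_char_2:
  assumes "a \<in> carrier K" "finite C"
  shows "(\<Oplus>\<^bsub>K\<^esub>i\<in>C. a) = (if odd (card C) then a else \<zero>\<^bsub>K\<^esub>)"
  using assms(2) by induction (use assms(1) in \<open>simp_all add: K.finsum_insert\<close>)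

text \<open>Sums of translates of \<open>f\<close> over arbitrary subsets of \<open>S\<close>; these are the elements of the
\<open>F\<^sub>2\<close>-span of the \<open>S\<close>-orbit of \<open>f\<close>, a finite set even when \<open>K\<close> is infinite.\<close>

lemma translate_sum_mem:
  assumes A: "subspace A" and trans: "\<And>s f. s \<in> S \<Longrightarrow> f \<in> A \<Longrightarrow> ftrans s f \<in> A"
    and f: "f \<in> A" and E: "E \<subseteq> S" "finite E" "S \<subseteq> carrier G"
  shows "\<exists>h\<in>A. \<forall>x\<in>carrier G. h x = (\<Oplus>\<^bsub>K\<^esub>t\<in>E. f (inv t \<otimes> x))"
  using E(2,1)
proof (induction E)
  case empty
  show ?case using subspaceD(3)[OF A] by (intro bexI[of _ fzero]) auto
next
  case (insert t E)
  then obtain h where h: "h \<in> A" "\<And>x. x \<in> carrier G \<Longrightarrow> h x = (\<Oplus>\<^bsub>K\<^esub>t\<in>E. f (inv t \<otimes> x))"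
    by auto
  have fc: "f x \<in> carrier K" if "x \<in> carrier G" for x using subspaceD(2)[OF A f] that by simp
  have "fadd (ftrans t f) h \<in> A" using trans[of t f] f insert.prems h(1) subspaceD(4)[OF A] by auto
  moreover have "fadd (ftrans t f) h x = (\<Oplus>\<^bsub>K\<^esub>t\<in>insert t E. f (inv t \<otimes> x))"
    if x: "x \<in> carrier G" for x
  proof -
    have "inv u \<otimes> x \<in> carrier G" if "u \<in> insert t E" for u using that x insert.prems E(3) by (meson inv_closed m_closed subsetD)
    then show ?thesis
      using insert.hyps insert.prems x E(3) by (subst K.finsum_insert) (auto intro!: fc simp: h(2))
  qed
  ultimately show ?case by blast
qed

text \<open>A 2-group \<open>S\<close> acting on a nonzero vector space in characteristic 2 fixes a nonzero vector. Here the
vectors are functions on the single orbit \<open>S x0\<close>, where invariance means being constant, so the fixed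
vector can be scaled to 1. The field may be infinite, so one counts in the finite \<open>F\<^sub>2\<close>-span of the
orbit of one nonzero vector: it has even cardinality, the number of its elements moved by \<open>S\<close> is even,
and 0 is not moved; hence 0 is not the only fixed element.\<close>

lemma two_group_invariant_function:
  assumes S: "subgroup S G" "card S = 2 ^ a" and x0: "x0 \<in> carrier G"
    and A: "subspace A" and trans: "\<And>s f. s \<in> S \<Longrightarrow> f \<in> A \<Longrightarrow> ftrans s f \<in> A"
    and f: "f \<in> A" and s0: "s0 \<in> S" and nz: "f (s0 \<otimes> x0) \<noteq> \<zero>\<^bsub>K\<^esub>"
  shows "\<exists>g\<in>A. \<forall>s\<in>S. g (s \<otimes> x0) = \<one>\<^bsub>K\<^esub>"
proof -
  interpret S: subgroup S G by fact
  have SG: "S \<subseteq> carrier G" by (rule S.subset)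
  have finS: "finite S" using SG finite_carrier finite_subset by blast
  \<comment> \<open>A translate of \<open>f\<close> that does not vanish at \<open>x0\<close> itself.\<close>
  define f' where "f' = ftrans (inv s0) f"
  have f'A: "f' \<in> A" using trans f s0 by (simp add: f'_def)
  have f'x0: "f' x0 \<noteq> \<zero>\<^bsub>K\<^esub>" using nz s0 x0 by (simp add: f'_def)
  have f'c: "f' x \<in> carrier K" if "x \<in> carrier G" for x
    using subspaceD(2)[OF A f'A] that by simp
  \<comment> \<open>\<open>W\<close> is the span, with each element \<open>w\<close> read as the function \<open>s \<mapsto> w (s x0)\<close> on \<open>S\<close>; \<open>tr\<close> is the
    action of \<open>S\<close>, and adding \<open>f'\<close> is a fixed-point-free involution \<open>sh\<close> of \<open>W\<close>.\<close>
  define F where "F = (\<lambda>E. \<lambda>s\<in>S. \<Oplus>\<^bsub>K\<^esub>t\<in>E. f' (inv t \<otimes> (s \<otimes> x0)))"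
  define W where "W = F ` Pow S"
  define tr where "tr = (\<lambda>u w. \<lambda>s\<in>S. w (inv u \<otimes> s) :: 'k)"
  define sh where "sh = (\<lambda>w. \<lambda>s\<in>S. w s \<oplus>\<^bsub>K\<^esub> f' (s \<otimes> x0))"
  have arg: "inv t \<otimes> (s \<otimes> x0) \<in> carrier G" if "t \<in> S" "s \<in> S" for t s
    using that x0 by simp
  have Fc: "F E s \<in> carrier K" if "E \<subseteq> S" "s \<in> S" for E s
  proof -
    have "(\<lambda>t. f' (inv t \<otimes> (s \<otimes> x0))) \<in> E \<rightarrow> carrier K" using that arg f'c by blast
    then show ?thesis using that by (simp add: F_def)
  qed
  have finW: "finite W" using finS by (simp add: W_def)
  have Fins: "F (insert t E) s = f' (inv t \<otimes> (s \<otimes> x0)) \<oplus>\<^bsub>K\<^esub> F E s"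
    if "E \<subseteq> S" "s \<in> S" "t \<in> S" "t \<notin> E" for E s t
  proof -
    have "(\<lambda>t. f' (inv t \<otimes> (s \<otimes> x0))) \<in> E \<rightarrow> carrier K" using that arg f'c by blast
    moreover have "finite E" using that finS finite_subset by blast
    ultimately show ?thesis using that arg f'c by (simp add: F_def K.finsum_insert)
  qed
  have sh_mem: "sh w \<in> W" if "w \<in> W" for w
  proof -
    obtain E where E: "E \<subseteq> S" "w = F E" using \<open>w \<in> W\<close> by (auto simp: W_def)
    show ?thesis
    proof (cases "\<one> \<in> E")
      case True
      then obtain D where D: "E = insert \<one> D" "\<one> \<notin> D" by (meson mk_disjoint_insert)
      have "sh w = F D"
      proof
        fix s
        show "sh w s = F D s"
        proof (cases "s \<in> S")
          case True
          have "F E s = f' (s \<otimes> x0) \<oplus>\<^bsub>K\<^esub> F D s"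
            unfolding D(1) using Fins[of D s \<one>] D E True x0 by simp
          then have "sh w s = F D s \<oplus>\<^bsub>K\<^esub> (f' (s \<otimes> x0) \<oplus>\<^bsub>K\<^esub> f' (s \<otimes> x0))"
            using True E D Fc[of D s] f'c[of "s \<otimes> x0"] x0 by (simp add: sh_def K.a_ac)
          then show ?thesis using True E D Fc[of D s] f'c[of "s \<otimes> x0"] x0 by simp
        qed (simp add: sh_def F_def)
      qed
      then show ?thesis using E D by (auto simp: W_def)
    next
      case False
      have "sh w = F (insert \<one> E)"
      proof
        fix s
        show "sh w s = F (insert \<one> E) s"
        proof (cases "s \<in> S")
          case True
          then show ?thesis using Fins[of E s \<one>] E False x0 Fc[of E s] f'c[of "s \<otimes> x0"]
            by (simp add: sh_def K.a_comm)
        qed (simp add: sh_def F_def)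
      qed
      then show ?thesis using E by (auto simp: W_def)
    qed
  qed
  have Wc: "w s \<in> carrier K" if "w \<in> W" "s \<in> S" for w s using that Fc by (auto simp: W_def)
  have Wext: "w \<in> extensional S" if "w \<in> W" for w using that by (auto simp: W_def F_def)
  have "even (card W)"
  proof (rule even_card_fixed_point_free_involution[of W sh])
    fix w assume w: "w \<in> W"
    show "sh w \<in> W" by (rule sh_mem) fact
    show "sh (sh w) = w"
    proof (rule extensionalityI[of _ S])
      fix s assume "s \<in> S"
      then show "sh (sh w) s = w s" using Wc[OF w] f'c[of "s \<otimes> x0"] x0 by (simp add: sh_def K.a_assoc)
    qed (simp_all add: sh_def Wext[OF w])
    show "sh w \<noteq> w"
    proof
      assume "sh w = w"
      then have "sh w \<one> = w \<one>" by simp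
      then have "w \<one> \<oplus>\<^bsub>K\<^esub> f' x0 = w \<one> \<oplus>\<^bsub>K\<^esub> \<zero>\<^bsub>K\<^esub>" using x0 Wc[OF w, of \<one>] by (simp add: sh_def)
      then show False using f'x0 Wc[OF w, of \<one>] f'c[OF x0] K.add.l_cancel by simp
    qed
  qed (rule finW)
  moreover have "even (card {w \<in> W. \<exists>g\<in>S. tr g w \<noteq> w})"
  proof (rule p_group_moved_points[OF group_axioms S(1) two_is_prime_nat S(2) finW])
    fix u w assume u: "u \<in> S" and w: "w \<in> W"
    then obtain E where E: "E \<subseteq> S" "w = F E" by (auto simp: W_def)
    have "tr u w = F ((\<lambda>t. u \<otimes> t) ` E)"
    proof
      fix s
      show "tr u w s = F ((\<lambda>t. u \<otimes> t) ` E) s"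
      proof (cases "s \<in> S")
        case True
        have inj: "inj_on (\<lambda>t. u \<otimes> t) E" using E u SG by (intro inj_onI) (metis l_cancel subsetD)
        have "(\<Oplus>\<^bsub>K\<^esub>t\<in>(\<lambda>t. u \<otimes> t) ` E. f' (inv t \<otimes> (s \<otimes> x0)))
              = (\<Oplus>\<^bsub>K\<^esub>t\<in>E. f' (inv (u \<otimes> t) \<otimes> (s \<otimes> x0)))"
          using E u arg f'c True by (intro K.finsum_reindex inj) auto
        also have "\<dots> = (\<Oplus>\<^bsub>K\<^esub>t\<in>E. f' (inv t \<otimes> (inv u \<otimes> s \<otimes> x0)))"
        proof (rule K.finsum_cong')
          fix t assume "t \<in> E"
          then have "t \<in> S" using E by blast
          then show "f' (inv (u \<otimes> t) \<otimes> (s \<otimes> x0)) = f' (inv t \<otimes> (inv u \<otimes> s \<otimes> x0))"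
            using u True x0 by (simp add: inv_mult_group m_assoc)
        qed (use E u arg f'c True in auto)
        finally show ?thesis using E u True by (simp add: tr_def F_def)
      qed (simp add: tr_def F_def)
    qed
    then show "tr u w \<in> W" using E u by (auto simp: W_def)
  next
    fix w assume w: "w \<in> W"
    show "tr \<one> w = w"
      by (rule extensionalityI[of _ S]) (simp_all add: tr_def Wext[OF w])
  next
    fix g h w assume g: "g \<in> S" "h \<in> S" and w: "w \<in> W"
    show "tr (g \<otimes> h) w = tr g (tr h w)"
      by (rule extensionalityI[of _ S]) (use g in \<open>simp_all add: tr_def inv_mult_group m_assoc\<close>)
  qed
  moreover have "F {} \<in> W" by (simp add: W_def)
  moreover have "tr g (F {}) = F {}" if "g \<in> S" for g
    by (rule extensionalityI[of _ S]) (use that in \<open>simp_all add: F_def tr_def\<close>)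
  then have z: "F {} \<notin> {w \<in> W. \<exists>g\<in>S. tr g w \<noteq> w}" by simp
  ultimately have "{w \<in> W. \<exists>g\<in>S. tr g w \<noteq> w} \<noteq> W - {F {}}"
    using finW by (metis (no_types, lifting) card_Suc_Diff1 even_Suc)
  then obtain w where w: "w \<in> W" "w \<noteq> F {}" "\<And>g. g \<in> S \<Longrightarrow> tr g w = w" using z by blast
  obtain E where E: "E \<subseteq> S" "w = F E" using \<open>w \<in> W\<close> by (auto simp: W_def)
  have const: "w s = w \<one>" if "s \<in> S" for s
    using fun_cong[OF w(3)[OF that], of s] that by (simp add: tr_def)
  have "w \<one> \<noteq> \<zero>\<^bsub>K\<^esub>"
  proof
    assume "w \<one> = \<zero>\<^bsub>K\<^esub>"
    then have "w s = F {} s" if "s \<in> S" for s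
      using const[OF that] that by (simp add: F_def)
    then have "w = F {}"
      by (intro extensionalityI[of _ S]) (simp_all add: F_def Wext[OF w(1)])
    then show False using w(2) by blast
  qed
  then have unit: "w \<one> \<in> Units K" using Wc[OF w(1)] by (simp add: K.field_Units)
  obtain h where h: "h \<in> A" "\<And>x. x \<in> carrier G \<Longrightarrow> h x = (\<Oplus>\<^bsub>K\<^esub>t\<in>E. f' (inv t \<otimes> x))"
    using translate_sum_mem[OF A trans f'A E(1) _ SG] finite_subset[OF E(1) finS] by auto
  have "fsmult (inv\<^bsub>K\<^esub> (w \<one>)) h (s \<otimes> x0) = \<one>\<^bsub>K\<^esub>" if s: "s \<in> S" for s
  proof -
    have "h (s \<otimes> x0) = w s" using s x0 h(2) E by (simp add: F_def)
    then show ?thesis using s x0 unit const[OF s] by simp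
  qed
  moreover have "fsmult (inv\<^bsub>K\<^esub> (w \<one>)) h \<in> A" using unit h(1) subspaceD(5)[OF A] by simp
  ultimately show ?thesis by blast
qed

section \<open>Injective endomorphisms of spaces of functions\<close>

text \<open>That an injective endomorphism of a finite-dimensional space is surjective is proved by means of
the positions of the leading coefficients: a basis in echelon form has exactly one element for
each of them, so their number is the dimension.\<close>

definition leading_positions :: "('a \<Rightarrow> nat) \<Rightarrow> ('a \<Rightarrow> 'k) set \<Rightarrow> 'a set" where
  "leading_positions ix A = {x \<in> carrier G. \<exists>f\<in>A. f x \<noteq> \<zero>\<^bsub>K\<^esub> \<and>
     (\<forall>y\<in>carrier G. ix y < ix x \<longrightarrow> f y = \<zero>\<^bsub>K\<^esub>)}"

text \<open>Gaussian elimination: an element of \<open>B\<close> is reduced to 0 by subtracting elements of \<open>A\<close> with the same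
leading position.\<close>

lemma subspace_eq_if_leading_positions_subset:
  assumes A: "subspace A" and B: "subspace B" "A \<subseteq> B" and inj: "inj_on ix (carrier G)"
    and le: "leading_positions ix B \<subseteq> leading_positions ix A"
  shows "A = B"
proof -
  obtain N where N: "\<And>x. x \<in> carrier G \<Longrightarrow> ix x < N"
    using finite_nat_set_iff_bounded[of "ix ` carrier G"] finite_carrier by auto
  \<comment> \<open>Induction on the number \<open>k\<close> of positions at which \<open>f\<close> may still be nonzero.\<close>
  have reduce: "f \<in> A" if "f \<in> B" "\<forall>y\<in>carrier G. ix y < N - k \<longrightarrow> f y = \<zero>\<^bsub>K\<^esub>" for f k
    using that
  proof (induction k arbitrary: f)
    case 0
    then have "f = fzero" using N subspaceD(2)[OF B(1)] by (intro fns_eqI) auto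
    then show ?case using subspaceD(3)[OF A] by simp
  next
    case (Suc k)
    show ?case
    proof (cases "\<forall>y\<in>carrier G. ix y < N - k \<longrightarrow> f y = \<zero>\<^bsub>K\<^esub>")
      case True
      then show ?thesis using Suc by blast
    next
      case False
      then obtain x where x: "x \<in> carrier G" "ix x < N - k" "f x \<noteq> \<zero>\<^bsub>K\<^esub>" by blast
      then have ix: "ix x = N - Suc k" using Suc.prems(2) by force
      then have "x \<in> leading_positions ix B"
        using x Suc.prems by (auto simp: leading_positions_def)
      then obtain g where g: "g \<in> A" "g x \<noteq> \<zero>\<^bsub>K\<^esub>" "\<And>y. y \<in> carrier G \<Longrightarrow> ix y < ix x \<Longrightarrow> g y = \<zero>\<^bsub>K\<^esub>"
        using le by (auto simp: leading_positions_def)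
      have gf: "g \<in> fns" "f \<in> fns" using g Suc.prems subspaceD(2) A B by auto
      define c where "c = f x \<otimes>\<^bsub>K\<^esub> inv\<^bsub>K\<^esub> (g x)"
      have unit: "g x \<in> Units K" using g gf x by (simp add: K.field_Units)
      then have c: "c \<in> carrier K" "c \<otimes>\<^bsub>K\<^esub> g x = f x"
        using gf x by (simp_all add: c_def K.m_assoc)
      have cg: "fsmult c g \<in> A" using subspaceD(5)[OF A] c g by simp
      have "fadd f (fsmult c g) \<in> A"
      proof (rule Suc.IH)
        show "fadd f (fsmult c g) \<in> B" using subspaceD(4)[OF B(1)] Suc.prems cg B(2) by blast
        show "\<forall>y\<in>carrier G. ix y < N - k \<longrightarrow> fadd f (fsmult c g) y = \<zero>\<^bsub>K\<^esub>"
        proof (intro ballI impI)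
          fix y assume y: "y \<in> carrier G" "ix y < N - k"
          show "fadd f (fsmult c g) y = \<zero>\<^bsub>K\<^esub>"
          proof (cases "ix y = ix x")
            case True
            then have "y = x" using inj x y by (auto dest: inj_onD)
            then show ?thesis using c gf x by simp
          next
            case False
            then have "ix y < ix x" using y ix by linarith
            then show ?thesis using y g(3) Suc.prems(2) ix c by simp
          qed
        qed
      qed
      then have "fadd (fadd f (fsmult c g)) (fsmult c g) \<in> A" using cg subspaceD(4)[OF A] by blast
      moreover have "fadd (fadd f (fsmult c g)) (fsmult c g) = f"
        using gf c by (intro fns_eqI) (simp_all add: K.a_assoc)
      ultimately show ?thesis by simp
    qed
  qed
  show ?thesis using B(2) reduce[of _ N] by auto
qed

text \<open>Among the images of the powers of \<open>\<theta>\<close> take one of least dimension. It is mapped onto itself,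
and the power can be cancelled because \<open>\<theta>\<close> is injective.\<close>

lemma injective_endomorphism_surjective:
  assumes A: "subspace A" and maps: "\<And>f. f \<in> A \<Longrightarrow> \<theta> f \<in> A"
    and add: "\<And>f g. f \<in> A \<Longrightarrow> g \<in> A \<Longrightarrow> \<theta> (fadd f g) = fadd (\<theta> f) (\<theta> g)"
    and smult: "\<And>a f. a \<in> carrier K \<Longrightarrow> f \<in> A \<Longrightarrow> \<theta> (fsmult a f) = fsmult a (\<theta> f)"
    and ker: "\<And>f. f \<in> A \<Longrightarrow> \<theta> f = fzero \<Longrightarrow> f = fzero"
  shows "\<theta> ` A = A"
proof -
  obtain ix :: "'a \<Rightarrow> nat" where ix: "inj_on ix (carrier G)"
    using finite_imp_inj_to_nat_seg[OF finite_carrier] by blast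
  define I where "I = (\<lambda>i. (\<theta> ^^ i) ` A)"
  have inj: "inj_on \<theta> A"
  proof (rule inj_onI)
    fix f g assume fg: "f \<in> A" "g \<in> A" "\<theta> f = \<theta> g"
    have "fadd (\<theta> g) (\<theta> g) = fzero"
      using fg maps subspaceD(2)[OF A] by (intro fns_eqI) simp_all
    then have "fadd f g = fzero" using fg add ker subspaceD(4)[OF A] by simp
    then show "f = g" using fg subspaceD(2)[OF A] fadd_eq_fzeroD by blast
  qed
  have pow: "(\<theta> ^^ i) f \<in> A" if "f \<in> A" for i f
    using that by (induction i) (auto intro: maps)
  have powinj: "inj_on (\<theta> ^^ i) A" for i
  proof (induction i)
    case (Suc i)
    have "inj_on \<theta> ((\<theta> ^^ i) ` A)" using inj by (rule inj_on_subset) (auto intro: pow)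
    then show ?case using comp_inj_on[OF Suc] by (simp add: comp_def)
  qed simp
  have powadd: "(\<theta> ^^ i) (fadd f g) = fadd ((\<theta> ^^ i) f) ((\<theta> ^^ i) g)"
    if "f \<in> A" "g \<in> A" for i f g using that by (induction i) (simp_all add: add pow)
  have powsm: "(\<theta> ^^ i) (fsmult a f) = fsmult a ((\<theta> ^^ i) f)"
    if "a \<in> carrier K" "f \<in> A" for i f a using that by (induction i) (simp_all add: smult pow)
  have sub: "subspace (I i)" for i
  proof -
    have z: "fsmult \<zero>\<^bsub>K\<^esub> f = fzero" if "f \<in> A" for f
      using subspaceD(2)[OF A that] by (intro fns_eqI) simp_all
    have "(\<theta> ^^ i) fzero = fzero"
      using powsm[of "\<zero>\<^bsub>K\<^esub>" fzero i] z pow subspaceD(3)[OF A] by simp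
    then have "fzero \<in> I i" unfolding I_def using subspaceD(3)[OF A] by (metis image_eqI)
    moreover have "fadd f g \<in> I i" if "f \<in> I i" "g \<in> I i" for f g
      using that subspaceD(4)[OF A] powadd unfolding I_def by (auto simp flip: powadd)
    moreover have "fsmult a f \<in> I i" if "a \<in> carrier K" "f \<in> I i" for f a
      using that subspaceD(5)[OF A] unfolding I_def by (auto simp flip: powsm)
    moreover have "I i \<subseteq> fns" unfolding I_def using pow subspaceD(2)[OF A] by blast
    ultimately show ?thesis by (simp add: subspace_def)
  qed
  obtain i where i: "\<And>j. card (leading_positions ix (I i)) \<le> card (leading_positions ix (I j))"
    using ex_has_least_nat[of "\<lambda>_. True" undefined "\<lambda>j. card (leading_positions ix (I j))"] by auto
  have step: "I (Suc i) \<subseteq> I i"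
    unfolding I_def using maps by (auto simp: funpow_swap1)
  have "leading_positions ix (I (Suc i)) \<subseteq> leading_positions ix (I i)"
    using step by (auto simp: leading_positions_def)
  moreover have "finite (leading_positions ix (I i))"
    using finite_carrier by (simp add: leading_positions_def)
  ultimately have "leading_positions ix (I (Suc i)) = leading_positions ix (I i)"
    using i by (meson card_seteq)
  then have eq: "I (Suc i) = I i"
    by (intro subspace_eq_if_leading_positions_subset[OF sub sub step ix]) simp
  have "f \<in> \<theta> ` A" if f: "f \<in> A" for f
  proof -
    have "(\<theta> ^^ i) f \<in> I (Suc i)" unfolding eq using f by (simp add: I_def)
    then obtain g where g: "g \<in> A" "(\<theta> ^^ i) f = (\<theta> ^^ i) (\<theta> g)"
      unfolding I_def by (auto simp: funpow_swap1)
    then have "f = \<theta> g" using powinj[of i] f maps by (auto dest: inj_onD)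
    then show ?thesis using g by blast
  qed
  then show ?thesis using maps by blast
qed

section \<open>Permutation modules and summation over cosets\<close>

text \<open>This is \<open>k[G/H]\<close>: functions on \<open>G\<close> that are constant on the left cosets \<open>xH\<close>, with \<open>G\<close> acting by left
translation.\<close>

definition perm_module :: "'a set \<Rightarrow> ('k, 'a \<Rightarrow> 'k, 'a) gmodule" where
  "perm_module H = induced_module G H (trivial_kG_module K)"

lemma perm_module_simps [simp]:
  "add (perm_module H) = fadd" "ring.zero (perm_module H) = fzero"
  "smult (perm_module H) = fsmult" "act (perm_module H) = ftrans"
  by (simp_all add: perm_module_def induced_module_def trivial_kG_module_def fun_eq_iff
      fadd_def fsmult_def fzero_def ftrans_def)

lemma mem_perm_module:
  "f \<in> carrier (perm_module H) \<longleftrightarrow>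
     f \<in> fns \<and> (\<forall>x\<in>carrier G. \<forall>h\<in>H. f (x \<otimes> h) = f x)"
  by (auto simp: perm_module_def induced_module_def trivial_kG_module_def)

lemma subspace_perm_module: "H \<subseteq> carrier G \<Longrightarrow> subspace (carrier (perm_module H))"
  unfolding subspace_def by (auto simp: mem_perm_module subset_iff)

lemma ftrans_perm_module:
  "H \<subseteq> carrier G \<Longrightarrow> g \<in> carrier G \<Longrightarrow> f \<in> carrier (perm_module H) \<Longrightarrow>
     ftrans g f \<in> carrier (perm_module H)"
  by (auto simp: mem_perm_module subset_iff simp flip: m_assoc)

lemma kG_submodule_perm_moduleD:
  assumes "kG_submodule K G (perm_module H) W" and H: "H \<subseteq> carrier G"
  shows "subspace W" "W \<subseteq> carrier (perm_module H)"
    "g \<in> carrier G \<Longrightarrow> f \<in> W \<Longrightarrow> ftrans g f \<in> W"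
proof -
  have sm: "submodule W K (perm_module H)"
    and act: "\<And>g f. g \<in> carrier G \<Longrightarrow> f \<in> W \<Longrightarrow> ftrans g f \<in> W"
    using assms by (auto simp: kG_submodule_def)
  interpret W: submodule W K "perm_module H" by (rule sm)
  show "W \<subseteq> carrier (perm_module H)" using W.subset by simp
  then have "W \<subseteq> fns" using mem_perm_module by blast
  then show "subspace W"
    unfolding subspace_def
    using W.m_closed W.one_closed W.smult_closed by simp
  show "g \<in> carrier G \<Longrightarrow> f \<in> W \<Longrightarrow> ftrans g f \<in> W" by (rule act)
qed

lemma l_coset_memE: "y \<in> a <# H \<Longrightarrow> (\<And>h. h \<in> H \<Longrightarrow> y = a \<otimes> h \<Longrightarrow> thesis) \<Longrightarrow> thesis"
  by (auto simp: l_coset_def)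

text \<open>The map \<open>k[G/H] \<rightarrow> k[G/L]\<close> given by summation over the cosets of \<open>H\<close> in \<open>L\<close>. Its values on \<open>k[G/H]\<close> do not
depend on the representatives. In characteristic 2 and for odd index it is the identity on
\<open>k[G/L]\<close>, without division by the index.\<close>

definition coset_sum :: "'a set \<Rightarrow> 'a set \<Rightarrow> ('a \<Rightarrow> 'k) \<Rightarrow> 'a \<Rightarrow> 'k" where
  "coset_sum L H f =
     (\<lambda>x\<in>carrier G. \<Oplus>\<^bsub>K\<^esub>C\<in>(\<lambda>l. l <# H) ` L. f (x \<otimes> (SOME c. c \<in> C)))"

context
  fixes L H
  assumes L: "subgroup L G" and H: "subgroup H G" and HL: "H \<subseteq> L"
begin

lemma coset_rep: 
  assumes "C \<in> (\<lambda>l. l <# H) ` L"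
  shows "(SOME c. c \<in> C) \<in> L" "C = (SOME c. c \<in> C) <# H" "(SOME c. c \<in> C) \<in> carrier G"
proof -
  obtain l where l: "l \<in> L" "C = l <# H" using assms by blast
  then have lG: "l \<in> carrier G" using L subgroup.subset by blast
  have "l \<in> C" using lcos_self[OF lG H] l by simp
  then have "(SOME c. c \<in> C) \<in> C" by (rule someI)
  then obtain h where h: "h \<in> H" "(SOME c. c \<in> C) = l \<otimes> h" using l by (auto simp: l_coset_def)
  then show *: "(SOME c. c \<in> C) \<in> L" using l HL subgroup.m_closed[OF L] by auto
  show "C = (SOME c. c \<in> C) <# H"
    using l_repr_independence[of "SOME c. c \<in> C" l H] \<open>(SOME c. c \<in> C) \<in> C\<close> l lG H by simp
  show "(SOME c. c \<in> C) \<in> carrier G" using * L subgroup.subset by blast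
qed

lemma finite_cosets: "finite ((\<lambda>l. l <# H) ` L)"
  using finite_subset[OF subgroup.subset[OF L] finite_carrier] by simp

lemma coset_sum_summand:
  "f \<in> fns \<Longrightarrow> x \<in> carrier G \<Longrightarrow>
    (\<lambda>C. f (x \<otimes> (SOME c. c \<in> C))) \<in> (\<lambda>l. l <# H) ` L \<rightarrow> carrier K"
  using coset_rep(3) by (simp add: Pi_iff)

lemma coset_sum_add:
  "f \<in> fns \<Longrightarrow> g \<in> fns \<Longrightarrow>
    coset_sum L H (fadd f g) = fadd (coset_sum L H f) (coset_sum L H g)"
proof
  fix x assume fg: "f \<in> fns" "g \<in> fns"
  show "coset_sum L H (fadd f g) x = fadd (coset_sum L H f) (coset_sum L H g) x"
  proof (cases "x \<in> carrier G")
    case True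
    have "(\<Oplus>\<^bsub>K\<^esub>C\<in>(\<lambda>l. l <# H) ` L. fadd f g (x \<otimes> (SOME c. c \<in> C)))
      = (\<Oplus>\<^bsub>K\<^esub>C\<in>(\<lambda>l. l <# H) ` L. f (x \<otimes> (SOME c. c \<in> C)) \<oplus>\<^bsub>K\<^esub> g (x \<otimes> (SOME c. c \<in> C)))"
      by (rule K.finsum_cong') (use True fg coset_rep(3) in auto)
    then show ?thesis
      using True coset_sum_summand[OF fg(1) True] coset_sum_summand[OF fg(2) True]
      by (simp add: coset_sum_def K.finsum_addf)
  qed (simp add: coset_sum_def fadd_def)
qed

lemma coset_sum_smult:
  "a \<in> carrier K \<Longrightarrow> f \<in> fns \<Longrightarrow>
    coset_sum L H (fsmult a f) = fsmult a (coset_sum L H f)"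
proof
  fix x assume fg: "a \<in> carrier K" "f \<in> fns"
  show "coset_sum L H (fsmult a f) x = fsmult a (coset_sum L H f) x"
  proof (cases "x \<in> carrier G")
    case True
    have "(\<Oplus>\<^bsub>K\<^esub>C\<in>(\<lambda>l. l <# H) ` L. fsmult a f (x \<otimes> (SOME c. c \<in> C)))
      = (\<Oplus>\<^bsub>K\<^esub>C\<in>(\<lambda>l. l <# H) ` L. a \<otimes>\<^bsub>K\<^esub> f (x \<otimes> (SOME c. c \<in> C)))"
      by (rule K.finsum_cong') (use True fg coset_rep(3) in auto)
    then show ?thesis
      using True fg coset_sum_summand[OF fg(2) True] finite_cosets
      by (simp add: coset_sum_def K.finsum_rdistr)
  qed (simp add: coset_sum_def fsmult_def)
qed

lemma coset_sum_ftrans: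
  "g \<in> carrier G \<Longrightarrow> f \<in> fns \<Longrightarrow>
    coset_sum L H (ftrans g f) = ftrans g (coset_sum L H f)"
proof
  fix x assume fg: "g \<in> carrier G" "f \<in> fns"
  show "coset_sum L H (ftrans g f) x = ftrans g (coset_sum L H f) x"
  proof (cases "x \<in> carrier G")
    case True
    have "(\<Oplus>\<^bsub>K\<^esub>C\<in>(\<lambda>l. l <# H) ` L. ftrans g f (x \<otimes> (SOME c. c \<in> C)))
      = (\<Oplus>\<^bsub>K\<^esub>C\<in>(\<lambda>l. l <# H) ` L. f (inv g \<otimes> x \<otimes> (SOME c. c \<in> C)))"
      by (rule K.finsum_cong') (use True fg coset_rep(3) in \<open>auto simp: m_assoc\<close>)
    then show ?thesis using True fg by (simp add: coset_sum_def)
  qed (simp add: coset_sum_def ftrans_def)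
qed

text \<open>Multiplication by \<open>l \<in> L\<close> permutes the cosets of \<open>H\<close> in \<open>L\<close>, and the value of \<open>f\<close> at the
representative of \<open>lC\<close> is its value at \<open>l\<close> times the representative of \<open>C\<close>.\<close>

lemma coset_sum_mem:
  assumes f: "f \<in> carrier (perm_module H)"
  shows "coset_sum L H f \<in> carrier (perm_module L)"
proof -
  have ff: "f \<in> fns" and inv: "\<And>x h. x \<in> carrier G \<Longrightarrow> h \<in> H \<Longrightarrow> f (x \<otimes> h) = f x"
    using f by (auto simp: mem_perm_module)
  have "coset_sum L H f \<in> fns"
    using coset_sum_summand[OF ff] by (auto simp: coset_sum_def)
  moreover have "coset_sum L H f (x \<otimes> l) = coset_sum L H f x"
    if x: "x \<in> carrier G" and l: "l \<in> L" for x l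
  proof -
    let ?R = "(\<lambda>l. l <# H) ` L"
    have lG: "l \<in> carrier G" using l L subgroup.subset by blast
    have LG: "L \<subseteq> carrier G" "H \<subseteq> carrier G" using L H subgroup.subset by blast+
    have sub: "C \<subseteq> carrier G" if "C \<in> ?R" for C
      using that LG by (auto simp: l_coset_def)
    have mem: "l <# C \<in> ?R" if "C \<in> ?R" for C
      using that l lG LG subgroup.m_closed[OF L] by (auto simp: lcos_m_assoc)
    have inj: "inj_on (\<lambda>C. l <# C) ?R"
    proof (rule inj_onI)
      fix C D assume CD: "C \<in> ?R" "D \<in> ?R" "l <# C = l <# D"
      then have "inv l <# (l <# C) = inv l <# (l <# D)" by simp
      then show "C = D" using sub[OF CD(1)] sub[OF CD(2)] lG by (simp add: lcos_m_assoc lcos_mult_one)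
    qed
    have img: "(\<lambda>C. l <# C) ` ?R = ?R"
      using endo_inj_surj[OF finite_cosets _ inj] mem by blast
    then have "coset_sum L H f x = (\<Oplus>\<^bsub>K\<^esub>C\<in>(\<lambda>C. l <# C) ` ?R. f (x \<otimes> (SOME c. c \<in> C)))"
      using x unfolding img by (simp add: coset_sum_def)
    also have "\<dots> = (\<Oplus>\<^bsub>K\<^esub>C\<in>?R. f (x \<otimes> (SOME c. c \<in> l <# C)))"
      by (rule K.finsum_reindex[OF _ inj]) (unfold img, rule coset_sum_summand[OF ff x])
    also have "\<dots> = (\<Oplus>\<^bsub>K\<^esub>C\<in>?R. f (x \<otimes> l \<otimes> (SOME c. c \<in> C)))"
    proof (rule K.finsum_cong')
      show "(\<lambda>C. f (x \<otimes> l \<otimes> (SOME c. c \<in> C))) \<in> ?R \<rightarrow> carrier K"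
        by (rule coset_sum_summand[OF ff m_closed[OF x lG]])
      fix C assume C: "C \<in> ?R"
      let ?c = "SOME c. c \<in> C" and ?d = "SOME c. c \<in> l <# C"
      have c: "?c \<in> carrier G" "C = ?c <# H" using coset_rep[OF C] by auto
      have d: "?d \<in> carrier G" "l <# C = ?d <# H" using coset_rep[OF mem[OF C]] by auto
      have d_mem: "?d \<in> l <# C" using subsetD[OF equalityD2[OF d(2)] lcos_self[OF d(1) H]] .
      have lC: "l <# C = (l \<otimes> ?c) <# H"
        using arg_cong[OF c(2), of "\<lambda>D. l <# D"] lcos_m_assoc[OF LG(2) lG c(1)] by (rule trans)
      obtain h where h: "h \<in> H" "?d = l \<otimes> ?c \<otimes> h"
        by (rule l_coset_memE[OF subsetD[OF equalityD1[OF lC] d_mem]])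
      have hG: "h \<in> carrier G" using h(1) LG(2) by blast
      have "x \<otimes> ?d = x \<otimes> l \<otimes> ?c \<otimes> h"
        using arg_cong[OF h(2), of "\<lambda>d. x \<otimes> d"] x lG c(1) hG by (simp only: m_assoc m_closed)
      moreover have "f (x \<otimes> l \<otimes> ?c \<otimes> h) = f (x \<otimes> l \<otimes> ?c)"
        by (rule inv) (use x lG c(1) h(1) in simp_all)
      ultimately show "f (x \<otimes> ?d) = f (x \<otimes> l \<otimes> ?c)" by simp
    qed simp
    finally show ?thesis using x lG by (simp add: coset_sum_def)
  qed
  ultimately show ?thesis by (simp add: mem_perm_module)
qed

lemma coset_sum_id:
  assumes odd: "odd (card ((\<lambda>l. l <# H) ` L))" and f: "f \<in> carrier (perm_module L)"
  shows "coset_sum L H f = f"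
proof (rule extensionalityI[of _ "carrier G"])
  have ff: "f \<in> fns" and inv: "\<And>x l. x \<in> carrier G \<Longrightarrow> l \<in> L \<Longrightarrow> f (x \<otimes> l) = f x"
    using f by (auto simp: mem_perm_module)
  show "coset_sum L H f \<in> extensional (carrier G)" by (simp add: coset_sum_def)
  show "f \<in> extensional (carrier G)" using ff by (simp only: PiE_iff)
  fix x assume x: "x \<in> carrier G"
  have "coset_sum L H f x = (\<Oplus>\<^bsub>K\<^esub>C\<in>(\<lambda>l. l <# H) ` L. f x)"
    unfolding coset_sum_def restrict_apply'[OF x]
  proof (rule K.finsum_cong')
    fix C assume "C \<in> (\<lambda>l. l <# H) ` L"
    then show "f (x \<otimes> (SOME c. c \<in> C)) = f x" by (rule inv[OF x coset_rep(1)])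
  qed (use ff x in simp_all)
  then show "coset_sum L H f x = f x"
    using finsum_const_char_2[OF fns_mem[OF ff x] finite_cosets] odd by simp
qed

end

section \<open>Scott modules that are permutation modules\<close>

text \<open>The case \<open>x0 = 1\<close> of \<open>two_group_invariant_function\<close>: the hypothesis \<open>G = SL\<close> says that \<open>S\<close> is transitive on \<open>G/L\<close>.\<close>

lemma nonzero_submodule_contains_constants:
  assumes S: "subgroup S G" "card S = 2 ^ a" and L: "subgroup L G"
    and G_eq: "\<And>x. x \<in> carrier G \<Longrightarrow> \<exists>s\<in>S. \<exists>l\<in>L. x = s \<otimes> l"
    and A: "subspace A" "A \<subseteq> carrier (perm_module L)"
    and trans: "\<And>g f. g \<in> carrier G \<Longrightarrow> f \<in> A \<Longrightarrow> ftrans g f \<in> A"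
    and f: "f \<in> A" "f \<noteq> fzero"
  shows "(\<lambda>x\<in>carrier G. \<one>\<^bsub>K\<^esub>) \<in> A"
proof -
  have SG: "S \<subseteq> carrier G" using S(1) by (rule subgroup.subset)
  have linv: "h (x \<otimes> l) = h x" if "h \<in> A" "x \<in> carrier G" "l \<in> L" for h x l
    using that A(2) mem_perm_module by blast
  obtain x where x: "x \<in> carrier G" "f x \<noteq> \<zero>\<^bsub>K\<^esub>"
    using f fns_eqI[of f fzero] subspaceD(2)[OF A(1) f(1)] fun_apply(1) fns_closed(1) by metis
  then obtain s l where sl: "s \<in> S" "l \<in> L" "x = s \<otimes> l" using G_eq by blast
  then have sG: "s \<in> carrier G" using SG by blast
  then have "f (s \<otimes> \<one>) \<noteq> \<zero>\<^bsub>K\<^esub>" using x(2) linv[OF f(1) sG sl(2)] sl(3) by simp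
  then obtain g where g: "g \<in> A" "\<And>s. s \<in> S \<Longrightarrow> g (s \<otimes> \<one>) = \<one>\<^bsub>K\<^esub>"
    using two_group_invariant_function[OF S one_closed A(1) _ f(1) sl(1)] trans SG by blast
  have "g = (\<lambda>x\<in>carrier G. \<one>\<^bsub>K\<^esub>)"
  proof (rule fns_eqI)
    fix y assume y: "y \<in> carrier G"
    then obtain s l where sl: "s \<in> S" "l \<in> L" "y = s \<otimes> l" using G_eq by blast
    then show "g y = (\<lambda>x\<in>carrier G. \<one>\<^bsub>K\<^esub>) y"
      using y g(2)[OF sl(1)] linv[OF g(1) _ sl(2)] SG by auto
  qed (use g subspaceD(2)[OF A(1)] in auto)
  then show ?thesis using g by simp
qed

text \<open>The projection along \<open>B\<close>. It is linear and equivariant because the decomposition \<open>f = w + b\<close> is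
unique and compatible with all operations.\<close>

lemma summand_projection:
  assumes ds: "kG_direct_sum K G (perm_module H) W B" and H: "H \<subseteq> carrier G"
  obtains p where "\<And>f. f \<in> carrier (perm_module H) \<Longrightarrow> p f \<in> W"
    "\<And>f. f \<in> W \<Longrightarrow> p f = f"
    "\<And>f g. f \<in> carrier (perm_module H) \<Longrightarrow> g \<in> carrier (perm_module H) \<Longrightarrow>
       p (fadd f g) = fadd (p f) (p g)"
    "\<And>a f. a \<in> carrier K \<Longrightarrow> f \<in> carrier (perm_module H) \<Longrightarrow> p (fsmult a f) = fsmult a (p f)"
    "\<And>g f. g \<in> carrier G \<Longrightarrow> f \<in> carrier (perm_module H) \<Longrightarrow> p (ftrans g f) = ftrans g (p f)"
proof -
  let ?I = "carrier (perm_module H)"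
  have sm: "kG_submodule K G (perm_module H) W" "kG_submodule K G (perm_module H) B"
    and sum: "W <+>\<^bsub>perm_module H\<^esub> B = ?I" and int: "W \<inter> B = {fzero}"
    using ds by (auto simp: kG_direct_sum_def)
  note W = kG_submodule_perm_moduleD[OF sm(1) H] and B = kG_submodule_perm_moduleD[OF sm(2) H]
  have dec: "\<exists>w\<in>W. \<exists>b\<in>B. f = fadd w b" if "f \<in> ?I" for f
    using that unfolding sum[symmetric] by (auto simp: set_add_def set_mult_def)
  have uniq: "w = w'" if "w \<in> W" "w' \<in> W" "b \<in> B" "b' \<in> B" "fadd w b = fadd w' b'" for w w' b b'
  proof -
    have fn: "w \<in> fns" "w' \<in> fns" "b \<in> fns" "b' \<in> fns"
      using that subspaceD(2)[OF W(1)] subspaceD(2)[OF B(1)] by blast+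
    have "fadd w w' x = fadd b b' x" if x: "x \<in> carrier G" for x
    proof -
      have mem: "w x \<in> carrier K" "w' x \<in> carrier K" "b x \<in> carrier K" "b' x \<in> carrier K"
        using fn x by simp_all
      have eq: "w x \<oplus>\<^bsub>K\<^esub> b x = w' x \<oplus>\<^bsub>K\<^esub> b' x"
        using fun_cong[OF \<open>fadd w b = fadd w' b'\<close>, of x] x by simp
      show ?thesis using add_swap[OF mem(1,3,2,4) eq] x by simp
    qed
    then have "fadd w w' = fadd b b'" using fn by (intro fns_eqI) simp_all
    then have "fadd w w' \<in> W \<inter> B"
      using that subspaceD(4)[OF W(1)] subspaceD(4)[OF B(1)] by (metis IntI)
    then show "w = w'" using int fadd_eq_fzeroD fn by blast
  qed
  define p where "p = (\<lambda>f. SOME w. w \<in> W \<and> (\<exists>b\<in>B. f = fadd w b))"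
  have pW: "p f \<in> W" and pB: "\<exists>b\<in>B. f = fadd (p f) b" if "f \<in> ?I" for f
    using someI_ex[of "\<lambda>w. w \<in> W \<and> (\<exists>b\<in>B. f = fadd w b)"] dec[OF that] unfolding p_def by blast+
  have p_eq: "p f = w" if fw: "f \<in> ?I" "w \<in> W" "b \<in> B" "f = fadd w b" for f w b
  proof -
    obtain b' where b': "b' \<in> B" "f = fadd (p f) b'" using pB[OF fw(1)] by blast
    show ?thesis by (rule uniq[OF pW[OF fw(1)] fw(2) b'(1) fw(3)]) (use b' fw in simp)
  qed
  note I = subspace_perm_module[OF H] and fnW = subspaceD(2)[OF W(1)] and fnB = subspaceD(2)[OF B(1)]
  show ?thesis
  proof (rule that[of p])
    show "p f \<in> W" if "f \<in> ?I" for f by (rule pW) fact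
    show "p f = f" if "f \<in> W" for f
    proof (rule p_eq[OF _ that subspaceD(3)[OF B(1)]])
      show "f \<in> ?I" using that W(2) by blast
      show "f = fadd f fzero" using fnW[OF that] by (intro fns_eqI) simp_all
    qed
    show "p (fadd f g) = fadd (p f) (p g)" if fg: "f \<in> ?I" "g \<in> ?I" for f g
    proof -
      obtain b c where b: "b \<in> B" "f = fadd (p f) b" and c: "c \<in> B" "g = fadd (p g) c"
        using pB fg by blast
      have "fadd f g = fadd (fadd (p f) (p g)) (fadd b c)"
      proof (rule fns_eqI)
        fix x assume x: "x \<in> carrier G"
        have mem: "p f x \<in> carrier K" "p g x \<in> carrier K" "b x \<in> carrier K" "c x \<in> carrier K"
          using x fnW[OF pW[OF fg(1)]] fnW[OF pW[OF fg(2)]] fnB[OF b(1)] fnB[OF c(1)] by simp_all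
        have "f x = p f x \<oplus>\<^bsub>K\<^esub> b x" "g x = p g x \<oplus>\<^bsub>K\<^esub> c x"
          using fun_cong[OF b(2), of x] fun_cong[OF c(2), of x] x by simp_all
        then show "fadd f g x = fadd (fadd (p f) (p g)) (fadd b c) x"
          using mem x by (simp add: K.a_ac)
      qed (use fg subspaceD(2)[OF I] fnW[OF pW[OF fg(1)]] fnW[OF pW[OF fg(2)]] fnB[OF b(1)] fnB[OF c(1)]
            in simp_all)
      then show ?thesis
        using p_eq subspaceD(4)[OF I fg] subspaceD(4)[OF W(1)] subspaceD(4)[OF B(1)] pW fg b(1) c(1)
        by metis
    qed
    show "p (fsmult a f) = fsmult a (p f)" if fg: "a \<in> carrier K" "f \<in> ?I" for a f
    proof -
      obtain b where b: "b \<in> B" "f = fadd (p f) b" using pB fg by blast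
      have "fsmult a f = fadd (fsmult a (p f)) (fsmult a b)"
      proof (rule fns_eqI)
        fix x assume x: "x \<in> carrier G"
        have mem: "p f x \<in> carrier K" "b x \<in> carrier K"
          using x fnW[OF pW[OF fg(2)]] fnB[OF b(1)] by simp_all
        have "f x = p f x \<oplus>\<^bsub>K\<^esub> b x" using fun_cong[OF b(2), of x] x by simp
        then show "fsmult a f x = fadd (fsmult a (p f)) (fsmult a b) x"
          using mem x fg by (simp add: K.r_distr)
      qed (use fg subspaceD(2)[OF I] fnW[OF pW[OF fg(2)]] fnB[OF b(1)] in simp_all)
      then show ?thesis
        using p_eq subspaceD(5)[OF I fg] subspaceD(5)[OF W(1)] subspaceD(5)[OF B(1)] pW fg b(1)
        by metis
    qed
    show "p (ftrans g f) = ftrans g (p f)" if fg: "g \<in> carrier G" "f \<in> ?I" for g f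
    proof -
      obtain b where b: "b \<in> B" "f = fadd (p f) b" using pB fg by blast
      have "ftrans g f = fadd (ftrans g (p f)) (ftrans g b)"
      proof (rule fns_eqI)
        fix x assume x: "x \<in> carrier G"
        have "f (inv g \<otimes> x) = p f (inv g \<otimes> x) \<oplus>\<^bsub>K\<^esub> b (inv g \<otimes> x)"
          using fun_cong[OF b(2), of "inv g \<otimes> x"] x fg by simp
        then show "ftrans g f x = fadd (ftrans g (p f)) (ftrans g b) x"
          using x fg by simp
      qed (use fg subspaceD(2)[OF I] fnW[OF pW[OF fg(2)]] fnB[OF b(1)] in simp_all)
      then show ?thesis
        using p_eq ftrans_perm_module[OF H fg] W(3)[OF fg(1)] B(3)[OF fg(1)] pW fg b(1)
        by metis
    qed
  qed
qed

lemma kG_iso_perm_moduleD: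
  assumes iso: "kG_iso K G V (perm_module H\<lparr>carrier := W\<rparr>) \<phi>"
  shows "bij_betw \<phi> (carrier V) W"
    "\<And>v w. v \<in> carrier V \<Longrightarrow> w \<in> carrier V \<Longrightarrow> \<phi> (v \<oplus>\<^bsub>V\<^esub> w) = fadd (\<phi> v) (\<phi> w)"
    "\<And>a v. a \<in> carrier K \<Longrightarrow> v \<in> carrier V \<Longrightarrow> \<phi> (a \<odot>\<^bsub>V\<^esub> v) = fsmult a (\<phi> v)"
    "\<And>g v. g \<in> carrier G \<Longrightarrow> v \<in> carrier V \<Longrightarrow> \<phi> (act V g v) = ftrans g (\<phi> v)"
  using iso unfolding kG_iso_def by auto

text \<open>If \<open>S\<close> is transitive on \<open>G/L\<close> and \<open>[L : H]\<close> is odd, then \<open>Sc(G, H)\<close> is all of \<open>k[G/L]\<close>. Let \<open>W\<close> be the copy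
of the Scott module in \<open>k[G/H]\<close>, \<open>p\<close> the projection onto \<open>W\<close> and \<open>e\<close> the projection onto \<open>k[G/L]\<close>. The
trivial submodule of \<open>W\<close> can only consist of the constants, so \<open>p\<close> and \<open>e\<close> both fix these. Hence
\<open>\<theta> = e p\<close> is an automorphism of \<open>k[G/L]\<close>, \<open>W = p(k[G/L]) \<oplus> (W \<inter> ker e)\<close>, and indecomposability leaves
\<open>W \<inter> ker e = 0\<close>.\<close>

theorem scott_module_iso_perm_module:
  fixes V :: "('k, 'v, 'a) gmodule"
  assumes scott: "is_scott_module K G H V"
    and L: "subgroup L G" and H: "subgroup H G" and HL: "H \<subseteq> L"
    and odd: "odd (card ((\<lambda>l. l <#\<^bsub>G\<^esub> H) ` L))"
    and S: "subgroup S G" "card S = 2 ^ a"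
    and G_eq: "\<And>x. x \<in> carrier G \<Longrightarrow> \<exists>s\<in>S. \<exists>l\<in>L. x = s \<otimes> l"
  shows "\<exists>\<psi>. kG_iso K G V (perm_module L) \<psi>"
proof -
  have HG: "H \<subseteq> carrier G" and LG: "L \<subseteq> carrier G" using H L subgroup.subset by blast+
  let ?I = "carrier (perm_module H)" and ?U = "carrier (perm_module L)"
  let ?one = "\<lambda>x\<in>carrier G. \<one>\<^bsub>K\<^esub>"
  obtain W B \<phi> T \<tau> where kV: "kG_module K G V" and ind: "kG_indecomposable K G V"
    and ds: "kG_direct_sum K G (perm_module H) W B"
    and \<phi>: "kG_iso K G V (perm_module H\<lparr>carrier := W\<rparr>) \<phi>"
    and T: "kG_submodule K G V T" and \<tau>: "kG_iso K G (V\<lparr>carrier := T\<rparr>) (trivial_kG_module K) \<tau>"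
    using scott unfolding is_scott_module_def Let_def perm_module_def kG_direct_summand_def
      kG_isomorphic_def by blast
  interpret V: module K V using kV by (simp add: kG_module_def)
  note iso = kG_iso_perm_moduleD[OF \<phi>]
  have sW: "kG_submodule K G (perm_module H) W" using ds by (simp add: kG_direct_sum_def)
  note W = kG_submodule_perm_moduleD[OF sW HG]
  note U = subspace_perm_module[OF LG] and I = subspace_perm_module[OF HG]
  have act_closed: "act V g v \<in> carrier V" if "g \<in> carrier G" "v \<in> carrier V" for g v
    using kV that by (simp add: kG_module_def)
  have UI: "?U \<subseteq> ?I" using HL unfolding subset_iff mem_perm_module by blast
  have \<phi>W: "\<phi> v \<in> W" if "v \<in> carrier V" for v using iso(1) that by (auto simp: bij_betw_def)
  have \<phi>0: "\<phi> \<zero>\<^bsub>V\<^esub> = fzero"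
  proof -
    have "\<phi> \<zero>\<^bsub>V\<^esub> \<in> fns" using \<phi>W subspaceD(2)[OF W(1)] by simp
    moreover have "\<phi> \<zero>\<^bsub>V\<^esub> = fadd (\<phi> \<zero>\<^bsub>V\<^esub>) (\<phi> \<zero>\<^bsub>V\<^esub>)" using iso(2)[of "\<zero>\<^bsub>V\<^esub>" "\<zero>\<^bsub>V\<^esub>"] by simp
    moreover have "fadd f f = fzero" if "f \<in> fns" for f using that by (intro fns_eqI) simp_all
    ultimately show ?thesis by metis
  qed
  \<comment> \<open>A generator of the trivial submodule corresponds to an invariant, hence constant, function.\<close>
  have one_W: "?one \<in> W"
  proof -
    have bij: "bij_betw \<tau> T (carrier K)"
      and \<tau>act: "\<And>g v. g \<in> carrier G \<Longrightarrow> v \<in> T \<Longrightarrow> \<tau> (act V g v) = \<tau> v"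
      and \<tau>add: "\<And>v w. v \<in> T \<Longrightarrow> w \<in> T \<Longrightarrow> \<tau> (v \<oplus>\<^bsub>V\<^esub> w) = \<tau> v \<oplus>\<^bsub>K\<^esub> \<tau> w"
      using \<tau> by (auto simp: kG_iso_def trivial_kG_module_def)
    have TV: "T \<subseteq> carrier V" and T0: "\<zero>\<^bsub>V\<^esub> \<in> T" and
      Tact: "\<And>g v. g \<in> carrier G \<Longrightarrow> v \<in> T \<Longrightarrow> act V g v \<in> T"
      using T V.submoduleE(1)[of T] subgroup.one_closed[of T "add_monoid V"]
      by (auto simp: kG_submodule_def submodule_def)
    obtain t where t: "t \<in> T" "\<tau> t = \<one>\<^bsub>K\<^esub>" using bij by (metis K.one_closed bij_betwE bij_betw_imp_surj_on imageE)
    have "\<tau> \<zero>\<^bsub>V\<^esub> \<in> carrier K" using bij T0 by (auto simp: bij_betw_def)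
    then have "\<tau> \<zero>\<^bsub>V\<^esub> = \<zero>\<^bsub>K\<^esub>" using \<tau>add[OF T0 T0] add_self by simp
    then have t0: "t \<noteq> \<zero>\<^bsub>V\<^esub>" using t by auto
    have tV: "t \<in> carrier V" using t TV by blast
    have fixed: "act V g t = t" if "g \<in> carrier G" for g
      using bij \<tau>act[OF that t(1)] Tact[OF that t(1)] t(1) by (auto simp: bij_betw_def dest: inj_onD)
    define f where "f = \<phi> t"
    have fW: "f \<in> W" and ff: "f \<in> fns" using \<phi>W[OF tV] subspaceD(2)[OF W(1)] by (auto simp: f_def)
    have const: "f x = f \<one>" if x: "x \<in> carrier G" for x
    proof -
      have "f = ftrans x f" using iso(4)[OF x tV] fixed[OF x] by (simp add: f_def)
      then have "f x = ftrans x f x" by simp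
      then show ?thesis using x by simp
    qed
    have "f \<noteq> fzero"
    proof
      assume "f = fzero"
      then have "\<phi> t = \<phi> \<zero>\<^bsub>V\<^esub>" using \<phi>0 by (simp add: f_def)
      then show False using iso(1) tV t0 by (auto simp: bij_betw_def dest: inj_onD)
    qed
    have "f \<one> \<noteq> \<zero>\<^bsub>K\<^esub>"
    proof
      assume "f \<one> = \<zero>\<^bsub>K\<^esub>"
      then have "f x = fzero x" if "x \<in> carrier G" for x using const[OF that] that by simp
      then show False using fns_eqI[OF ff fns_closed(1)] \<open>f \<noteq> fzero\<close> by blast
    qed
    then have unit: "f \<one> \<in> Units K" using ff by (simp add: K.field_Units)
    have "fsmult (inv\<^bsub>K\<^esub> (f \<one>)) f = ?one"
    proof (rule fns_eqI)
      fix x assume x: "x \<in> carrier G"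
      then show "fsmult (inv\<^bsub>K\<^esub> (f \<one>)) f x = ?one x" using unit const[OF x] by simp
    qed (use ff unit in auto)
    then show ?thesis using subspaceD(5)[OF W(1) K.Units_inv_closed[OF unit] fW] by simp
  qed

  obtain p where p: "\<And>f. f \<in> ?I \<Longrightarrow> p f \<in> W" "\<And>f. f \<in> W \<Longrightarrow> p f = f"
    "\<And>f g. f \<in> ?I \<Longrightarrow> g \<in> ?I \<Longrightarrow> p (fadd f g) = fadd (p f) (p g)"
    "\<And>a f. a \<in> carrier K \<Longrightarrow> f \<in> ?I \<Longrightarrow> p (fsmult a f) = fsmult a (p f)"
    "\<And>g f. g \<in> carrier G \<Longrightarrow> f \<in> ?I \<Longrightarrow> p (ftrans g f) = ftrans g (p f)"
    using summand_projection[OF ds HG] by blast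
  define e where "e = coset_sum L H"
  note e_add = coset_sum_add[OF L H HL, folded e_def]
    and e_smult = coset_sum_smult[OF L H HL, folded e_def]
    and e_trans = coset_sum_ftrans[OF L H HL, folded e_def]
    and e_mem = coset_sum_mem[OF L H HL, folded e_def]
    and e_id = coset_sum_id[OF L H HL odd, folded e_def]
  have fnW: "f \<in> fns" if "f \<in> W" for f using that subspaceD(2)[OF W(1)] by blast
  have pU: "p f \<in> W" "p f \<in> ?I" "p f \<in> fns" if "f \<in> ?U" for f
    using that p(1) UI W(2) fnW by blast+
  have UinI: "f \<in> ?I" if "f \<in> ?U" for f using that UI by blast
  define \<theta> where "\<theta> = (\<lambda>f. e (p f))"
  have \<theta>U: "\<theta> f \<in> ?U" if "f \<in> ?U" for f using that pU e_mem by (simp add: \<theta>_def)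
  have \<theta>add: "\<theta> (fadd f g) = fadd (\<theta> f) (\<theta> g)" if "f \<in> ?U" "g \<in> ?U" for f g
    using that by (simp add: \<theta>_def p UinI e_add pU)
  have \<theta>smult: "\<theta> (fsmult c f) = fsmult c (\<theta> f)" if "c \<in> carrier K" "f \<in> ?U" for c f
    using that by (simp add: \<theta>_def p UinI e_smult pU)
  have \<theta>trans: "\<theta> (ftrans g f) = ftrans g (\<theta> f)" if "g \<in> carrier G" "f \<in> ?U" for g f
    using that by (simp add: \<theta>_def p UinI e_trans pU)
  have one_U: "?one \<in> ?U" using LG by (auto simp: mem_perm_module)
  have \<theta>one: "\<theta> ?one = ?one" using p(2)[OF one_W] e_id[OF one_U] by (simp add: \<theta>_def)
  have one_nz: "?one \<noteq> fzero"
  proof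
    assume "?one = fzero"
    then have "?one \<one> = fzero \<one>" by (rule fun_cong)
    then show False by simp
  qed
  have scale0: "fsmult c fzero = fzero" if "c \<in> carrier K" for c
    using that by (intro fns_eqI) simp_all
  have add0: "fadd fzero fzero = fzero" by (intro fns_eqI) simp_all
  have trans0: "ftrans g fzero = fzero" if "g \<in> carrier G" for g
    using that by (intro fns_eqI) simp_all
  have fsm0: "fsmult \<zero>\<^bsub>K\<^esub> f = fzero" if "f \<in> fns" for f
    using that by (intro fns_eqI) simp_all
  \<comment> \<open>A nonzero kernel would be a submodule of \<open>k[G/L]\<close>, so it would contain the constants.\<close>
  have \<theta>ker: "f = fzero" if f: "f \<in> ?U" "\<theta> f = fzero" for f
  proof (rule ccontr)
    assume nz: "f \<noteq> fzero"
    let ?N = "{f \<in> ?U. \<theta> f = fzero}"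
    have "\<theta> fzero = fzero"
      using \<theta>smult[of "\<zero>\<^bsub>K\<^esub>" fzero] subspaceD(3)[OF U] \<theta>U subspaceD(2)[OF U] fsm0 by simp
    then have N: "subspace ?N"
      using subspaceD[OF U] \<theta>add \<theta>smult add0 scale0 unfolding subspace_def by simp blast
    have "?one \<in> ?N"
      by (rule nonzero_submodule_contains_constants[OF S L G_eq N])
         (use f nz ftrans_perm_module[OF LG] \<theta>trans trans0 in auto)
    then show False using \<theta>one one_nz by simp
  qed
  have \<theta>surj: "\<theta> ` ?U = ?U"
    by (rule injective_endomorphism_surjective[OF U \<theta>U \<theta>add \<theta>smult \<theta>ker])

  \<comment> \<open>The decomposition of \<open>W\<close>, pulled back to \<open>V\<close>.\<close>
  define V1 where "V1 = {v \<in> carrier V. \<phi> v \<in> p ` ?U}"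
  define V2 where "V2 = {v \<in> carrier V. e (\<phi> v) = fzero}"
  have \<phi>fns: "\<phi> v \<in> fns" if "v \<in> carrier V" for v using \<phi>W that fnW by blast
  have p0: "p fzero = fzero" using p(2) subspaceD(3)[OF W(1)] by blast
  have e0: "e fzero = fzero" using e_id subspaceD(3)[OF U] by blast
  have sub1: "kG_submodule K G V V1"
  proof -
    have add1: "v \<oplus>\<^bsub>V\<^esub> w \<in> V1" if "v \<in> V1" "w \<in> V1" for v w
    proof -
      obtain f g where fg: "f \<in> ?U" "g \<in> ?U" "\<phi> v = p f" "\<phi> w = p g"
        using \<open>v \<in> V1\<close> \<open>w \<in> V1\<close> by (auto simp: V1_def)
      have "\<phi> (v \<oplus>\<^bsub>V\<^esub> w) = p (fadd f g)"
        using that fg by (simp add: V1_def iso p UinI)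
      then show ?thesis using that subspaceD(4)[OF U fg(1,2)] by (auto simp: V1_def)
    qed
    have sm1: "c \<odot>\<^bsub>V\<^esub> v \<in> V1" if "c \<in> carrier K" "v \<in> V1" for c v
    proof -
      obtain f where fg: "f \<in> ?U" "\<phi> v = p f" using \<open>v \<in> V1\<close> by (auto simp: V1_def)
      have "\<phi> (c \<odot>\<^bsub>V\<^esub> v) = p (fsmult c f)"
        using that fg by (simp add: V1_def iso p UinI)
      then show ?thesis using that subspaceD(5)[OF U that(1) fg(1)] by (auto simp: V1_def)
    qed
    have act1: "act V g v \<in> V1" if "g \<in> carrier G" "v \<in> V1" for g v
    proof -
      obtain f where fg: "f \<in> ?U" "\<phi> v = p f" using \<open>v \<in> V1\<close> by (auto simp: V1_def)
      have "\<phi> (act V g v) = p (ftrans g f)"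
        using that fg by (simp add: V1_def iso p UinI)
      then show ?thesis
        using that ftrans_perm_module[OF LG that(1) fg(1)] act_closed by (auto simp: V1_def)
    qed
    have zero1: "\<zero>\<^bsub>V\<^esub> \<in> V1"
      using \<phi>0 p0 subspaceD(3)[OF U] unfolding V1_def by (simp add: image_iff) metis
    have sub: "V1 \<subseteq> carrier V" by (auto simp: V1_def)
    have "submodule V1 K V"
      by (rule V.submoduleI[OF sub zero1 _ add1 sm1])
         (use sm1 V.uminus_smult sub K.one_closed K.a_inv_closed in \<open>metis subsetD\<close>)
    then show ?thesis using act1 by (simp add: kG_submodule_def)
  qed
  have sub2: "kG_submodule K G V V2"
  proof -
    have add2: "v \<oplus>\<^bsub>V\<^esub> w \<in> V2" if "v \<in> V2" "w \<in> V2" for v w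
      using that by (simp add: V2_def iso e_add \<phi>fns add0)
    have sm2: "c \<odot>\<^bsub>V\<^esub> v \<in> V2" if "c \<in> carrier K" "v \<in> V2" for c v
      using that by (simp add: V2_def iso e_smult \<phi>fns scale0)
    have act2: "act V g v \<in> V2" if "g \<in> carrier G" "v \<in> V2" for g v
      using that by (simp add: V2_def iso e_trans \<phi>fns trans0 act_closed)
    have zero2: "\<zero>\<^bsub>V\<^esub> \<in> V2" using \<phi>0 e0 by (simp add: V2_def)
    have sub: "V2 \<subseteq> carrier V" by (auto simp: V2_def)
    have "submodule V2 K V"
      by (rule V.submoduleI[OF sub zero2 _ add2 sm2])
         (use sm2 V.uminus_smult sub K.one_closed K.a_inv_closed in \<open>metis subsetD\<close>)
    then show ?thesis using act2 by (simp add: kG_submodule_def)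
  qed
  have inj\<phi>: "v = w" if "v \<in> carrier V" "w \<in> carrier V" "\<phi> v = \<phi> w" for v w
    using that iso(1) by (auto simp: bij_betw_def dest: inj_onD)
  have surj\<phi>: "\<exists>v\<in>carrier V. \<phi> v = f" if "f \<in> W" for f
    using that iso(1) by (auto simp: bij_betw_def)
  have e\<phi>U: "e (\<phi> v) \<in> ?U" if "v \<in> carrier V" for v
    using e_mem \<phi>W[OF that] W(2) by blast
  have "kG_direct_sum K G V V1 V2"
  proof -
    have "v \<in> V1 <+>\<^bsub>V\<^esub> V2" if v: "v \<in> carrier V" for v
    proof -
      have "e (\<phi> v) \<in> \<theta> ` ?U" unfolding \<theta>surj using e\<phi>U[OF v] .
      \<comment> \<open>The component \<open>w\<close> of \<open>v\<close> in \<open>V1\<close> is the one with the same image under \<open>e\<close>.\<close>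
      then obtain u where u: "u \<in> ?U" "e (\<phi> v) = e (p u)" by (auto simp: \<theta>_def)
      obtain w where w: "w \<in> carrier V" "\<phi> w = p u" using surj\<phi>[OF pU(1)[OF u(1)]] by blast
      have w1: "w \<in> V1" using w u by (auto simp: V1_def)
      define d where "d = (\<ominus>\<^bsub>V\<^esub> w) \<oplus>\<^bsub>V\<^esub> v"
      have dV: "d \<in> carrier V" using v w by (simp add: d_def)
      have vd: "v = w \<oplus>\<^bsub>V\<^esub> d" using v w by (simp add: d_def V.a_assoc[symmetric] V.r_neg)
      have "e (\<phi> v) = fadd (e (\<phi> w)) (e (\<phi> d))"
        using iso(2)[OF w(1) dV] e_add[OF \<phi>fns[OF w(1)] \<phi>fns[OF dV]] vd by simp
      moreover have "e (\<phi> v) = e (\<phi> w)" using u w by simp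
      ultimately have eq: "e (\<phi> w) = fadd (e (\<phi> w)) (e (\<phi> d))" by simp
      have fn: "e (\<phi> w) \<in> fns" "e (\<phi> d) \<in> fns"
        using e\<phi>U[OF w(1)] e\<phi>U[OF dV] subspaceD(2)[OF U] by blast+
      have "e (\<phi> d) x = fzero x" if x: "x \<in> carrier G" for x
      proof -
        have mem: "e (\<phi> w) x \<in> carrier K" "e (\<phi> d) x \<in> carrier K" using fn x by simp_all
        have "e (\<phi> w) x = e (\<phi> w) x \<oplus>\<^bsub>K\<^esub> e (\<phi> d) x" using fun_cong[OF eq, of x] x by simp
        then have "e (\<phi> w) x \<oplus>\<^bsub>K\<^esub> e (\<phi> d) x = e (\<phi> w) x \<oplus>\<^bsub>K\<^esub> \<zero>\<^bsub>K\<^esub>" using mem by simp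
        then have "e (\<phi> d) x = \<zero>\<^bsub>K\<^esub>" using K.add.l_cancel mem by blast
        then show ?thesis using x by simp
      qed
      then have "d \<in> V2" using fns_eqI[OF fn(2) fns_closed(1)] dV by (simp add: V2_def)
      then show ?thesis using w1 vd unfolding set_add_def set_mult_def by auto
    qed
    moreover have "V1 <+>\<^bsub>V\<^esub> V2 \<subseteq> carrier V"
      by (auto simp: set_add_def set_mult_def V1_def V2_def)
    moreover have "v = \<zero>\<^bsub>V\<^esub>" if v: "v \<in> V1" "v \<in> V2" for v
    proof -
      obtain u where u: "u \<in> ?U" "\<phi> v = p u" using v by (auto simp: V1_def)
      then have "\<theta> u = fzero" using v by (simp add: V2_def \<theta>_def)
      then have "u = fzero" by (rule \<theta>ker[OF u(1)])
      then have "\<phi> v = \<phi> \<zero>\<^bsub>V\<^esub>" using u p0 \<phi>0 by simp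
      then show ?thesis using inj\<phi> v by (simp add: V2_def)
    qed
    moreover have "\<zero>\<^bsub>V\<^esub> \<in> V1" "\<zero>\<^bsub>V\<^esub> \<in> V2"
      using sub1 sub2 subgroup.one_closed[of _ "add_monoid V"]
      by (auto simp: kG_submodule_def submodule_def)
    ultimately show ?thesis using sub1 sub2 unfolding kG_direct_sum_def by blast
  qed
  then have "V1 = {\<zero>\<^bsub>V\<^esub>} \<or> V2 = {\<zero>\<^bsub>V\<^esub>}" using ind by (simp add: kG_indecomposable_def)
  moreover have "V1 \<noteq> {\<zero>\<^bsub>V\<^esub>}"
  proof
    assume "V1 = {\<zero>\<^bsub>V\<^esub>}"
    moreover obtain v where v: "v \<in> carrier V" "\<phi> v = ?one" using surj\<phi>[OF one_W] by blast
    moreover have "v \<in> V1" using v one_U p(2)[OF one_W] unfolding V1_def by (simp add: image_iff) metis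
    ultimately show False using \<phi>0 one_nz by simp
  qed
  ultimately have V2: "V2 = {\<zero>\<^bsub>V\<^esub>}" by blast

  have "kG_iso K G V (perm_module L) (\<lambda>v. e (\<phi> v))"
    unfolding kG_iso_def
  proof (intro conjI ballI)
    show "bij_betw (\<lambda>v. e (\<phi> v)) (carrier V) ?U"
    proof (rule bij_betw_imageI)
      show "inj_on (\<lambda>v. e (\<phi> v)) (carrier V)"
      proof (rule inj_onI)
        fix v w assume vw: "v \<in> carrier V" "w \<in> carrier V" "e (\<phi> v) = e (\<phi> w)"
        have "e (\<phi> (v \<oplus>\<^bsub>V\<^esub> w)) = fadd (e (\<phi> w)) (e (\<phi> w))"
          using vw iso(2)[OF vw(1,2)] e_add[OF \<phi>fns[OF vw(1)] \<phi>fns[OF vw(2)]] by simp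
        also have "\<dots> = fzero"
          using subspaceD(2)[OF U e\<phi>U[OF vw(2)]] by (intro fns_eqI) simp_all
        finally have "v \<oplus>\<^bsub>V\<^esub> w \<in> V2" using vw by (simp add: V2_def)
        then have "fadd (\<phi> v) (\<phi> w) = fzero" using V2 iso(2)[OF vw(1,2)] \<phi>0 by simp
        then have "\<phi> v = \<phi> w" using fadd_eq_fzeroD \<phi>fns vw by blast
        then show "v = w" using inj\<phi> vw by blast
      qed
      show "(\<lambda>v. e (\<phi> v)) ` carrier V = ?U"
      proof
        show "?U \<subseteq> (\<lambda>v. e (\<phi> v)) ` carrier V"
        proof
          fix u assume "u \<in> ?U"
          then have "u \<in> \<theta> ` ?U" using \<theta>surj by simp
          then obtain u' where u': "u' \<in> ?U" "u = e (p u')" by (auto simp: \<theta>_def)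
          obtain v where v: "v \<in> carrier V" "\<phi> v = p u'" using surj\<phi>[OF pU(1)[OF u'(1)]] by blast
          show "u \<in> (\<lambda>v. e (\<phi> v)) ` carrier V"
            by (rule image_eqI[of _ _ v]) (use u' v in simp_all)
        qed
      qed (use e\<phi>U in blast)
    qed
  qed (use iso e_add e_smult e_trans \<phi>fns in simp_all)
  then show ?thesis by blast
qed

text \<open>A coset \<open>xL\<close> is fixed by \<open>Q\<close> if and only if \<open>x\<close> conjugates \<open>Q\<close> into \<open>L\<close>, so this is the preimage in \<open>G\<close> of the set
of fixed points of \<open>Q\<close> in \<open>G/L\<close>.\<close>

definition conjugated_into :: "'a set \<Rightarrow> 'a set \<Rightarrow> 'a set" where
  "conjugated_into Q L = {x \<in> carrier G. \<forall>q\<in>Q. inv x \<otimes> q \<otimes> x \<in> L}"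

end

section \<open>Brauer quotients of permutation modules\<close>

text \<open>The hypotheses for computing the Brauer quotient at \<open>Q\<close> of a module \<open>V\<close> that is isomorphic to
\<open>k[G/L]\<close>. Working with \<open>V\<close> and \<open>\<psi>\<close> avoids transporting traces and quotients along isomorphisms.\<close>

locale perm_module_copy = finite_group_char_2 G K
  for G (structure) and K :: "('k, 'n) ring_scheme" +
  fixes V :: "('k, 'v, 'a) gmodule" and L :: "'a set" and \<psi> :: "'v \<Rightarrow> 'a \<Rightarrow> 'k"
    and Q :: "'a set" and m :: nat
  assumes kG: "kG_module K G V" and L: "subgroup L G"
    and \<psi>: "kG_iso K G V (perm_module L) \<psi>"
    and Q: "subgroup Q G" and card_Q: "card Q = 2 ^ m"
begin

sublocale V: module K V using kG by (simp add: kG_module_def)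

lemma LG: "L \<subseteq> carrier G" and QG: "Q \<subseteq> carrier G"
  using L Q subgroup.subset by blast+

lemma act_closed [simp]: "g \<in> carrier G \<Longrightarrow> v \<in> carrier V \<Longrightarrow> act V g v \<in> carrier V"
  and act_add: "g \<in> carrier G \<Longrightarrow> v \<in> carrier V \<Longrightarrow> w \<in> carrier V \<Longrightarrow>
    act V g (v \<oplus>\<^bsub>V\<^esub> w) = act V g v \<oplus>\<^bsub>V\<^esub> act V g w"
  and act_smult: "g \<in> carrier G \<Longrightarrow> a \<in> carrier K \<Longrightarrow> v \<in> carrier V \<Longrightarrow>
    act V g (a \<odot>\<^bsub>V\<^esub> v) = a \<odot>\<^bsub>V\<^esub> act V g v"
  and act_mult: "g \<in> carrier G \<Longrightarrow> h \<in> carrier G \<Longrightarrow> v \<in> carrier V \<Longrightarrow>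
    act V (g \<otimes> h) v = act V g (act V h v)"
  using kG by (simp_all add: kG_module_def)

lemma \<psi>_bij: "bij_betw \<psi> (carrier V) (carrier (perm_module L))"
  and \<psi>_add: "v \<in> carrier V \<Longrightarrow> w \<in> carrier V \<Longrightarrow> \<psi> (v \<oplus>\<^bsub>V\<^esub> w) = fadd (\<psi> v) (\<psi> w)"
  and \<psi>_smult: "a \<in> carrier K \<Longrightarrow> v \<in> carrier V \<Longrightarrow> \<psi> (a \<odot>\<^bsub>V\<^esub> v) = fsmult a (\<psi> v)"
  and \<psi>_act: "g \<in> carrier G \<Longrightarrow> v \<in> carrier V \<Longrightarrow> \<psi> (act V g v) = ftrans g (\<psi> v)"
  using \<psi> by (simp_all add: kG_iso_def)

lemma \<psi>_mem: "v \<in> carrier V \<Longrightarrow> \<psi> v \<in> carrier (perm_module L)"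
  using \<psi>_bij by (rule bij_betwE[rule_format])

lemma \<psi>_fns [simp]: "v \<in> carrier V \<Longrightarrow> \<psi> v \<in> fns"
  using \<psi>_mem mem_perm_module by blast

lemma \<psi>_L: "v \<in> carrier V \<Longrightarrow> x \<in> carrier G \<Longrightarrow> l \<in> L \<Longrightarrow> \<psi> v (x \<otimes> l) = \<psi> v x"
  using \<psi>_mem mem_perm_module by blast

lemma \<psi>_inj: "v \<in> carrier V \<Longrightarrow> w \<in> carrier V \<Longrightarrow> \<psi> v = \<psi> w \<Longrightarrow> v = w"
  using \<psi>_bij by (auto simp: bij_betw_def dest: inj_onD)

lemma add_self_V: "v \<in> carrier V \<Longrightarrow> v \<oplus>\<^bsub>V\<^esub> v = \<zero>\<^bsub>V\<^esub>"
  using V.smult_l_distr[of "\<one>\<^bsub>K\<^esub>" "\<one>\<^bsub>K\<^esub>" v] char_2 by simp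

lemma a_inv_V: "v \<in> carrier V \<Longrightarrow> \<ominus>\<^bsub>V\<^esub> v = v"
  using add_self_V V.minus_equality by blast

lemma \<psi>_zero: "\<psi> \<zero>\<^bsub>V\<^esub> = fzero"
proof (rule fns_eqI)
  fix x assume x: "x \<in> carrier G"
  have "\<psi> \<zero>\<^bsub>V\<^esub> x = \<psi> \<zero>\<^bsub>V\<^esub> x \<oplus>\<^bsub>K\<^esub> \<psi> \<zero>\<^bsub>V\<^esub> x"
    using fun_cong[OF \<psi>_add[of "\<zero>\<^bsub>V\<^esub>" "\<zero>\<^bsub>V\<^esub>"], of x] x by simp
  then show "\<psi> \<zero>\<^bsub>V\<^esub> x = fzero x" using x by simp
qed simp_all

text \<open>Evaluation at a point is additive, so values of traces can be computed in \<open>K\<close>.\<close>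

lemma \<psi>_finsum:
  assumes "finite C" "f \<in> C \<rightarrow> carrier V" and x: "x \<in> carrier G"
  shows "\<psi> (\<Oplus>\<^bsub>V\<^esub>c\<in>C. f c) x = (\<Oplus>\<^bsub>K\<^esub>c\<in>C. \<psi> (f c) x)"
  using assms(1,2)
proof induction
  case empty
  then show ?case using x by (simp add: \<psi>_zero)
next
  case (insert c C)
  then have f: "f c \<in> carrier V" "f \<in> C \<rightarrow> carrier V" by auto
  moreover have "(\<lambda>c. \<psi> (f c) x) \<in> C \<rightarrow> carrier K" using f x by (simp add: Pi_iff)
  ultimately show ?case
    using insert x by (simp add: V.finsum_insert K.finsum_insert \<psi>_add)
qed

lemma Q_coset_rep:
  assumes R: "subgroup R G" "R \<subseteq> Q" and C: "C \<in> (\<lambda>x. x <#\<^bsub>G\<^esub> R) ` Q"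
  shows "(SOME c. c \<in> C) \<in> Q" "C = (SOME c. c \<in> C) <#\<^bsub>G\<^esub> R" "(SOME c. c \<in> C) \<in> carrier G"
  using coset_rep[OF Q R C] by blast+

lemma relative_trace_closed:
  assumes "subgroup R G" "R \<subseteq> Q" "v \<in> carrier V"
  shows "relative_trace G V R Q v \<in> carrier V"
  unfolding relative_trace_def
  by (rule V.finsum_closed) (use assms Q_coset_rep(3) in auto)

lemma \<psi>_relative_trace:
  assumes R: "subgroup R G" "R \<subseteq> Q" and v: "v \<in> carrier V" and x: "x \<in> carrier G"
  shows "\<psi> (relative_trace G V R Q v) x
    = (\<Oplus>\<^bsub>K\<^esub>C\<in>(\<lambda>x. x <#\<^bsub>G\<^esub> R) ` Q. \<psi> v (inv (SOME c. c \<in> C) \<otimes> x))"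
proof -
  let ?R = "(\<lambda>x. x <#\<^bsub>G\<^esub> R) ` Q"
  have "(\<lambda>C. act V (SOME c. c \<in> C) v) \<in> ?R \<rightarrow> carrier V" using Q_coset_rep(3)[OF R] v by auto
  then have "\<psi> (relative_trace G V R Q v) x = (\<Oplus>\<^bsub>K\<^esub>C\<in>?R. \<psi> (act V (SOME c. c \<in> C) v) x)"
    unfolding relative_trace_def using finite_cosets[OF Q R] x by (intro \<psi>_finsum)
  also have "\<dots> = (\<Oplus>\<^bsub>K\<^esub>C\<in>?R. \<psi> v (inv (SOME c. c \<in> C) \<otimes> x))"
    by (rule K.finsum_cong') (use Q_coset_rep(3)[OF R] v x \<psi>_act in auto)
  finally show ?thesis .
qed

lemma even_card_cosets:
  assumes R: "subgroup R G" "R \<subset> Q"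
  shows "even (card ((\<lambda>x. x <#\<^bsub>G\<^esub> R) ` Q))"
proof -
  have fin: "finite Q" using QG finite_carrier finite_subset by blast
  interpret Q: group "G\<lparr>carrier := Q\<rparr>" using subgroup.subgroup_is_group[OF Q group_axioms] .
  have "subgroup R (G\<lparr>carrier := Q\<rparr>)" using subgroup_incl[OF R(1) Q] R(2) by blast
  then have "card (lcosets\<^bsub>G\<lparr>carrier := Q\<rparr>\<^esub> R) * card R = order (G\<lparr>carrier := Q\<rparr>)"
    using fin by (intro Q.l_lagrange) simp_all
  moreover have "lcosets\<^bsub>G\<lparr>carrier := Q\<rparr>\<^esub> R = (\<lambda>x. x <#\<^bsub>G\<^esub> R) ` Q"
    by (auto simp: LCOSETS_def l_coset_def)
  ultimately have eq: "card ((\<lambda>x. x <#\<^bsub>G\<^esub> R) ` Q) * card R = 2 ^ m"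
    using card_Q by (simp add: order_def)
  have "card R < 2 ^ m" using R(2) fin card_Q psubset_card_mono by metis
  moreover have "card ((\<lambda>x. x <#\<^bsub>G\<^esub> R) ` Q) dvd 2 ^ m" using eq by (metis dvd_triv_left)
  then obtain i where "card ((\<lambda>x. x <#\<^bsub>G\<^esub> R) ` Q) = 2 ^ i"
    using divides_primepow_nat two_is_prime_nat by blast
  ultimately show ?thesis using eq by (cases i) auto
qed

text \<open>\<open>Q\<close> fixes the coset \<open>xL\<close>.\<close>

lemma conj_translate:
  assumes x: "x \<in> conjugated_into Q L" and q: "q \<in> Q" and v: "v \<in> carrier V"
  shows "\<psi> v (inv q \<otimes> x) = \<psi> v x"
proof -
  have xG: "x \<in> carrier G" and "inv x \<otimes> inv q \<otimes> x \<in> L"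
    using x q subgroup.m_inv_closed[OF Q] by (auto simp: conjugated_into_def)
  moreover have "inv q \<otimes> x = x \<otimes> (inv x \<otimes> inv q \<otimes> x)"
    using xG q QG by (simp add: m_assoc[symmetric] subset_iff)
  ultimately show ?thesis using \<psi>_L[OF v xG] by simp
qed

lemma trace_sum_subgroup: "subgroup (trace_sum G V Q) (add_monoid V)"
  unfolding trace_sum_def
proof (rule V.add.generate_is_subgroup)
  show "(\<Union>R\<in>{R. subgroup R G \<and> R \<subset> Q}. relative_trace G V R Q ` fixed_points V R) \<subseteq> carrier V"
    using relative_trace_closed by (auto simp: fixed_points_def)
qed

text \<open>At a fixed point of \<open>Q\<close> all \<open>[Q : R]\<close> summands of a trace from \<open>R\<close> have the same value, and
\<open>[Q : R]\<close> is even, as \<open>R\<close> is a proper subgroup of a 2-group.\<close>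

lemma trace_sum_vanishes:
  assumes "v \<in> trace_sum G V Q" and x: "x \<in> conjugated_into Q L"
  shows "\<psi> v x = \<zero>\<^bsub>K\<^esub>"
proof -
  have xG: "x \<in> carrier G" using x by (simp add: conjugated_into_def)
  have gen: "\<psi> v x = \<zero>\<^bsub>K\<^esub> \<and> v \<in> carrier V"
    if vU: "v \<in> (\<Union>R\<in>{R. subgroup R G \<and> R \<subset> Q}. relative_trace G V R Q ` fixed_points V R)" for v
  proof -
    obtain R w where R: "subgroup R G" "R \<subset> Q" and w: "w \<in> carrier V"
      and v: "v = relative_trace G V R Q w" using vU unfolding fixed_points_def by blast
    have RQ: "R \<subseteq> Q" using R(2) by blast
    have "\<psi> v x = (\<Oplus>\<^bsub>K\<^esub>C\<in>(\<lambda>x. x <#\<^bsub>G\<^esub> R) ` Q. \<psi> w x)"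
      unfolding v \<psi>_relative_trace[OF R(1) RQ w xG]
      by (rule K.finsum_cong') (use conj_translate[OF x Q_coset_rep(1)[OF R(1) RQ] w] w xG in auto)
    also have "\<dots> = \<zero>\<^bsub>K\<^esub>"
      using finsum_const_char_2[OF _ finite_cosets[OF Q R(1) RQ], of "\<psi> w x"]
        even_card_cosets[OF R] w xG by simp
    finally show ?thesis using v relative_trace_closed[OF R(1) RQ w] by simp
  qed
  have "\<psi> v x = \<zero>\<^bsub>K\<^esub> \<and> v \<in> carrier V"
    using assms(1) unfolding trace_sum_def
  proof (induction rule: generate.induct)
    case one
    then show ?case using \<psi>_zero xG by simp
  next
    case (incl h)
    then show ?case by (rule gen)
  next
    case (inv h)
    then have "\<psi> h x = \<zero>\<^bsub>K\<^esub> \<and> h \<in> carrier V" by (rule gen)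
    moreover have "inv\<^bsub>add_monoid V\<^esub> h = \<ominus>\<^bsub>V\<^esub> h" by (simp add: a_inv_def)
    ultimately show ?case by (simp add: a_inv_V)
  next
    case (eng h1 h2)
    then show ?case using \<psi>_add xG by simp
  qed
  then show ?thesis by simp
qed

text \<open>Together with the preceding lemma this identifies \<open>V(Q)\<close> with the functions on the fixed points of
\<open>Q\<close> in \<open>G/L\<close>. A \<open>Q\<close>-invariant function is a combination of indicator functions of \<open>Q\<close>-orbits, and the
indicator of the orbit of \<open>xL\<close> is the trace of the indicator of \<open>xL\<close> from the stabilizer \<open>R\<close> of \<open>xL\<close>.
Since \<open>v\<close> vanishes on the fixed points, only orbits with \<open>R\<close> a proper subgroup occur. The induction
removes one orbit at a time from the support of \<open>v\<close>.\<close>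

lemma vanishing_imp_trace_sum:
  assumes "v \<in> fixed_points V Q" and "\<And>x. x \<in> conjugated_into Q L \<Longrightarrow> \<psi> v x = \<zero>\<^bsub>K\<^esub>"
  shows "v \<in> trace_sum G V Q"
  using assms
proof (induction "card {x \<in> carrier G. \<psi> v x \<noteq> \<zero>\<^bsub>K\<^esub>}" arbitrary: v rule: less_induct)
  case (less v)
  have vV: "v \<in> carrier V" and fixed: "\<And>q. q \<in> Q \<Longrightarrow> act V q v = v"
    using less.prems(1) by (auto simp: fixed_points_def)
  interpret T: subgroup "trace_sum G V Q" "add_monoid V" by (rule trace_sum_subgroup)
  show ?case
  proof (cases "\<exists>x\<in>carrier G. \<psi> v x \<noteq> \<zero>\<^bsub>K\<^esub>")
    case False
    then have "\<psi> v = \<psi> \<zero>\<^bsub>V\<^esub>" using vV \<psi>_zero by (intro fns_eqI) auto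
    then have "v = \<zero>\<^bsub>V\<^esub>" using \<psi>_inj vV by blast
    then show ?thesis using T.one_closed by simp
  next
    case True
    then obtain x where x: "x \<in> carrier G" "\<psi> v x \<noteq> \<zero>\<^bsub>K\<^esub>" by blast
    define a where "a = \<psi> v x"
    have aK: "a \<in> carrier K" using x vV by (simp add: a_def)
    define R where "R = {q \<in> Q. inv x \<otimes> q \<otimes> x \<in> L}"
    have RQ: "R \<subseteq> Q" by (auto simp: R_def)
    have qG: "q \<in> carrier G" if "q \<in> Q" for q using that QG by blast
    have lG: "l \<in> carrier G" if "l \<in> L" for l using that LG by blast
    have R: "subgroup R G"
    proof
      show "R \<subseteq> carrier G" using RQ QG by blast
      show "\<one> \<in> R" using x subgroup.one_closed[OF Q] subgroup.one_closed[OF L] by (simp add: R_def)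
      fix q assume q: "q \<in> R"
      then have "inv (inv x \<otimes> q \<otimes> x) \<in> L" using subgroup.m_inv_closed[OF L] by (simp add: R_def)
      then show "inv q \<in> R"
        using q x qG subgroup.m_inv_closed[OF Q] by (simp add: R_def inv_mult_group m_assoc)
      fix q' assume q': "q' \<in> R"
      have "(inv x \<otimes> q \<otimes> x) \<otimes> (inv x \<otimes> q' \<otimes> x) \<in> L"
        using q q' subgroup.m_closed[OF L] by (simp add: R_def)
      moreover have "(inv x \<otimes> q \<otimes> x) \<otimes> (inv x \<otimes> q' \<otimes> x) = inv x \<otimes> (q \<otimes> q') \<otimes> x"
      proof -
        have "q \<in> carrier G" "q' \<in> carrier G" using q q' qG by (auto simp: R_def)
        then show ?thesis using x by (simp add: m_assoc cancel_inv)
      qed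
      ultimately show "q \<otimes> q' \<in> R" using q q' subgroup.m_closed[OF Q] by (simp add: R_def)
    qed
    have "x \<notin> conjugated_into Q L" using less.prems(2) x by blast
    then have R_proper: "R \<subset> Q" using RQ x by (auto simp: R_def conjugated_into_def)
    \<comment> \<open>\<open>a\<close> times the indicator of \<open>xL\<close>\<close>
    define \<delta> where "\<delta> = (\<lambda>y\<in>carrier G. if inv x \<otimes> y \<in> L then a else \<zero>\<^bsub>K\<^esub>)"
    have L_mult: "y \<otimes> l \<in> L \<longleftrightarrow> y \<in> L" "l \<otimes> y \<in> L \<longleftrightarrow> y \<in> L" if "y \<in> carrier G" "l \<in> L" for y l
    proof -
      have "y = y \<otimes> l \<otimes> inv l" "y = inv l \<otimes> (l \<otimes> y)" using that lG by (simp_all add: m_assoc cancel_inv)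
      then show "y \<otimes> l \<in> L \<longleftrightarrow> y \<in> L" "l \<otimes> y \<in> L \<longleftrightarrow> y \<in> L"
        using that subgroup.m_closed[OF L] subgroup.m_inv_closed[OF L] by metis+
    qed
    have "\<delta> \<in> carrier (perm_module L)"
      using aK x lG L_mult by (auto simp: mem_perm_module \<delta>_def simp flip: m_assoc)
    then have "\<delta> \<in> \<psi> ` carrier V" using bij_betw_imp_surj_on[OF \<psi>_bij] by simp
    then obtain w where w: "w \<in> carrier V" "\<psi> w = \<delta>" by blast
    have "w \<in> fixed_points V R"
      unfolding fixed_points_def
    proof (intro CollectI conjI ballI w(1))
      fix q assume q: "q \<in> R"
      then have qQ: "q \<in> carrier G" using RQ QG by blast
      have inL: "inv x \<otimes> inv q \<otimes> x \<in> L"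
        using subgroup.m_inv_closed[OF R q] by (simp add: R_def)
      have "\<psi> (act V q w) = \<psi> w"
      proof (rule fns_eqI)
        fix y assume y: "y \<in> carrier G"
        have "inv x \<otimes> (inv q \<otimes> y) = (inv x \<otimes> inv q \<otimes> x) \<otimes> (inv x \<otimes> y)"
          using x y qQ by (simp add: m_assoc cancel_inv)
        then have "inv x \<otimes> (inv q \<otimes> y) \<in> L \<longleftrightarrow> inv x \<otimes> y \<in> L"
          using L_mult(2)[of "inv x \<otimes> y", OF _ inL] x y by simp
        then show "\<psi> (act V q w) y = \<psi> w y"
          using \<psi>_act[OF qQ w(1)] w(2) y qQ by (simp add: \<delta>_def)
      qed (use \<psi>_fns act_closed w(1) qQ in blast)+
      then show "act V q w = w" using \<psi>_inj w(1) qQ by simp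
    qed
    define t where "t = relative_trace G V R Q w"
    have tT: "t \<in> trace_sum G V Q"
      unfolding trace_sum_def t_def
      by (rule generate.incl) (use R R_proper \<open>w \<in> fixed_points V R\<close> in blast)
    have tV: "t \<in> carrier V" using relative_trace_closed[OF R RQ w(1)] by (simp add: t_def)
    \<comment> \<open>The orbit \<open>QxL\<close>, the support of the trace of \<open>\<delta>\<close>.\<close>
    define Z where "Z = {y \<in> carrier G. \<exists>q\<in>Q. inv x \<otimes> (inv q \<otimes> y) \<in> L}"
    have \<psi>t: "\<psi> t y = (if y \<in> Z then a else \<zero>\<^bsub>K\<^esub>)" if y: "y \<in> carrier G" for y
    proof -
      let ?R = "(\<lambda>x. x <#\<^bsub>G\<^esub> R) ` Q"
      have sum: "\<psi> t y = (\<Oplus>\<^bsub>K\<^esub>C\<in>?R. \<delta> (inv (SOME c. c \<in> C) \<otimes> y))"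
        unfolding t_def \<psi>_relative_trace[OF R RQ w(1) y] w(2) ..
      show ?thesis
      proof (cases "y \<in> Z")
        case False
        have "\<delta> (inv (SOME c. c \<in> C) \<otimes> y) = \<zero>\<^bsub>K\<^esub>" if "C \<in> ?R" for C
          using False y Q_coset_rep(1)[OF R RQ that] qG by (auto simp: Z_def \<delta>_def)
        then show ?thesis using False sum by (simp add: K.add.finprod_one_eqI)
      next
        case True
        then obtain q where q: "q \<in> Q" "inv x \<otimes> (inv q \<otimes> y) \<in> L" by (auto simp: Z_def)
        have "\<delta> (inv (SOME c. c \<in> C) \<otimes> y) = (if q <#\<^bsub>G\<^esub> R = C then a else \<zero>\<^bsub>K\<^esub>)" if C: "C \<in> ?R" for C
        proof -
          define r where "r = (SOME c. c \<in> C)"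
          have r: "r \<in> Q" "C = r <#\<^bsub>G\<^esub> R" using Q_coset_rep[OF R RQ C] by (auto simp: r_def)
          have rG: "r \<in> carrier G" and qG': "q \<in> carrier G" using r q qG by auto
          have "inv x \<otimes> (inv r \<otimes> y) = (inv x \<otimes> (inv r \<otimes> q) \<otimes> x) \<otimes> (inv x \<otimes> (inv q \<otimes> y))"
            using x y rG qG' by (simp add: m_assoc cancel_inv)
          then have "inv x \<otimes> (inv r \<otimes> y) \<in> L \<longleftrightarrow> inv x \<otimes> (inv r \<otimes> q) \<otimes> x \<in> L"
            using L_mult(1)[OF _ q(2)] x rG qG' by simp
          also have "\<dots> \<longleftrightarrow> inv r \<otimes> q \<in> R"
            using r q subgroup.m_closed[OF Q] subgroup.m_inv_closed[OF Q] by (simp add: R_def)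
          also have "\<dots> \<longleftrightarrow> q \<in> r <#\<^bsub>G\<^esub> R"
            using subgroup.lcos_module_rev[OF R group_axioms rG qG'] subgroup.lcos_module_imp[OF R group_axioms rG] by blast
          also have "\<dots> \<longleftrightarrow> q <#\<^bsub>G\<^esub> R = C"
            using r(2) l_repr_independence[OF _ rG R] lcos_self[OF qG' R] by blast
          finally show ?thesis using y rG by (simp add: \<delta>_def r_def[symmetric])
        qed
        then have "\<psi> t y = (\<Oplus>\<^bsub>K\<^esub>C\<in>?R. if q <#\<^bsub>G\<^esub> R = C then a else \<zero>\<^bsub>K\<^esub>)"
          unfolding sum by (intro K.finsum_cong') (use aK in auto)
        also have "\<dots> = a"
          using K.finsum_singleton[of "q <#\<^bsub>G\<^esub> R" ?R "\<lambda>_. a"] finite_cosets[OF Q R RQ] q(1) aK by simp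
        finally show ?thesis using True by simp
      qed
    qed
    have \<psi>vZ: "\<psi> v y = a" if yZ: "y \<in> Z" for y
    proof -
      obtain q where y: "y \<in> carrier G" and q: "q \<in> Q" "inv x \<otimes> (inv q \<otimes> y) \<in> L"
        using yZ by (auto simp: Z_def)
      have "\<psi> v y = \<psi> (act V (inv q) v) (inv q \<otimes> y)"
        using \<psi>_act[OF _ vV, of "inv q"] q(1) qG y by (simp add: m_assoc[symmetric])
      also have "\<dots> = \<psi> v (inv q \<otimes> y)" using fixed subgroup.m_inv_closed[OF Q q(1)] by simp
      also have "inv q \<otimes> y = x \<otimes> (inv x \<otimes> (inv q \<otimes> y))"
        using x(1) y q(1) qG by (simp add: m_assoc[symmetric])
      also have "\<psi> v \<dots> = a" using \<psi>_L[OF vV x(1) q(2)] by (simp add: a_def)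
      finally show ?thesis .
    qed
    have t_fixed: "t \<in> fixed_points V Q"
      unfolding fixed_points_def
    proof (intro CollectI conjI ballI tV)
      fix q assume q: "q \<in> Q"
      have Z_stable: "inv q \<otimes> y \<in> Z \<longleftrightarrow> y \<in> Z" if y: "y \<in> carrier G" for y
      proof
        assume "inv q \<otimes> y \<in> Z"
        then obtain q' where q': "q' \<in> Q" "inv x \<otimes> (inv q' \<otimes> (inv q \<otimes> y)) \<in> L" by (auto simp: Z_def)
        then have "inv x \<otimes> (inv (q \<otimes> q') \<otimes> y) \<in> L" using q qG y x by (simp add: inv_mult_group m_assoc)
        then show "y \<in> Z" using y subgroup.m_closed[OF Q q q'(1)] by (auto simp: Z_def)
      next
        assume "y \<in> Z"
        then obtain q' where q': "q' \<in> Q" "inv x \<otimes> (inv q' \<otimes> y) \<in> L" by (auto simp: Z_def)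
        then have "inv x \<otimes> (inv (inv q \<otimes> q') \<otimes> (inv q \<otimes> y)) \<in> L"
          using q qG y x by (simp add: inv_mult_group m_assoc cancel_inv)
        then show "inv q \<otimes> y \<in> Z"
          using y q qG subgroup.m_closed[OF Q subgroup.m_inv_closed[OF Q q] q'(1)] by (auto simp: Z_def)
      qed
      have "\<psi> (act V q t) = \<psi> t"
      proof (rule fns_eqI)
        fix y assume y: "y \<in> carrier G"
        then show "\<psi> (act V q t) y = \<psi> t y"
          using \<psi>_act[OF qG[OF q] tV] \<psi>t[of y] \<psi>t[of "inv q \<otimes> y"] Z_stable q qG by simp
      qed (use tV q qG in simp_all)
      then show "act V q t = t" using \<psi>_inj tV q qG by simp
    qed
    \<comment> \<open>In characteristic 2 adding \<open>t\<close> cancels the values on \<open>Z\<close>.\<close>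
    define v' where "v' = v \<oplus>\<^bsub>V\<^esub> t"
    have v'V: "v' \<in> carrier V" using vV tV by (simp add: v'_def)
    have \<psi>v': "\<psi> v' y = (if y \<in> Z then \<zero>\<^bsub>K\<^esub> else \<psi> v y)" if y: "y \<in> carrier G" for y
      using \<psi>_add[OF vV tV] \<psi>t[OF y] \<psi>vZ[of y] aK y vV by (simp add: v'_def)
    have "v' \<in> trace_sum G V Q"
    proof (rule less.hyps)
      have xZ: "x \<in> Z"
        using x subgroup.one_closed[OF Q] subgroup.one_closed[OF L] by (auto simp: Z_def intro!: bexI[of _ \<one>])
      have "{y \<in> carrier G. \<psi> v' y \<noteq> \<zero>\<^bsub>K\<^esub>} \<subseteq> {y \<in> carrier G. \<psi> v y \<noteq> \<zero>\<^bsub>K\<^esub>} - {x}"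
        using \<psi>v' xZ by (auto split: if_splits)
      also have "\<dots> \<subset> {y \<in> carrier G. \<psi> v y \<noteq> \<zero>\<^bsub>K\<^esub>}" using x by blast
      finally show "card {y \<in> carrier G. \<psi> v' y \<noteq> \<zero>\<^bsub>K\<^esub>} < card {y \<in> carrier G. \<psi> v y \<noteq> \<zero>\<^bsub>K\<^esub>}"
        using finite_carrier by (intro psubset_card_mono) simp_all
      show "v' \<in> fixed_points V Q"
        using v'V fixed t_fixed act_add vV tV qG by (auto simp: fixed_points_def v'_def)
      fix y assume y: "y \<in> conjugated_into Q L"
      then show "\<psi> v' y = \<zero>\<^bsub>K\<^esub>" using \<psi>v'[of y] less.prems(2) by (simp add: conjugated_into_def)
    qed
    then have "v' \<oplus>\<^bsub>V\<^esub> t \<in> trace_sum G V Q" using T.m_closed tT by simp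
    moreover have "v' \<oplus>\<^bsub>V\<^esub> t = v" using vV tV by (simp add: v'_def V.a_assoc add_self_V)
    ultimately show ?thesis by simp
  qed
qed

lemma brauer_quotient_simps:
  "carrier (brauer_quotient G V Q) = (\<lambda>v. {t \<oplus>\<^bsub>V\<^esub> v |t. t \<in> trace_sum G V Q}) ` fixed_points V Q"
  "ring.zero (brauer_quotient G V Q) = trace_sum G V Q"
  "add (brauer_quotient G V Q) C D = {c \<oplus>\<^bsub>V\<^esub> d |c d. c \<in> C \<and> d \<in> D}"
  "smult (brauer_quotient G V Q) a C =
     (\<Union>v\<in>C. {t \<oplus>\<^bsub>V\<^esub> (a \<odot>\<^bsub>V\<^esub> v) |t. t \<in> trace_sum G V Q})"
  "act (brauer_quotient G V Q) g C =
     (\<Union>v\<in>C. {t \<oplus>\<^bsub>V\<^esub> act V g v |t. t \<in> trace_sum G V Q})"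
  by (auto simp: brauer_quotient_def quotient_gmodule_def A_RCOSETS_def RCOSETS_def a_r_coset_def
      r_coset_def set_add_def set_mult_def)

text \<open>By the two lemmas on traces \<open>V(Q)\<close> consists of the functions on the fixed points of \<open>Q\<close> in \<open>G/L\<close>, and the hypothesis
provides a 2-subgroup of \<open>C\<^sub>G(Q)\<close> that is transitive on them. So every nonzero submodule contains the
constant function 1, and two nonzero submodules cannot have zero intersection. If there are no
fixed points, \<open>V(Q)\<close> is zero.\<close>

theorem brauer_quotient_indecomposable_or_zero:
  assumes trans: "\<And>x0. x0 \<in> conjugated_into Q L \<Longrightarrow>
    \<exists>S a. subgroup S G \<and> card S = 2 ^ a \<and> S \<subseteq> centralizer G Q \<and>
      (\<forall>y\<in>conjugated_into Q L. \<exists>s\<in>S. \<exists>l\<in>L. y = s \<otimes> x0 \<otimes> l)"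
  shows "kG_indecomposable K (G\<lparr>carrier := Q <#>\<^bsub>G\<^esub> centralizer G Q\<rparr>) (brauer_quotient G V Q) \<or>
    kG_zero (brauer_quotient G V Q)"
proof (rule disjCI)
  let ?N = "fixed_points V Q" and ?T = "trace_sum G V Q" and ?B = "brauer_quotient G V Q"
  let ?Y = "conjugated_into Q L"
  define cos where "cos = (\<lambda>v. {t \<oplus>\<^bsub>V\<^esub> v |t. t \<in> ?T})"
  have "{t \<oplus>\<^bsub>V\<^esub> v |t. t \<in> ?T} = cos v" for v by (simp add: cos_def)
  note B = brauer_quotient_simps[unfolded this]
  interpret T: subgroup ?T "add_monoid V" by (rule trace_sum_subgroup)
  have T: "t \<in> carrier V" "\<zero>\<^bsub>V\<^esub> \<in> ?T" "t \<oplus>\<^bsub>V\<^esub> t' \<in> ?T" if "t \<in> ?T" "t' \<in> ?T" for t t'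
    using that T.subset T.one_closed T.m_closed by auto
  have T0: "\<zero>\<^bsub>V\<^esub> \<in> ?T" using T.one_closed by simp
  have TV: "t \<in> carrier V" if "t \<in> ?T" for t using T(1)[OF that that] .
  have NV: "v \<in> carrier V" if "v \<in> ?N" for v using that by (simp add: fixed_points_def)
  have cos_self: "v \<in> cos v" if "v \<in> carrier V" for v
    unfolding cos_def using T0 that by (auto intro!: exI[of _ "\<zero>\<^bsub>V\<^esub>"])
  have add_cancel: "(v \<oplus>\<^bsub>V\<^esub> w) \<oplus>\<^bsub>V\<^esub> w = v" if "v \<in> carrier V" "w \<in> carrier V" for v w
    using that by (simp add: V.a_assoc add_self_V)
  have cos_sub: "cos v \<subseteq> cos w" if "v \<oplus>\<^bsub>V\<^esub> w \<in> ?T" "v \<in> carrier V" "w \<in> carrier V" for v w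
  proof
    fix u assume "u \<in> cos v"
    then obtain t where t: "t \<in> ?T" "u = t \<oplus>\<^bsub>V\<^esub> v" by (auto simp: cos_def)
    have "u = (t \<oplus>\<^bsub>V\<^esub> (v \<oplus>\<^bsub>V\<^esub> w)) \<oplus>\<^bsub>V\<^esub> w"
      using t TV[OF t(1)] that add_cancel[OF that(2,3)] by (simp add: V.a_assoc)
    then show "u \<in> cos w" using T(3)[OF t(1) that(1)] by (auto simp: cos_def)
  qed
  have cos_eq: "cos v = cos w" if "v \<oplus>\<^bsub>V\<^esub> w \<in> ?T" "v \<in> carrier V" "w \<in> carrier V" for v w
    using cos_sub[OF that] cos_sub[of w v] that by (simp add: V.a_comm)
  have cos_zero: "cos \<zero>\<^bsub>V\<^esub> = ?T" 
    unfolding cos_def using TV V.r_zero by (auto intro!: exI)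
  have cosT: "cos v = ?T \<longleftrightarrow> v \<in> ?T" if "v \<in> carrier V" for v
    using cos_self[OF that] cos_eq[of v "\<zero>\<^bsub>V\<^esub>"] that cos_zero by auto
  have cos_mem: "cos v = cos w" if "v \<in> cos w" "w \<in> carrier V" for v w
  proof -
    obtain t where t: "t \<in> ?T" "v = t \<oplus>\<^bsub>V\<^esub> w" using \<open>v \<in> cos w\<close> by (auto simp: cos_def)
    then show ?thesis using cos_eq[of v w] TV[OF t(1)] that(2) add_cancel by simp
  qed
  have N0: "\<zero>\<^bsub>V\<^esub> \<in> ?N"
  proof -
    have "act V g \<zero>\<^bsub>V\<^esub> = \<zero>\<^bsub>V\<^esub>" if "g \<in> Q" for g
      using act_add[of g "\<zero>\<^bsub>V\<^esub>" "\<zero>\<^bsub>V\<^esub>"] add_self_V act_closed[of g "\<zero>\<^bsub>V\<^esub>"] that QG by auto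
    then show ?thesis by (simp add: fixed_points_def)
  qed
  have Nadd: "v \<oplus>\<^bsub>V\<^esub> w \<in> ?N" if "v \<in> ?N" "w \<in> ?N" for v w
    using that QG by (auto simp: fixed_points_def act_add)
  have Nsmult: "a \<odot>\<^bsub>V\<^esub> v \<in> ?N" if "a \<in> carrier K" "v \<in> ?N" for a v
    using that QG by (auto simp: fixed_points_def act_smult)
  have Nact: "act V s v \<in> ?N" if s: "s \<in> centralizer G Q" and v: "v \<in> ?N" for s v
  proof -
    have sG: "s \<in> carrier G" using s by (simp add: centralizer_def)
    have "act V q (act V s v) = act V s v" if q: "q \<in> Q" for q
    proof -
      have qG: "q \<in> carrier G" using q QG by blast
      have "act V q (act V s v) = act V (s \<otimes> q) v"
        using act_mult[OF qG sG NV[OF v]] s q by (simp add: centralizer_def)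
      also have "\<dots> = act V s v" using act_mult[OF sG qG NV[OF v]] v q by (simp add: fixed_points_def)
      finally show ?thesis .
    qed
    then show ?thesis using sG NV[OF v] by (simp add: fixed_points_def)
  qed

  assume not_zero: "\<not> kG_zero ?B"
  show "kG_indecomposable K (G\<lparr>carrier := Q <#>\<^bsub>G\<^esub> centralizer G Q\<rparr>) ?B"
    unfolding kG_indecomposable_def
  proof (intro conjI not_zero allI impI)
    fix A1 A2 assume ds: "kG_direct_sum K (G\<lparr>carrier := Q <#>\<^bsub>G\<^esub> centralizer G Q\<rparr>) ?B A1 A2"
    have "\<exists>v\<in>?N. v \<notin> ?T"
    proof (rule ccontr)
      assume "\<not> ?thesis"
      then have "cos v = ?T" if "v \<in> ?N" for v using cosT NV that by blast
      then have "carrier ?B = {?T}" unfolding B(1) using N0 by auto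
      then show False using not_zero by (simp add: kG_zero_def B(2))
    qed
    then obtain x0 where x0: "x0 \<in> ?Y" using vanishing_imp_trace_sum by blast
    have x0G: "x0 \<in> carrier G" using x0 by (simp add: conjugated_into_def)
    obtain S a where S: "subgroup S G" "card S = 2 ^ a" "S \<subseteq> centralizer G Q"
      and Y: "\<And>y. y \<in> ?Y \<Longrightarrow> \<exists>s\<in>S. \<exists>l\<in>L. y = s \<otimes> x0 \<otimes> l"
      using trans[OF x0] by blast
    have SG: "S \<subseteq> carrier G" using S(1) by (rule subgroup.subset)
    have normalised: "\<exists>v\<in>?N. cos v \<in> A \<and> (\<forall>y\<in>?Y. \<psi> v y = \<one>\<^bsub>K\<^esub>)"
      if A: "kG_submodule K (G\<lparr>carrier := Q <#>\<^bsub>G\<^esub> centralizer G Q\<rparr>) ?B A" and nz: "A \<noteq> {?T}" for A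
    proof -
      have sub: "submodule A K ?B" and
        actA: "\<And>g C. g \<in> Q <#>\<^bsub>G\<^esub> centralizer G Q \<Longrightarrow> C \<in> A \<Longrightarrow> act ?B g C \<in> A"
        using A by (auto simp: kG_submodule_def)
      interpret A: submodule A K ?B by (rule sub)
      have Acar: "\<exists>w\<in>?N. C = cos w" if "C \<in> A" for C
        using A.subset that B(1) by auto
      have A_mem: "cos u \<in> A" if "C \<in> A" "u \<in> C" for C u
        using Acar[OF that(1)] cos_mem NV that by metis
      \<comment> \<open>The preimage of \<open>A\<close> among the fixed points of \<open>Q\<close> in \<open>V\<close>.\<close>
      define D where "D = {v \<in> ?N. cos v \<in> A}"
      have DN: "v \<in> ?N" "v \<in> carrier V" if "v \<in> D" for v using that NV by (auto simp: D_def)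
      have D0: "\<zero>\<^bsub>V\<^esub> \<in> D" using A.one_closed N0 by (simp add: D_def cos_zero B(2))
      have Dadd: "v \<oplus>\<^bsub>V\<^esub> w \<in> D" if "v \<in> D" "w \<in> D" for v w
      proof -
        have "add ?B (cos v) (cos w) \<in> A" using A.m_closed that by (simp add: D_def)
        moreover have "v \<oplus>\<^bsub>V\<^esub> w \<in> add ?B (cos v) (cos w)"
          unfolding B(3) using cos_self DN that by blast
        ultimately have "cos (v \<oplus>\<^bsub>V\<^esub> w) \<in> A" by (rule A_mem)
        then show ?thesis using Nadd[OF DN(1) DN(1)] that by (simp add: D_def)
      qed
      have Dsmult: "c \<odot>\<^bsub>V\<^esub> v \<in> D" if "c \<in> carrier K" "v \<in> D" for c v
      proof -
        have "smult ?B c (cos v) \<in> A" using A.smult_closed that by (simp add: D_def)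
        moreover have "c \<odot>\<^bsub>V\<^esub> v \<in> smult ?B c (cos v)"
          unfolding B(4) by (rule UN_I[OF cos_self cos_self]) (use DN(2) that in simp_all)
        ultimately have "cos (c \<odot>\<^bsub>V\<^esub> v) \<in> A" by (rule A_mem)
        then show ?thesis using Nsmult[OF _ DN(1)] that by (simp add: D_def)
      qed
      have Dact: "act V s v \<in> D" if "s \<in> S" "v \<in> D" for s v
      proof -
        have s: "s \<in> centralizer G Q" using that S(3) by blast
        have "s = \<one> \<otimes> s" using that SG by auto
        then have "s \<in> Q <#>\<^bsub>G\<^esub> centralizer G Q"
          using s subgroup.one_closed[OF Q] unfolding set_mult_def by blast
        then have "act ?B s (cos v) \<in> A" using actA that by (simp add: D_def)
        moreover have "act V s v \<in> act ?B s (cos v)"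
          unfolding B(5) by (rule UN_I[OF cos_self cos_self]) (use DN(2) that SG in auto)
        ultimately have "cos (act V s v) \<in> A" by (rule A_mem)
        then show ?thesis using Nact[OF s DN(1)] that by (simp add: D_def)
      qed
      have "?T \<in> A" using A.one_closed by (simp add: B(2))
      then obtain C where C: "C \<in> A" "C \<noteq> ?T" using nz by blast
      then obtain v where v: "v \<in> ?N" "C = cos v" using Acar by blast
      then have vD: "v \<in> D" using C by (simp add: D_def)
      have "v \<notin> ?T" using C v cosT NV by blast
      then obtain y where y: "y \<in> ?Y" "\<psi> v y \<noteq> \<zero>\<^bsub>K\<^esub>" using vanishing_imp_trace_sum v(1) by blast
      then obtain s0 l where s0: "s0 \<in> S" "l \<in> L" "y = s0 \<otimes> x0 \<otimes> l" using Y by blast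
      have "\<psi> v (s0 \<otimes> x0) \<noteq> \<zero>\<^bsub>K\<^esub>"
        using y(2) s0 \<psi>_L[OF DN(2)[OF vD], of "s0 \<otimes> x0" l] SG x0G by auto
      moreover have "subspace (\<psi> ` D)"
        unfolding subspace_def
      proof (intro conjI ballI)
        show "\<psi> ` D \<subseteq> fns" using \<psi>_fns DN by blast
        show "fzero \<in> \<psi> ` D" using D0 \<psi>_zero by (metis image_eqI)
      next
        fix f g assume "f \<in> \<psi> ` D" "g \<in> \<psi> ` D"
        then obtain v w where vw: "v \<in> D" "w \<in> D" "f = \<psi> v" "g = \<psi> w" by blast
        then have "fadd f g = \<psi> (v \<oplus>\<^bsub>V\<^esub> w)" using \<psi>_add DN by simp
        then show "fadd f g \<in> \<psi> ` D" using Dadd vw by blast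
      next
        fix c f assume c: "c \<in> carrier K" "f \<in> \<psi> ` D"
        then obtain v where vw: "v \<in> D" "f = \<psi> v" by blast
        then have "fsmult c f = \<psi> (c \<odot>\<^bsub>V\<^esub> v)" using \<psi>_smult DN c by simp
        then show "fsmult c f \<in> \<psi> ` D" using Dsmult vw c by blast
      qed
      moreover have "ftrans s f \<in> \<psi> ` D" if s: "s \<in> S" "f \<in> \<psi> ` D" for s f
      proof -
        obtain v where vw: "v \<in> D" "f = \<psi> v" using s by blast
        then have "ftrans s f = \<psi> (act V s v)" using \<psi>_act DN s SG by auto
        then show ?thesis using Dact vw s by blast
      qed
      ultimately obtain g where g: "g \<in> \<psi> ` D" "\<forall>s\<in>S. g (s \<otimes> x0) = \<one>\<^bsub>K\<^esub>"
        using two_group_invariant_function[OF S(1,2) x0G _ _ imageI[OF vD] s0(1)] by blast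
      then obtain u where u: "u \<in> D" "g = \<psi> u" by blast
      have "\<psi> u y = \<one>\<^bsub>K\<^esub>" if "y \<in> ?Y" for y
      proof -
        obtain s l where sl: "s \<in> S" "l \<in> L" "y = s \<otimes> x0 \<otimes> l" using Y[OF \<open>y \<in> ?Y\<close>] by blast
        then have "s \<in> carrier G" using SG by blast
        then have "\<psi> u y = \<psi> u (s \<otimes> x0)" using sl \<psi>_L[OF DN(2)[OF u(1)]] x0G by simp
        then show ?thesis using g(2) sl(1) u(2) by simp
      qed
      then show ?thesis using u by (auto simp: D_def)
    qed
    show "A1 = {ring.zero ?B} \<or> A2 = {ring.zero ?B}"
    proof (rule ccontr)
      assume "\<not> ?thesis"
      then have nz: "A1 \<noteq> {?T}" "A2 \<noteq> {?T}" unfolding B(2) by blast+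
      have sub: "kG_submodule K (G\<lparr>carrier := Q <#>\<^bsub>G\<^esub> centralizer G Q\<rparr>) ?B A1"
        "kG_submodule K (G\<lparr>carrier := Q <#>\<^bsub>G\<^esub> centralizer G Q\<rparr>) ?B A2"
        and int: "A1 \<inter> A2 = {?T}"
        using ds unfolding kG_direct_sum_def B(2) by blast+
      obtain u where u: "u \<in> ?N" "cos u \<in> A1" "\<And>y. y \<in> ?Y \<Longrightarrow> \<psi> u y = \<one>\<^bsub>K\<^esub>"
        using normalised[OF sub(1) nz(1)] by blast
      obtain w where w: "w \<in> ?N" "cos w \<in> A2" "\<And>y. y \<in> ?Y \<Longrightarrow> \<psi> w y = \<one>\<^bsub>K\<^esub>"
        using normalised[OF sub(2) nz(2)] by blast
      have "u \<oplus>\<^bsub>V\<^esub> w \<in> ?T"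
      proof (rule vanishing_imp_trace_sum[OF Nadd[OF u(1) w(1)]])
        fix y assume y: "y \<in> ?Y"
        then have "y \<in> carrier G" by (simp add: conjugated_into_def)
        then show "\<psi> (u \<oplus>\<^bsub>V\<^esub> w) y = \<zero>\<^bsub>K\<^esub>"
          using \<psi>_add[OF NV[OF u(1)] NV[OF w(1)]] u(3)[OF y] w(3)[OF y] char_2 by simp
      qed
      then have "cos u = cos w" using cos_eq NV u(1) w(1) by blast
      then have "cos u \<in> A1 \<inter> A2" using u(2) w(2) by simp
      then have "cos u = ?T" unfolding int by simp
      then have "u \<in> ?T" using cosT NV[OF u(1)] by blast
      then have "\<psi> u x0 = \<zero>\<^bsub>K\<^esub>" using trace_sum_vanishes x0 by blast
      then show False using u(3)[OF x0] by simp
    qed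
  qed
qed

end

section \<open>Park's group for a subgroup of index 3\<close>

locale park_index_3 = group M for M (structure) +
  fixes P :: "'a set" and F :: "'a fusion_system" and n :: nat and G :: "('a \<Rightarrow> 'a) monoid"
  assumes finite_M: "finite (carrier M)" and order_M: "order M = 3 * 2 ^ n"
    and P: "subgroup P M" and card_P: "card P = 2 ^ n"
    and fs_F: "fs_group F = P" and G_def: "G = park_group F M"
begin

abbreviation emb where "emb \<equiv> park_embedding M"

lemma PM: "P \<subseteq> carrier M" using P by (rule subgroup.subset)

lemma mem_G: "f \<in> carrier G \<longleftrightarrow>
    f \<in> Bij (carrier M) \<and> (\<forall>m\<in>carrier M. \<forall>u\<in>P. f (m \<otimes> u) = f m \<otimes> u)"
  by (simp add: G_def park_group_def fs_F)

lemma G_closed: "f \<in> carrier G \<Longrightarrow> m \<in> carrier M \<Longrightarrow> f m \<in> carrier M"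
  using Bij_imp_funcset mem_G by blast

lemma G_right: "f \<in> carrier G \<Longrightarrow> m \<in> carrier M \<Longrightarrow> u \<in> P \<Longrightarrow> f (m \<otimes> u) = f m \<otimes> u"
  by (simp add: mem_G)

lemma G_inj: "f \<in> carrier G \<Longrightarrow> m \<in> carrier M \<Longrightarrow> m' \<in> carrier M \<Longrightarrow> f m = f m' \<Longrightarrow> m = m'"
  by (auto simp: mem_G Bij_def bij_betw_def dest: inj_onD)

lemma G_eqI: "f \<in> carrier G \<Longrightarrow> g \<in> carrier G \<Longrightarrow> (\<And>m. m \<in> carrier M \<Longrightarrow> f m = g m) \<Longrightarrow> f = g"
  using Bij_imp_extensional extensionalityI mem_G by metis

lemma group_G: "group G"
proof -
  interpret B: group "BijGroup (carrier M)" by (rule group_BijGroup)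
  have "subgroup (carrier G) (BijGroup (carrier M))"
  proof
    show "carrier G \<subseteq> carrier (BijGroup (carrier M))" by (auto simp: mem_G BijGroup_def)
    show "\<one>\<^bsub>BijGroup (carrier M)\<^esub> \<in> carrier G"
      using PM by (auto simp: mem_G BijGroup_def id_Bij)
    fix f assume f: "f \<in> carrier G"
    show "inv\<^bsub>BijGroup (carrier M)\<^esub> f \<in> carrier G"
    proof -
      have fB: "f \<in> Bij (carrier M)" using f mem_G by blast
      let ?g = "restrict (inv_into (carrier M) f) (carrier M)"
      have g: "?g \<in> Bij (carrier M)" by (rule restrict_inv_into_Bij) fact
      have surj: "f ` carrier M = carrier M" using fB by (simp add: Bij_def bij_betw_def)
      have gc: "?g m \<in> carrier M" "f (?g m) = m" if "m \<in> carrier M" for m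
        using that surj Bij_inv_into_mem[OF fB] by (simp_all add: f_inv_into_f)
      have "?g (m \<otimes> u) = ?g m \<otimes> u" if m: "m \<in> carrier M" and u: "u \<in> P" for m u
      proof (rule G_inj[OF f])
        have uM: "u \<in> carrier M" using u PM by blast
        show "?g (m \<otimes> u) \<in> carrier M" "?g m \<otimes> u \<in> carrier M" using gc m uM by auto
        show "f (?g (m \<otimes> u)) = f (?g m \<otimes> u)"
          using gc(2)[of "m \<otimes> u"] gc[OF m] G_right[OF f gc(1)[OF m] u] m uM by simp
      qed
      then show ?thesis unfolding inv_BijGroup[OF fB] using g by (simp add: mem_G)
    qed
    fix g assume g: "g \<in> carrier G"
    have fg: "f \<in> Bij (carrier M)" "g \<in> Bij (carrier M)" using f g mem_G by blast+
    have "compose (carrier M) f g (m \<otimes> u) = compose (carrier M) f g m \<otimes> u"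
      if "m \<in> carrier M" "u \<in> P" for m u
    proof -
      have "u \<in> carrier M" using that PM by blast
      then show ?thesis using that G_right G_closed f g by (simp add: compose_def)
    qed
    then show "f \<otimes>\<^bsub>BijGroup (carrier M)\<^esub> g \<in> carrier G"
      using fg by (simp add: mem_G BijGroup_def compose_Bij)
  qed
  moreover have "G = BijGroup (carrier M)\<lparr>carrier := carrier G\<rparr>"
    by (simp add: G_def park_group_def)
  ultimately show ?thesis using B.subgroup_imp_group by metis
qed

sublocale G: group G by (rule group_G)

lemma mult_apply: "f \<in> carrier G \<Longrightarrow> g \<in> carrier G \<Longrightarrow> m \<in> carrier M \<Longrightarrow> (f \<otimes>\<^bsub>G\<^esub> g) m = f (g m)"
  by (auto simp: G_def park_group_def BijGroup_def compose_def)

lemma one_apply: "m \<in> carrier M \<Longrightarrow> \<one>\<^bsub>G\<^esub> m = m"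
  by (simp add: G_def park_group_def BijGroup_def)

lemma inv_apply: "f \<in> carrier G \<Longrightarrow> m \<in> carrier M \<Longrightarrow> (inv\<^bsub>G\<^esub> f) (f m) = m"
  using mult_apply[of "inv\<^bsub>G\<^esub> f" f m] one_apply by simp

lemma finite_G: "finite (carrier G)"
proof (rule finite_subset)
  show "carrier G \<subseteq> carrier M \<rightarrow>\<^sub>E carrier M"
    using G_closed Bij_imp_extensional mem_G by (auto simp: PiE_def)
  show "finite (carrier M \<rightarrow>\<^sub>E carrier M)" using finite_M by (simp add: finite_PiE)
qed

lemma emb_apply: "u \<in> carrier M \<Longrightarrow> m \<in> carrier M \<Longrightarrow> emb u m = u \<otimes> m"
  by (simp add: park_embedding_def)

lemma emb_closed: "u \<in> carrier M \<Longrightarrow> emb u \<in> carrier G"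
proof -
  assume u: "u \<in> carrier M"
  have "bij_betw (emb u) (carrier M) (carrier M)"
    by (rule bij_betwI[where g = "\<lambda>m. inv u \<otimes> m"]) (use u in \<open>auto simp: emb_apply cancel_inv\<close>)
  then show ?thesis
    using u PM by (auto simp: mem_G Bij_def emb_apply m_assoc) (simp add: park_embedding_def)
qed

lemma emb_mult: "u \<in> carrier M \<Longrightarrow> v \<in> carrier M \<Longrightarrow> emb (u \<otimes> v) = emb u \<otimes>\<^bsub>G\<^esub> emb v"
  by (rule G_eqI) (simp_all add: emb_closed mult_apply emb_apply m_assoc)

sublocale emb: group_hom M G emb
  by unfold_locales (simp add: hom_def emb_closed emb_mult)

lemma emb_inj: "inj_on emb (carrier M)"
proof (rule inj_onI)
  fix u v assume uv: "u \<in> carrier M" "v \<in> carrier M" "emb u = emb v"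
  then have "emb u \<one> = emb v \<one>" by simp
  then show "u = v"
    unfolding emb_apply[OF uv(1) one_closed] emb_apply[OF uv(2) one_closed] using uv by simp
qed

lemma subgroup_emb_M: "subgroup (emb ` carrier M) G" and subgroup_emb_P: "subgroup (emb ` P) G"
  using emb.img_is_subgroup emb.subgroup_img_is_subgroup[OF P] by simp_all

lemma card_cosets: "card (lcosets P) = 3"
  using l_lagrange[OF finite_M P] order_M card_P by simp

lemma card_emb_cosets: "card ((\<lambda>l. l <#\<^bsub>G\<^esub> (emb ` P)) ` (emb ` carrier M)) = 3"
proof -
  have "emb u <#\<^bsub>G\<^esub> (emb ` P) = emb ` (u <#\<^bsub>M\<^esub> P)" if "u \<in> carrier M" for u
    unfolding l_coset_def image_UN image_insert image_empty UN_simps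
    using that PM emb_mult by (intro SUP_cong) auto
  then have "(\<lambda>l. l <#\<^bsub>G\<^esub> (emb ` P)) ` (emb ` carrier M) = (\<lambda>C. emb ` C) ` (lcosets P)"
    by (auto simp: LCOSETS_def image_image)
  moreover have "inj_on (\<lambda>C. emb ` C) (lcosets P)"
    using inj_on_image_Pow[OF emb_inj] lcosets_subset_PowG[OF P] by (rule inj_on_subset)
  ultimately show ?thesis using card_image card_cosets by metis
qed

text \<open>So \<open>G\<close> acts on the set of left cosets of \<open>P\<close> in \<open>M\<close>.\<close>

lemma image_coset: "f \<in> carrier G \<Longrightarrow> m \<in> carrier M \<Longrightarrow> f ` (m <#\<^bsub>M\<^esub> P) = f m <#\<^bsub>M\<^esub> P"
  unfolding l_coset_def image_UN image_insert image_empty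
  using G_right by (intro SUP_cong) auto

text \<open>The action is taken along a homomorphism \<open>h\<close>, because a subgroup of \<open>G\<close> will also act through its
conjugate by some \<open>x\<close>.\<close>

lemma moved_cosets:
  assumes S: "subgroup S A" "group A" "Factorial_Ring.prime p" "card S = p ^ k"
    and h: "h \<in> hom (A\<lparr>carrier := S\<rparr>) G"
  shows "p dvd card {C \<in> lcosets P. \<exists>g\<in>S. h g ` C \<noteq> C}"
proof (rule p_group_moved_points[OF S(2,1,3,4)])
  have hS: "h g \<in> carrier G" if "g \<in> S" for g
    using hom_in_carrier[OF h] that by simp
  have sub: "C \<subseteq> carrier M" if "C \<in> lcosets P" for C
    using lcosets_subset_PowG[OF P] that by blast
  interpret A: group A by fact
  interpret S: subgroup S A by fact
  have "group (A\<lparr>carrier := S\<rparr>)" by (rule S.subgroup_is_group) fact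
  then have "group_hom (A\<lparr>carrier := S\<rparr>) G h"
    using h by (intro group_hom.intro group_hom_axioms.intro group_G)
  then have h1: "h \<one>\<^bsub>A\<^esub> = \<one>\<^bsub>G\<^esub>" using group_hom.hom_one by fastforce
  have hm: "h (f \<otimes>\<^bsub>A\<^esub> g) = h f \<otimes>\<^bsub>G\<^esub> h g" if "f \<in> S" "g \<in> S" for f g
    using hom_mult[OF h] that by simp
  show "finite (lcosets P)" using card_cosets card.infinite by fastforce
  fix f C assume C: "C \<in> lcosets P"
  show "h \<one>\<^bsub>A\<^esub> ` C = C" unfolding h1 using sub[OF C] one_apply by (auto simp: image_iff subset_iff)
  assume f: "f \<in> S"
  obtain m where m: "m \<in> carrier M" "C = m <#\<^bsub>M\<^esub> P" using C by (auto simp: LCOSETS_def)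
  show "h f ` C \<in> lcosets P"
    unfolding m(2) image_coset[OF hS[OF f] m(1)] using G_closed[OF hS[OF f] m(1)]
    by (auto simp: LCOSETS_def)
  fix g assume g: "g \<in> S"
  show "h (f \<otimes>\<^bsub>A\<^esub> g) ` C = h f ` h g ` C"
    unfolding image_image using sub[OF C] mult_apply hS f g hm by (intro image_cong) auto
qed

lemma fixed_coset:
  assumes S: "subgroup S A" "group A" "card S = 2 ^ k" and h: "h \<in> hom (A\<lparr>carrier := S\<rparr>) G"
  obtains m where "m \<in> carrier M" "\<And>g. g \<in> S \<Longrightarrow> \<exists>v\<in>P. h g m = m \<otimes> v"
proof -
  have "{C \<in> lcosets P. \<exists>g\<in>S. h g ` C \<noteq> C} \<noteq> lcosets P"
  proof
    assume eq: "{C \<in> lcosets P. \<exists>g\<in>S. h g ` C \<noteq> C} = lcosets P"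
    have "2 dvd card (lcosets P)" using moved_cosets[OF S(1,2) two_is_prime_nat S(3) h] unfolding eq .
    then show False using card_cosets by simp
  qed
  then obtain C where C: "C \<in> lcosets P" "\<And>g. g \<in> S \<Longrightarrow> h g ` C = C" by blast
  then obtain m where m: "m \<in> carrier M" "C = m <#\<^bsub>M\<^esub> P" by (auto simp: LCOSETS_def)
  have "\<exists>v\<in>P. h g m = m \<otimes> v" if "g \<in> S" for g
  proof -
    have "m \<in> C" using m lcos_self[OF m(1) P] by simp
    then have "h g m \<in> m <#\<^bsub>M\<^esub> P" using C(2)[OF that] m(2) by blast
    then show ?thesis by (auto simp: l_coset_def)
  qed
  then show ?thesis using that m(1) by blast
qed

text \<open>Suppose that \<open>S\<close> contained a subgroup \<open>T\<close> of odd prime order \<open>q\<close>. It fixes the coset of \<open>m\<close>, and the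
number of cosets that it moves is at most 2 and divisible by \<open>q\<close>; so it fixes all three. An element
\<open>g \<in> T\<close> that fixes \<open>xP\<close> maps \<open>x\<close> to \<open>xv\<close> with \<open>v \<in> P\<close>, and its powers map \<open>x\<close> to \<open>x\<close> times the powers of \<open>v\<close>; since \<open>v\<close> has
2-power order and \<open>g\<close> has odd order, \<open>v = 1\<close>. So \<open>T\<close> is trivial.\<close>

lemma point_stabilizer_card:
  assumes S: "subgroup S G" and m: "m \<in> carrier M" and fix_m: "\<And>f. f \<in> S \<Longrightarrow> f m = m"
  shows "\<exists>k. card S = 2 ^ k"
proof (rule ccontr)
  assume no_power: "\<not> ?thesis"
  have SG: "S \<subseteq> carrier G" using S by (rule subgroup.subset)
  have finS: "finite S" using finite_subset[OF SG finite_G] .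
  then have "card S \<noteq> 0" using subgroup.one_closed[OF S] by auto
  obtain q where q: "Factorial_Ring.prime q" "q dvd card S" "q \<noteq> 2"
    using no_power Ex_other_prime_factor[of "card S" 2] \<open>card S \<noteq> 0\<close> two_is_prime_nat
    by (auto dest: in_prime_factors_imp_prime in_prime_factors_imp_dvd)
  let ?S = "G\<lparr>carrier := S\<rparr>"
  interpret S: group ?S using subgroup.subgroup_is_group[OF S group_G] .
  obtain r where "order ?S = q ^ 1 * r" using q(2) by (auto simp: order_def dvd_def)
  from sylow_thm[OF q(1) S.group_axioms this] finS
  obtain T where T: "subgroup T ?S" "card T = q ^ 1" by auto
  have TS: "T \<subseteq> S" using subgroup.subset[OF T(1)] by simp
  have TG: "subgroup T G" using G.incl_subgroup[OF S T(1)] .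
  have idh: "(\<lambda>g. g) \<in> hom (G\<lparr>carrier := T\<rparr>) G" using TS SG by (auto simp: hom_def)
  let ?moved = "{C \<in> lcosets P. \<exists>g\<in>T. g ` C \<noteq> C}"
  have "m <#\<^bsub>M\<^esub> P \<in> lcosets P" using m by (auto simp: LCOSETS_def)
  moreover have "g ` (m <#\<^bsub>M\<^esub> P) = m <#\<^bsub>M\<^esub> P" if "g \<in> T" for g
  proof -
    have "g \<in> S" "g \<in> carrier G" using that TS SG by blast+
    then show ?thesis using image_coset[OF _ m] fix_m[of g] by simp
  qed
  ultimately have sub: "?moved \<subseteq> lcosets P - {m <#\<^bsub>M\<^esub> P}" by blast
  have fin: "finite (lcosets P)" using card_cosets card.infinite by fastforce
  have "card ?moved \<le> card (lcosets P - {m <#\<^bsub>M\<^esub> P})" using sub fin by (intro card_mono) simp_all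
  also have "\<dots> = 2" using card_cosets \<open>m <#\<^bsub>M\<^esub> P \<in> lcosets P\<close> by simp
  finally have "card ?moved < q" using q prime_ge_2_nat[OF q(1)] by linarith
  moreover have "q dvd card ?moved" using moved_cosets[OF TG group_G q(1) T(2) idh] .
  ultimately have "card ?moved = 0" using dvd_imp_le[of q "card ?moved"] by linarith
  then have none: "?moved = {}" using fin by simp
  have all_fixed: "g ` C = C" if gC: "g \<in> T" "C \<in> lcosets P" for g C
  proof (rule ccontr)
    assume "g ` C \<noteq> C"
    then have "C \<in> ?moved" using gC by (intro CollectI conjI bexI[of _ g])
    then show False unfolding none by (rule emptyE)
  qed
  have "g = \<one>\<^bsub>G\<^esub>" if g: "g \<in> T" for g
  proof (rule G_eqI)
    show gG: "g \<in> carrier G" using g TS SG by blast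
    fix x assume x: "x \<in> carrier M"
    have "x <#\<^bsub>M\<^esub> P \<in> lcosets P" using x by (auto simp: LCOSETS_def)
    then have "g x \<in> x <#\<^bsub>M\<^esub> P" using all_fixed[OF g] lcos_self[OF x P] by blast
    then obtain v where v: "v \<in> P" "g x = x \<otimes> v" by (auto simp: l_coset_def)
    have vM: "v \<in> carrier M" using v PM by blast
    have pow: "(g [^]\<^bsub>G\<^esub> k) x = x \<otimes> v [^] k \<and> v [^] k \<in> P" for k :: nat
    proof (induction k)
      case 0
      show ?case using x one_apply subgroup.one_closed[OF P] by simp
    next
      case (Suc k)
      have "(g [^]\<^bsub>G\<^esub> Suc k) x = (g [^]\<^bsub>G\<^esub> k) (x \<otimes> v)"
        using mult_apply[of "g [^]\<^bsub>G\<^esub> k" g x] gG x v by simp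
      also have "\<dots> = x \<otimes> v [^] k \<otimes> v" using G_right[of "g [^]\<^bsub>G\<^esub> k" x v] gG x v Suc by simp
      finally show ?case using x vM Suc v subgroup.m_closed[OF P] by (simp add: m_assoc)
    qed
    have "g [^]\<^bsub>G\<^esub> card T = \<one>\<^bsub>G\<^esub>"
    proof -
      interpret T: group "G\<lparr>carrier := T\<rparr>" using subgroup.subgroup_is_group[OF TG group_G] .
      have "g [^]\<^bsub>G\<lparr>carrier := T\<rparr>\<^esub> order (G\<lparr>carrier := T\<rparr>) = \<one>\<^bsub>G\<lparr>carrier := T\<rparr>\<^esub>"
        using g by (intro T.pow_order_eq_1) simp
      then show ?thesis using G.nat_pow_consistent[of g "card T" T] by (simp add: order_def)
    qed
    then have "x \<otimes> v [^] q = x" using pow[of q] T(2) one_apply[OF x] by simp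
    then have "v [^] q = \<one>" using x vM by simp
    moreover have "v [^] (2 ^ n :: nat) = \<one>"
    proof -
      interpret Pg: group "M\<lparr>carrier := P\<rparr>" using subgroup.subgroup_is_group[OF P group_axioms] .
      have "v [^]\<^bsub>M\<lparr>carrier := P\<rparr>\<^esub> order (M\<lparr>carrier := P\<rparr>) = \<one>\<^bsub>M\<lparr>carrier := P\<rparr>\<^esub>"
        using v by (intro Pg.pow_order_eq_1) simp
      then show ?thesis using nat_pow_consistent[of v "2 ^ n" P] by (simp add: order_def card_P)
    qed
    ultimately have "ord v dvd q" "ord v dvd 2 ^ n" using pow_eq_id[OF vM] by blast+
    moreover have "coprime q (2 ^ n)" using primes_coprime[OF q(1) two_is_prime_nat q(3)] by (rule coprime_power_right_iff[THEN iffD2, OF disjI1])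
    ultimately have "ord v = 1" using coprime_common_divisor by fastforce
    then have "v = \<one>" using ord_eq_1[OF vM] by simp
    then show "g x = \<one>\<^bsub>G\<^esub> x" using v x one_apply by simp
  qed simp
  then have "T \<subseteq> {\<one>\<^bsub>G\<^esub>}" by blast
  then have "card T \<le> 1" using card_mono[of "{\<one>\<^bsub>G\<^esub>}" T] by simp
  then show False using T(2) prime_gt_1_nat[OF q(1)] by simp
qed

text \<open>\<open>Q\<close> fixes some coset \<open>mP\<close>. If \<open>c\<close> centralizes \<open>Q\<close>, then \<open>Q\<close> acts on \<open>cm\<close> by the same right
multiplications as on \<open>m\<close>, so \<open>z = (cm)m\<^sup>-\<^sup>1 \<in> M\<close> centralizes the preimage of \<open>Q\<close> in \<open>M\<close>. Left multiplication by
\<open>z\<close> maps \<open>m\<close> to \<open>cm\<close>, so it differs from \<open>c\<close> by an element of \<open>C\<^sub>G(Q)\<close> that fixes \<open>m\<close>. The set \<open>S\<close> of all such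
elements is a 2-group.\<close>

lemma centralizer_factorization:
  assumes Q: "subgroup Q G" "card Q = 2 ^ k" "Q \<subseteq> emb ` carrier M"
  shows "\<exists>S a. subgroup S G \<and> card S = 2 ^ a \<and> S \<subseteq> centralizer G Q \<and>
    (\<forall>c\<in>centralizer G Q. \<exists>s\<in>S. \<exists>l\<in>emb ` carrier M. c = s \<otimes>\<^bsub>G\<^esub> l)"
proof -
  have QG: "Q \<subseteq> carrier G" using Q(1) by (rule subgroup.subset)
  have "(\<lambda>g. g) \<in> hom (G\<lparr>carrier := Q\<rparr>) G" using QG by (auto simp: hom_def)
  from fixed_coset[OF Q(1) group_G Q(2) this]
  obtain m where m: "m \<in> carrier M" "\<And>q. q \<in> Q \<Longrightarrow> \<exists>v\<in>P. q m = m \<otimes> v" by blast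
  let ?C = "centralizer G Q"
  have C: "subgroup ?C G" by (rule G.centralizer_subgroup) fact
  have CG: "?C \<subseteq> carrier G" using C by (rule subgroup.subset)
  define S where "S = {f \<in> ?C. f m = m}"
  have S: "subgroup S G"
  proof
    show "S \<subseteq> carrier G" using CG by (auto simp: S_def)
    show "\<one>\<^bsub>G\<^esub> \<in> S" using subgroup.one_closed[OF C] one_apply m(1) by (simp add: S_def)
    fix f assume f: "f \<in> S"
    then have fG: "f \<in> carrier G" using CG by (auto simp: S_def)
    show "inv\<^bsub>G\<^esub> f \<in> S"
      using f subgroup.m_inv_closed[OF C] inv_apply[OF fG m(1)] by (simp add: S_def)
    fix g assume g: "g \<in> S"
    then have gG: "g \<in> carrier G" using CG by (auto simp: S_def)
    show "f \<otimes>\<^bsub>G\<^esub> g \<in> S"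
      using f g subgroup.m_closed[OF C] mult_apply[OF fG gG m(1)] by (simp add: S_def)
  qed
  obtain a where "card S = 2 ^ a"
    using point_stabilizer_card[OF S m(1)] by (auto simp: S_def)
  moreover have "\<exists>s\<in>S. \<exists>l\<in>emb ` carrier M. c = s \<otimes>\<^bsub>G\<^esub> l" if c: "c \<in> ?C" for c
  proof -
    \<comment> \<open>The argument gives a factor in \<open>L\<close> on the left, so it is applied to the inverse.\<close>
    define c' where "c' = inv\<^bsub>G\<^esub> c"
    have c': "c' \<in> ?C" "c' \<in> carrier G" "c \<in> carrier G"
      using c CG subgroup.m_inv_closed[OF C c] by (auto simp: c'_def)
    have c'm: "c' m \<in> carrier M" using G_closed c'(2) m(1) .
    define z where "z = c' m \<otimes> inv m"
    have z: "z \<in> carrier M" using c'm m(1) by (simp add: z_def)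
    define d where "d = emb z"
    have dG: "d \<in> carrier G" using emb_closed z by (simp add: d_def)
    have "d \<otimes>\<^bsub>G\<^esub> q = q \<otimes>\<^bsub>G\<^esub> d" if q: "q \<in> Q" for q
    proof -
      obtain u where u: "u \<in> carrier M" "q = emb u" using Q(3) q by blast
      obtain v where v: "v \<in> P" "q m = m \<otimes> v" using m(2)[OF q] by blast
      have vM: "v \<in> carrier M" using v PM by blast
      have qG: "q \<in> carrier G" using q QG by blast
      have um: "u \<otimes> m = m \<otimes> v" using v u m(1) by (simp add: emb_apply)
      have "u \<otimes> c' m = (q \<otimes>\<^bsub>G\<^esub> c') m" using mult_apply[OF qG c'(2) m(1)] u c'm by (simp add: emb_apply)
      also have "q \<otimes>\<^bsub>G\<^esub> c' = c' \<otimes>\<^bsub>G\<^esub> q" using c'(1) q by (simp add: centralizer_def)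
      also have "(c' \<otimes>\<^bsub>G\<^esub> q) m = c' m \<otimes> v"
        using mult_apply[OF c'(2) qG m(1)] v G_right[OF c'(2) m(1)] by simp
      finally have ucm: "u \<otimes> c' m = c' m \<otimes> v" .
      have "m \<otimes> v \<otimes> inv m = u" using um u m(1) vM by (metis inv_solve_right m_closed)
      then have minv: "inv m \<otimes> u = v \<otimes> inv m" using um u m(1) vM by (simp add: cancel_inv m_assoc flip: \<open>m \<otimes> v \<otimes> inv m = u\<close>)
      have "z \<otimes> u = c' m \<otimes> (inv m \<otimes> u)" using c'm m(1) u by (simp add: z_def m_assoc)
      also have "\<dots> = (c' m \<otimes> v) \<otimes> inv m" unfolding minv using c'm m(1) vM by (simp add: m_assoc)
      also have "\<dots> = u \<otimes> z" unfolding ucm[symmetric] using c'm m(1) u by (simp add: z_def m_assoc)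
      finally have "z \<otimes> u = u \<otimes> z" .
      then show ?thesis using emb_mult[OF z u(1)] emb_mult[OF u(1) z] u(2) by (simp add: d_def)
    qed
    then have dC: "d \<in> ?C" using dG by (simp add: centralizer_def)
    define s where "s = inv\<^bsub>G\<^esub> d \<otimes>\<^bsub>G\<^esub> c'"
    have "d m = z \<otimes> m" unfolding d_def by (rule emb_apply[OF z m(1)])
    then have "d m = c' m" using m(1) c'm by (simp add: z_def m_assoc)
    then have "s m = m"
      using mult_apply[of "inv\<^bsub>G\<^esub> d" c' m] inv_apply[OF dG m(1)] dG c'(2) m(1) by (simp add: s_def)
    moreover have "s \<in> ?C"
      unfolding s_def using subgroup.m_closed[OF C subgroup.m_inv_closed[OF C dC] c'(1)] .
    ultimately have "s \<in> S" by (simp add: S_def)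
    moreover have "c = inv\<^bsub>G\<^esub> s \<otimes>\<^bsub>G\<^esub> inv\<^bsub>G\<^esub> d"
      using dG c'(2,3) by (simp add: s_def c'_def G.inv_mult_group G.m_assoc)
    moreover have "inv\<^bsub>G\<^esub> d \<in> emb ` carrier M"
      using subgroup.m_inv_closed[OF subgroup_emb_M] z by (simp add: d_def)
    ultimately show ?thesis using subgroup.m_inv_closed[OF S] by blast
  qed
  moreover have "S \<subseteq> ?C" by (auto simp: S_def)
  ultimately show ?thesis using S by (intro exI[of _ S] exI[of _ a] conjI ballI)
qed

text \<open>The conjugate \<open>Q\<^sup>x\<close> fixes some coset \<open>mP\<close>. If \<open>q \<in> Q\<close> is left multiplication by \<open>u\<close> and \<open>q\<^sup>x\<close> is left
multiplication by \<open>w\<close>, then \<open>w m = m v\<close> with \<open>v \<in> P\<close>. Applying \<open>x\<close>, which commutes with right multiplication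
by \<open>v\<close>, gives \<open>u (x m) = (x m) v\<close>. So \<open>z = m (x m)\<^sup>-\<^sup>1\<close>, which does not depend on \<open>q\<close>, conjugates \<open>u\<close> to \<open>w\<close>,
that is, \<open>q\<close> to \<open>q\<^sup>x\<close>, and \<open>x \<iota>(z)\<close> centralizes \<open>Q\<close>.\<close>

lemma conjugating_element_factorization:
  assumes Q: "subgroup Q G" "card Q = 2 ^ k" "Q \<subseteq> emb ` carrier M"
    and x: "x \<in> carrier G" and conj: "\<And>q. q \<in> Q \<Longrightarrow> inv\<^bsub>G\<^esub> x \<otimes>\<^bsub>G\<^esub> q \<otimes>\<^bsub>G\<^esub> x \<in> emb ` carrier M"
  shows "\<exists>c\<in>centralizer G Q. \<exists>l\<in>emb ` carrier M. x = c \<otimes>\<^bsub>G\<^esub> l"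
proof -
  have QG: "Q \<subseteq> carrier G" using Q(1) by (rule subgroup.subset)
  have "(\<lambda>q. inv\<^bsub>G\<^esub> x \<otimes>\<^bsub>G\<^esub> q \<otimes>\<^bsub>G\<^esub> x) \<in> hom (G\<lparr>carrier := Q\<rparr>) G"
    using QG x by (auto intro!: homI simp: G.m_assoc G.cancel_inv subset_iff)
  from fixed_coset[OF Q(1) group_G Q(2) this]
  obtain m where m: "m \<in> carrier M"
    "\<And>q. q \<in> Q \<Longrightarrow> \<exists>v\<in>P. (inv\<^bsub>G\<^esub> x \<otimes>\<^bsub>G\<^esub> q \<otimes>\<^bsub>G\<^esub> x) m = m \<otimes> v" by blast
  have xm: "x m \<in> carrier M" using G_closed x m(1) .
  define z where "z = m \<otimes> inv (x m)"
  have z: "z \<in> carrier M" using m(1) xm by (simp add: z_def)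
  define c where "c = x \<otimes>\<^bsub>G\<^esub> emb z"
  have cG: "c \<in> carrier G" using x emb_closed[OF z] by (simp add: c_def)
  have "c \<otimes>\<^bsub>G\<^esub> q = q \<otimes>\<^bsub>G\<^esub> c" if q: "q \<in> Q" for q
  proof -
    obtain u where u: "u \<in> carrier M" "q = emb u" using Q(3) q by blast
    obtain w where w: "w \<in> carrier M" "inv\<^bsub>G\<^esub> x \<otimes>\<^bsub>G\<^esub> q \<otimes>\<^bsub>G\<^esub> x = emb w" using conj[OF q] by blast
    obtain v where v: "v \<in> P" "emb w m = m \<otimes> v" using m(2)[OF q] w by auto
    have vM: "v \<in> carrier M" using v PM by blast
    have qG: "q \<in> carrier G" and wG: "emb w \<in> carrier G" using q QG emb_closed w by blast+
    have wm: "w \<otimes> m = m \<otimes> v" using v w m(1) by (simp add: emb_apply)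
    have xw: "x \<otimes>\<^bsub>G\<^esub> emb w = q \<otimes>\<^bsub>G\<^esub> x"
      unfolding w(2)[symmetric] using x qG by (simp add: G.m_assoc G.cancel_inv)
    have "u \<otimes> x m = (q \<otimes>\<^bsub>G\<^esub> x) m" using mult_apply[OF qG x m(1)] u xm by (simp add: emb_apply)
    also have "\<dots> = x m \<otimes> v"
      unfolding xw[symmetric] using mult_apply[OF x wG m(1)] v G_right[OF x m(1)] by simp
    finally have uxm: "u \<otimes> x m = x m \<otimes> v" .
    have "inv (x m) \<otimes> u = v \<otimes> inv (x m)"
      using uxm u xm vM by (metis inv_solve_left inv_solve_right m_assoc m_closed inv_closed)
    then have "z \<otimes> u = (m \<otimes> v) \<otimes> inv (x m)" using m(1) xm u vM by (simp add: z_def m_assoc)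
    also have "\<dots> = w \<otimes> z" unfolding wm[symmetric] using m(1) xm w by (simp add: z_def m_assoc)
    finally have "emb z \<otimes>\<^bsub>G\<^esub> q = emb w \<otimes>\<^bsub>G\<^esub> emb z" using emb_mult[OF z u(1)] emb_mult[OF w(1) z] u(2) by simp
    then have "c \<otimes>\<^bsub>G\<^esub> q = (x \<otimes>\<^bsub>G\<^esub> emb w) \<otimes>\<^bsub>G\<^esub> emb z"
      using x emb_closed[OF z] qG wG by (simp add: c_def G.m_assoc)
    then show ?thesis unfolding xw using x emb_closed[OF z] qG by (simp add: c_def G.m_assoc)
  qed
  then have "c \<in> centralizer G Q" using cG by (simp add: centralizer_def)
  moreover have "x = c \<otimes>\<^bsub>G\<^esub> inv\<^bsub>G\<^esub> (emb z)" using x emb_closed[OF z] by (simp add: c_def G.m_assoc)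
  moreover have "inv\<^bsub>G\<^esub> (emb z) \<in> emb ` carrier M"
    using subgroup.m_inv_closed[OF subgroup_emb_M] z by simp
  ultimately show ?thesis by blast
qed

text \<open>The elements \<open>y\<close> that conjugate \<open>Q\<close> into \<open>L\<close> form a single double coset \<open>S x0 L\<close>, so that \<open>S\<close> is
transitive on the fixed points of \<open>Q\<close> in \<open>G/L\<close>. Replacing \<open>Q\<close> by its conjugate under \<open>x0\<close> reduces this to
the two factorizations for subgroups of \<open>L\<close>.\<close>

lemma conjugating_elements_double_coset:
  assumes Q: "subgroup Q G" "card Q = 2 ^ k"
    and x0: "x0 \<in> carrier G" "\<And>q. q \<in> Q \<Longrightarrow> inv\<^bsub>G\<^esub> x0 \<otimes>\<^bsub>G\<^esub> q \<otimes>\<^bsub>G\<^esub> x0 \<in> emb ` carrier M"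
  shows "\<exists>S a. subgroup S G \<and> card S = 2 ^ a \<and> S \<subseteq> centralizer G Q \<and>
    (\<forall>y\<in>carrier G. (\<forall>q\<in>Q. inv\<^bsub>G\<^esub> y \<otimes>\<^bsub>G\<^esub> q \<otimes>\<^bsub>G\<^esub> y \<in> emb ` carrier M) \<longrightarrow>
      (\<exists>s\<in>S. \<exists>l\<in>emb ` carrier M. y = s \<otimes>\<^bsub>G\<^esub> x0 \<otimes>\<^bsub>G\<^esub> l))"
proof -
  have QG: "q \<in> carrier G" if "q \<in> Q" for q using that Q(1) subgroup.subset by blast
  define Q0 where "Q0 = (\<lambda>q. inv\<^bsub>G\<^esub> x0 \<otimes>\<^bsub>G\<^esub> q \<otimes>\<^bsub>G\<^esub> x0) ` Q"
  have Q0: "subgroup Q0 G" "card Q0 = 2 ^ k" "Q0 \<subseteq> emb ` carrier M"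
    using G.conjugate_subgroup[OF Q(1), of "inv\<^bsub>G\<^esub> x0"] x0 Q(2) by (auto simp: Q0_def)
  obtain S0 a where S0: "subgroup S0 G" "card S0 = 2 ^ a" "S0 \<subseteq> centralizer G Q0"
    and fac: "\<And>c. c \<in> centralizer G Q0 \<Longrightarrow> \<exists>s\<in>S0. \<exists>l\<in>emb ` carrier M. c = s \<otimes>\<^bsub>G\<^esub> l"
    using centralizer_factorization[OF Q0] by blast
  have S0G: "s \<in> carrier G" if "s \<in> S0" for s using that S0(1) subgroup.subset by blast
  have LG: "l \<in> carrier G" if "l \<in> emb ` carrier M" for l using that emb_closed by blast
  define S where "S = (\<lambda>s. x0 \<otimes>\<^bsub>G\<^esub> s \<otimes>\<^bsub>G\<^esub> inv\<^bsub>G\<^esub> x0) ` S0"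
  have S: "subgroup S G" "card S = 2 ^ a"
    using G.conjugate_subgroup[OF S0(1) x0(1)] S0(2) by (auto simp: S_def)
  moreover have "S \<subseteq> centralizer G Q"
  proof
    fix t assume "t \<in> S"
    then obtain s where s: "s \<in> S0" "t = x0 \<otimes>\<^bsub>G\<^esub> s \<otimes>\<^bsub>G\<^esub> inv\<^bsub>G\<^esub> x0" by (auto simp: S_def)
    have sG: "s \<in> carrier G" by (rule S0G) fact
    have "t \<otimes>\<^bsub>G\<^esub> q = q \<otimes>\<^bsub>G\<^esub> t" if q: "q \<in> Q" for q
    proof -
      have qG: "q \<in> carrier G" by (rule QG) fact
      have "s \<otimes>\<^bsub>G\<^esub> (inv\<^bsub>G\<^esub> x0 \<otimes>\<^bsub>G\<^esub> q \<otimes>\<^bsub>G\<^esub> x0) = (inv\<^bsub>G\<^esub> x0 \<otimes>\<^bsub>G\<^esub> q \<otimes>\<^bsub>G\<^esub> x0) \<otimes>\<^bsub>G\<^esub> s"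
        using S0(3) s(1) q unfolding centralizer_def Q0_def by blast
      then have "x0 \<otimes>\<^bsub>G\<^esub> (s \<otimes>\<^bsub>G\<^esub> (inv\<^bsub>G\<^esub> x0 \<otimes>\<^bsub>G\<^esub> q \<otimes>\<^bsub>G\<^esub> x0)) \<otimes>\<^bsub>G\<^esub> inv\<^bsub>G\<^esub> x0
        = x0 \<otimes>\<^bsub>G\<^esub> ((inv\<^bsub>G\<^esub> x0 \<otimes>\<^bsub>G\<^esub> q \<otimes>\<^bsub>G\<^esub> x0) \<otimes>\<^bsub>G\<^esub> s) \<otimes>\<^bsub>G\<^esub> inv\<^bsub>G\<^esub> x0" by simp
      then show ?thesis using s(2) sG qG x0(1) by (simp add: G.m_assoc G.cancel_inv)
    qed
    then show "t \<in> centralizer G Q" using s(2) sG x0(1) by (simp add: centralizer_def)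
  qed
  moreover have "\<exists>s\<in>S. \<exists>l\<in>emb ` carrier M. y = s \<otimes>\<^bsub>G\<^esub> x0 \<otimes>\<^bsub>G\<^esub> l"
    if y: "y \<in> carrier G" "\<forall>q\<in>Q. inv\<^bsub>G\<^esub> y \<otimes>\<^bsub>G\<^esub> q \<otimes>\<^bsub>G\<^esub> y \<in> emb ` carrier M" for y
  proof -
    define x where "x = inv\<^bsub>G\<^esub> x0 \<otimes>\<^bsub>G\<^esub> y"
    have xG: "x \<in> carrier G" using x0 y by (simp add: x_def)
    have "inv\<^bsub>G\<^esub> x \<otimes>\<^bsub>G\<^esub> q0 \<otimes>\<^bsub>G\<^esub> x \<in> emb ` carrier M" if "q0 \<in> Q0" for q0
    proof -
      obtain q where q: "q \<in> Q" "q0 = inv\<^bsub>G\<^esub> x0 \<otimes>\<^bsub>G\<^esub> q \<otimes>\<^bsub>G\<^esub> x0" using \<open>q0 \<in> Q0\<close> by (auto simp: Q0_def)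
      have "inv\<^bsub>G\<^esub> x \<otimes>\<^bsub>G\<^esub> q0 \<otimes>\<^bsub>G\<^esub> x = inv\<^bsub>G\<^esub> y \<otimes>\<^bsub>G\<^esub> q \<otimes>\<^bsub>G\<^esub> y"
        using q QG[OF q(1)] x0(1) y(1) by (simp add: x_def G.inv_mult_group G.m_assoc G.cancel_inv)
      then show ?thesis using y(2) q(1) by simp
    qed
    then obtain c l where c: "c \<in> centralizer G Q0" "l \<in> emb ` carrier M" "x = c \<otimes>\<^bsub>G\<^esub> l"
      using conjugating_element_factorization[OF Q0 xG] by blast
    obtain s l' where s: "s \<in> S0" "l' \<in> emb ` carrier M" "c = s \<otimes>\<^bsub>G\<^esub> l'" using fac[OF c(1)] by blast
    have mem: "s \<in> carrier G" "l \<in> carrier G" "l' \<in> carrier G" using S0G LG s c by blast+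
    have "y = x0 \<otimes>\<^bsub>G\<^esub> x" using x0(1) y(1) by (simp add: x_def G.cancel_inv)
    also have "\<dots> = (x0 \<otimes>\<^bsub>G\<^esub> s \<otimes>\<^bsub>G\<^esub> inv\<^bsub>G\<^esub> x0) \<otimes>\<^bsub>G\<^esub> x0 \<otimes>\<^bsub>G\<^esub> (l' \<otimes>\<^bsub>G\<^esub> l)"
      unfolding c(3) s(3) using mem x0(1) by (simp add: G.m_assoc G.cancel_inv)
    finally show ?thesis
      using s(1) subgroup.m_closed[OF subgroup_emb_M s(2) c(2)] unfolding S_def by blast
  qed
  ultimately show ?thesis by blast
qed

text \<open>The double coset lemma for \<open>Q = 1\<close> gives the factorization \<open>G = SL\<close> that is needed to identify the Scott
module; for general \<open>Q\<close> it gives the transitivity needed for the Brauer quotient.\<close>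

theorem scott_module_brauer_indecomposable:
  fixes K :: "('k, 'r) ring_scheme" and V :: "('k, 'v, 'a \<Rightarrow> 'a) gmodule"
  assumes K: "field K" and char_2: "\<one>\<^bsub>K\<^esub> \<oplus>\<^bsub>K\<^esub> \<one>\<^bsub>K\<^esub> = \<zero>\<^bsub>K\<^esub>"
    and scott: "is_scott_module K G (emb ` P) V"
  shows "brauer_indecomposable 2 K G V"
proof -
  interpret char2: finite_group_char_2 G K
    by (rule finite_group_char_2.intro[OF group_G K],
        rule finite_group_char_2_axioms.intro[OF finite_G char_2])
  have transitive: "\<exists>S a. subgroup S G \<and> card S = 2 ^ a \<and> S \<subseteq> centralizer G Q \<and>
      (\<forall>y\<in>char2.conjugated_into Q (emb ` carrier M).
        \<exists>s\<in>S. \<exists>l\<in>emb ` carrier M. y = s \<otimes>\<^bsub>G\<^esub> x0 \<otimes>\<^bsub>G\<^esub> l)"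
    if Q: "subgroup Q G" "card Q = 2 ^ k" and x0: "x0 \<in> char2.conjugated_into Q (emb ` carrier M)"
    for Q k x0
  proof -
    have x0G: "x0 \<in> carrier G"
      and conj: "\<And>q. q \<in> Q \<Longrightarrow> inv\<^bsub>G\<^esub> x0 \<otimes>\<^bsub>G\<^esub> q \<otimes>\<^bsub>G\<^esub> x0 \<in> emb ` carrier M"
      using x0 unfolding char2.conjugated_into_def by blast+
    obtain S a where S: "subgroup S G" "card S = 2 ^ a" "S \<subseteq> centralizer G Q"
      and eq: "\<forall>y\<in>carrier G. (\<forall>q\<in>Q. inv\<^bsub>G\<^esub> y \<otimes>\<^bsub>G\<^esub> q \<otimes>\<^bsub>G\<^esub> y \<in> emb ` carrier M) \<longrightarrow>
        (\<exists>s\<in>S. \<exists>l\<in>emb ` carrier M. y = s \<otimes>\<^bsub>G\<^esub> x0 \<otimes>\<^bsub>G\<^esub> l)"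
      using conjugating_elements_double_coset[OF Q x0G conj] by blast
    have "\<forall>y\<in>char2.conjugated_into Q (emb ` carrier M).
        \<exists>s\<in>S. \<exists>l\<in>emb ` carrier M. y = s \<otimes>\<^bsub>G\<^esub> x0 \<otimes>\<^bsub>G\<^esub> l"
      using eq unfolding char2.conjugated_into_def by blast
    then show ?thesis using S by (intro exI[of _ S] exI[of _ a] conjI)
  qed
  have kG: "kG_module K G V" using scott by (simp add: is_scott_module_def)
  have L1: "\<one>\<^bsub>G\<^esub> \<in> emb ` carrier M" using subgroup.one_closed[OF subgroup_emb_M] .
  have triv: "subgroup {\<one>\<^bsub>G\<^esub>} G" by (rule G.triv_subgroup)
  obtain S a where S: "subgroup S G" "card S = 2 ^ a"
    and G_eq: "\<And>x. x \<in> carrier G \<Longrightarrow> \<exists>s\<in>S. \<exists>l\<in>emb ` carrier M. x = s \<otimes>\<^bsub>G\<^esub> l"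
  proof -
    have "\<one>\<^bsub>G\<^esub> \<in> char2.conjugated_into {\<one>\<^bsub>G\<^esub>} (emb ` carrier M)"
      using L1 by (simp add: char2.conjugated_into_def)
    from transitive[OF triv _ this, of 0] obtain S a where S: "subgroup S G" "card S = 2 ^ a"
      and eq: "\<And>y. y \<in> char2.conjugated_into {\<one>\<^bsub>G\<^esub>} (emb ` carrier M) \<Longrightarrow>
        \<exists>s\<in>S. \<exists>l\<in>emb ` carrier M. y = s \<otimes>\<^bsub>G\<^esub> \<one>\<^bsub>G\<^esub> \<otimes>\<^bsub>G\<^esub> l" by auto
    have "\<exists>s\<in>S. \<exists>l\<in>emb ` carrier M. x = s \<otimes>\<^bsub>G\<^esub> l" if "x \<in> carrier G" for x
    proof -
      have "x \<in> char2.conjugated_into {\<one>\<^bsub>G\<^esub>} (emb ` carrier M)"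
        using that L1 by (simp add: char2.conjugated_into_def)
      from eq[OF this] show ?thesis using subgroup.mem_carrier[OF S(1)] by auto
    qed
    then show ?thesis using that S by blast
  qed
  obtain \<psi> where \<psi>: "kG_iso K G V (char2.perm_module (emb ` carrier M)) \<psi>"
    using char2.scott_module_iso_perm_module[OF scott subgroup_emb_M subgroup_emb_P _ _ S G_eq]
      PM card_emb_cosets by auto
  show ?thesis
    unfolding brauer_indecomposable_def
  proof (intro allI impI)
    fix Q assume "p_subgroup 2 G Q"
    then obtain k where Q: "subgroup Q G" "card Q = 2 ^ k" by (auto simp: p_subgroup_def)
    interpret perm_module_copy G K V "emb ` carrier M" \<psi> Q k
      by (intro perm_module_copy.intro perm_module_copy_axioms.intro char2.finite_group_char_2_axioms
          kG subgroup_emb_M \<psi> Q)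
    show "kG_indecomposable K (G\<lparr>carrier := Q <#>\<^bsub>G\<^esub> centralizer G Q\<rparr>) (brauer_quotient G V Q) \<or>
        kG_zero (brauer_quotient G V Q)"
      by (rule brauer_quotient_indecomposable_or_zero) (rule transitive[OF Q card_Q])
  qed
qed

end

theorem theorem1p3:
  fixes K :: "('k, 'n) ring_scheme"
    and M :: "('a, 'm) monoid_scheme"
    and P :: "'a set"
    and F :: "'a fusion_system"
    and G :: "('a \<Rightarrow> 'a) monoid"
    and V :: "('k, 'v, 'a \<Rightarrow> 'a) gmodule"
    and n :: nat
  assumes "algebraically_closed K" and "ring_char K = 2"
    and "group M" and "finite (carrier M)" and "n \<ge> 3" and "order M = 3 * 2 ^ n"
    and "p_length 2 M = 2" and "p'_core 2 M = {\<one>\<^bsub>M\<^esub>}"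
    and "sylow_subgroup 2 M P"
    and "F = group_fusion_system M P"
    and "G = park_group F M"
    and "is_scott_module K G (park_embedding M ` P) V"
  shows "brauer_indecomposable 2 K G V"
proof -
  have mult: "multiplicity 2 (3 * 2 ^ n :: nat) = n"
    by (intro multiplicity_eqI) auto
  have P: "subgroup P M" "card P = 2 ^ n"
    using assms(9) unfolding sylow_subgroup_def assms(6) mult by blast+
  have fs: "fs_group F = P" unfolding assms(10) group_fusion_system_def by simp
  have K: "field K" by (rule algebraically_closed.axioms(1)[OF assms(1)])
  have char_2: "\<one>\<^bsub>K\<^esub> \<oplus>\<^bsub>K\<^esub> \<one>\<^bsub>K\<^esub> = \<zero>\<^bsub>K\<^esub>"
    by (rule ring.ring_char_2[OF cring.axioms(1)[OF fieldE(1)[OF K]] assms(2)])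
  have "park_index_3 M P F n G"
    by (rule park_index_3.intro[OF assms(3) park_index_3_axioms.intro[OF assms(4,6) P fs assms(11)]])
  then show ?thesis
    by (rule park_index_3.scott_module_brauer_indecomposable[OF _ K char_2 assms(12)])
qed

end
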